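(* Let $\mathcal{R}=(V,R)$ be the random graph and let $\mathrm{Aut}(\mathcal{R})$ be its automorphism group. Then the set of $f\in\mathrm{Aut}(\mathcal{R})$ satisfying both of the following properties is co-Haar null in $\mathrm{Aut}(\mathcal{R})$: (1) for every pair of finite disjoint sets $A,B\subset V$ there exists $v\in V$ such that $xRv$ for all $x\in A$, $\neg(yRv)$ for all $y\in B$, and $v\notin\mathcal{O}^f(A\cup B)$; (2) $f$ has only finitely many finite orbits. Moreover, a conjugacy class of $\mathrm{Aut}(\mathcal{R})$ is non-Haar null if and only if one (equivalently, each) of its elements has properties (1) and (2). Furthermore, every non-Haar null conjugacy class is a compact biter, and every non-Haar null conjugacy class whose elements have no finite orbits is a compact catcher.
   Context: The random graph $\mathcal{R}=(V,R)$ is the unique (up to isomorphism) countable graph such that for every pair of finite disjoint sets $A,B\subset V$ there is $v\in V$ with $xRv$ for all $x\in A$ and $\neg(yRv)$ for all $y\in B$. $\mathrm{Aut}(\mathcal{R})$ is a closed subgroup of the symmetric group of the countable set $V$ and is a Polish group with the topology of pointwise convergence. For $f\in\mathrm{Aut}(\mathcal{R})$ and $A\subset V$, $\mathcal{O}^f(A)=\{f^k(v):v\in A,k\in\mathbb{Z}\}$. A Borel subset $B$ of a Polish group $G$ is Haar null if there is a Borel probability measure $\mu$ on $G$ with $\mu(gBh)=0$ for all $g,h\in G$; an arbitrary set is Haar null if it is contained in a Borel Haar null set; co-Haar null means the complement is Haar null. A set $A\subset G$ is a compact catcher if for every compact $K\subset G$ there exist $g,h\in G$ with $gKh\subset A$;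 it is a compact biter if for every compact $K\subset G$ there exist an open set $U$ with $U\cap K\neq\emptyset$ and $g,h\in G$ with $g(U\cap K)h\subset A$. *)

theory Defs
  imports "HOL-Probability.Probability" "HOL-Algebra.Algebra"
begin

section \<open>Haar null sets, compact catchers and compact biters\<close>

text \<open>A (Polish) topological group is given by a group \<open>G\<close> in the sense of HOL-Algebra
  together with a topology \<open>T\<close> on its carrier.\<close>

definition borel_of :: "'a topology \<Rightarrow> 'a measure"
  where "borel_of T = sigma (topspace T) {U. openin T U}"

definition two_sided_translate :: "('a, 'm) monoid_scheme \<Rightarrow> 'a \<Rightarrow> 'a set \<Rightarrow> 'a \<Rightarrow> 'a set"
  where "two_sided_translate G g A h = (\<lambda>x. g \<otimes>\<^bsub>G\<^esub> x \<otimes>\<^bsub>G\<^esub> h) ` A"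

text \<open>Membership in \<^const>\<open>null_sets\<close> says that the translate is measurable and has measure 0;
  measurability is automatic when the translations are homeomorphisms.\<close>

definition borel_haar_null :: "('a, 'm) monoid_scheme \<Rightarrow> 'a topology \<Rightarrow> 'a set \<Rightarrow> bool"
  where "borel_haar_null G T B \<longleftrightarrow>
    B \<in> sets (borel_of T) \<and>
    (\<exists>\<mu>. prob_space \<mu> \<and> sets \<mu> = sets (borel_of T) \<and>
      (\<forall>g\<in>carrier G. \<forall>h\<in>carrier G. two_sided_translate G g B h \<in> null_sets \<mu>))"

definition haar_null :: "('a, 'm) monoid_scheme \<Rightarrow> 'a topology \<Rightarrow> 'a set \<Rightarrow> bool"
  where "haar_null G T A \<longleftrightarrow> (\<exists>B. borel_haar_null G T B \<and> A \<subseteq> B)"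

definition co_haar_null :: "('a, 'm) monoid_scheme \<Rightarrow> 'a topology \<Rightarrow> 'a set \<Rightarrow> bool"
  where "co_haar_null G T A \<longleftrightarrow> A \<subseteq> carrier G \<and> haar_null G T (carrier G - A)"

definition compact_catcher :: "('a, 'm) monoid_scheme \<Rightarrow> 'a topology \<Rightarrow> 'a set \<Rightarrow> bool"
  where "compact_catcher G T A \<longleftrightarrow>
    (\<forall>K. compactin T K \<longrightarrow>
      (\<exists>g\<in>carrier G. \<exists>h\<in>carrier G. two_sided_translate G g K h \<subseteq> A))"

text \<open>Only nonempty \<open>K\<close> are considered: no open set meets the empty set, so with \<open>K = {}\<close> allowed
  no set at all would be a compact biter.\<close>

definition compact_biter :: "('a, 'm) monoid_scheme \<Rightarrow> 'a topology \<Rightarrow> 'a set \<Rightarrow> bool"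
  where "compact_biter G T A \<longleftrightarrow>
    (\<forall>K. compactin T K \<and> K \<noteq> {} \<longrightarrow>
      (\<exists>U. openin T U \<and> U \<inter> K \<noteq> {} \<and>
        (\<exists>g\<in>carrier G. \<exists>h\<in>carrier G. two_sided_translate G g (U \<inter> K) h \<subseteq> A)))"

definition conjugacy_class :: "('a, 'm) monoid_scheme \<Rightarrow> 'a \<Rightarrow> 'a set"
  where "conjugacy_class G f = {g \<otimes>\<^bsub>G\<^esub> f \<otimes>\<^bsub>G\<^esub> inv\<^bsub>G\<^esub> g | g. g \<in> carrier G}"

definition conjugacy_classes :: "('a, 'm) monoid_scheme \<Rightarrow> 'a set set"
  where "conjugacy_classes G = conjugacy_class G ` carrier G"

section \<open>The random graph and its automorphism group\<close>

text \<open>The vertex set is the whole of a countable type. The extension property forces it to be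
  infinite.\<close>

definition random_graph :: "('v::countable \<Rightarrow> 'v \<Rightarrow> bool) \<Rightarrow> bool"
  where "random_graph R \<longleftrightarrow> irreflp R \<and> symp R \<and>
    (\<forall>A B. finite A \<and> finite B \<and> A \<inter> B = {} \<longrightarrow>
      (\<exists>v. (\<forall>x\<in>A. R x v) \<and> (\<forall>y\<in>B. \<not> R y v)))"

definition Aut :: "('v \<Rightarrow> 'v \<Rightarrow> bool) \<Rightarrow> ('v \<Rightarrow> 'v) monoid"
  where "Aut R = \<lparr>carrier = {f. bij f \<and> (\<forall>x y. R (f x) (f y) \<longleftrightarrow> R x y)}, mult = (\<circ>), one = id\<rparr>"

definition Aut_topology :: "('v \<Rightarrow> 'v \<Rightarrow> bool) \<Rightarrow> ('v \<Rightarrow> 'v) topology"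
  where "Aut_topology R =
    subtopology (product_topology (\<lambda>_. discrete_topology UNIV) UNIV) (carrier (Aut R))"

lemma topspace_Aut_topology: "topspace (Aut_topology R) = carrier (Aut R)"
  by (simp add: Aut_topology_def)

lemma group_Aut: "group (Aut R)"
proof (rule groupI)
  fix f assume "f \<in> carrier (Aut R)"
  then have f: "bij f" and R: "\<And>x y. R (f x) (f y) \<longleftrightarrow> R x y"
    by (auto simp: Aut_def)
  have "R (inv_into UNIV f x) (inv_into UNIV f y) \<longleftrightarrow> R x y" for x y
    using R[of "inv_into UNIV f x" "inv_into UNIV f y"] f by (simp add: bij_is_surj surj_f_inv_f)
  moreover have "inv_into UNIV f \<circ> f = id"
    using f by (simp add: bij_is_inj)
  ultimately show "\<exists>g\<in>carrier (Aut R). g \<otimes>\<^bsub>Aut R\<^esub> f = \<one>\<^bsub>Aut R\<^esub>"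
    using f by (intro bexI[of _ "inv_into UNIV f"]) (auto simp: Aut_def bij_imp_bij_inv)
qed (auto simp: Aut_def bij_comp comp_assoc)

definition orb :: "('v \<Rightarrow> 'v \<Rightarrow> bool) \<Rightarrow> ('v \<Rightarrow> 'v) \<Rightarrow> 'v set \<Rightarrow> 'v set"
  where "orb R f A = {(f [^]\<^bsub>Aut R\<^esub> k) v | v k. v \<in> A \<and> k \<in> (UNIV :: int set)}"

definition orbits_of :: "('v \<Rightarrow> 'v \<Rightarrow> bool) \<Rightarrow> ('v \<Rightarrow> 'v) \<Rightarrow> 'v set set"
  where "orbits_of R f = {orb R f {v} | v. True}"

definition extension_off_orbits :: "('v \<Rightarrow> 'v \<Rightarrow> bool) \<Rightarrow> ('v \<Rightarrow> 'v) \<Rightarrow> bool"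
  where "extension_off_orbits R f \<longleftrightarrow>
    (\<forall>A B. finite A \<and> finite B \<and> A \<inter> B = {} \<longrightarrow>
      (\<exists>v. (\<forall>x\<in>A. R x v) \<and> (\<forall>y\<in>B. \<not> R y v) \<and> v \<notin> orb R f (A \<union> B)))"

definition finitely_many_finite_orbits :: "('v \<Rightarrow> 'v \<Rightarrow> bool) \<Rightarrow> ('v \<Rightarrow> 'v) \<Rightarrow> bool"
  where "finitely_many_finite_orbits R f \<longleftrightarrow> finite {W \<in> orbits_of R f. finite W}"

definition no_finite_orbits :: "('v \<Rightarrow> 'v \<Rightarrow> bool) \<Rightarrow> ('v \<Rightarrow> 'v) \<Rightarrow> bool"
  where "no_finite_orbits R f \<longleftrightarrow> (\<forall>W\<in>orbits_of R f. infinite W)"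

end

theory Submission
  imports Defs
begin

text \<open>Call \<open>f\<close> good if it satisfies both properties.

  Almost every automorphism is good: build a random automorphism \<open>k\<close> back and forth, choosing the
  image or preimage of stage \<open>n\<close> uniformly among \<open>2 ^ n\<close> admissible new vertices. For any fixed
  automorphism \<open>h\<close>, the chance that stage \<open>n\<close> links two given chains of \<open>k \<circ> h\<close>, or closes a cycle, is
  \<open>O(2 ^ -n)\<close>. By Borel--Cantelli only finitely many cycles are closed, and a vertex of a prescribed
  type that is chosen late avoids the orbits of a given finite set.

  Conversely, let \<open>f\<close> be good, with finite orbits \<open>P\<close>, and let \<open>K\<close> be a set of automorphisms with
  finite \<open>K v\<close> and \<open>K\<inverse> v\<close> for all \<open>v\<close>, whose inverses agree on \<open>P\<close>. A single \<open>g\<close> with \<open>k \<circ> g\<close> conjugate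
  to \<open>f\<close> for all \<open>k \<in> K\<close> is constructed by approximating \<open>g\<close> and all the conjugacies simultaneously.
  The adjacency of \<open>v\<close> to \<open>f v\<close> is the only datum that cannot be adjusted when a new orbit is started,
  and goodness implies that a suitable value of it, depending only on the type of \<open>v\<close> over \<open>P\<close>, is
  always available. Compact sets satisfy the finiteness condition, and tightness provides sets of
  positive measure that satisfy it.\<close>

section \<open>Extension of partial conjugacies\<close>

text \<open>What makes the converse hard is that one vertex \<open>y\<close> has to serve as the
  value of \<open>g\<close> at \<open>x\<close> for all members of \<open>K\<close> together. Each
  member demands adjacencies of \<open>y\<close> to the preimages of its own chain starts, and
  demands of different members may fall on the same vertex. Two devices keep them compatible. All
  demands are drawn from one relation \<open>\<tau>\<close> fixed in advance, and the start of a new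
  orbit is chosen so as to obey it. New values are chosen to tell the members apart: two members
  that send \<open>y\<close> to the same vertex have behaved alike so far, so they may share the
  demands of their common new end. Since values and preimages under \<open>K\<close> are finite in
  number, only finitely many behaviours occur on a finite approximation even if \<open>K\<close> is
  infinite, and finitely many steps can treat them all.

  The option counts \<open>2 ^ n\<close> are there to make the failure probabilities
  summable.\<close>

lemma random_graph_type:
  assumes R: "random_graph R" and fin: "finite F" "finite W"
  shows "\<exists>v. v \<notin> W \<and> (\<forall>x\<in>F. R x v \<longleftrightarrow> t x)"
proof -
  have ext: "\<exists>v. (\<forall>x\<in>A. R x v) \<and> (\<forall>y\<in>B. \<not> R y v)" if "finite A" "finite B" "A \<inter> B = {}" for A B
    using R that unfolding random_graph_def by blast
  have sym: "R x y \<Longrightarrow> R y x" for x y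
    using R by (auto simp: random_graph_def symp_def)
  \<comment> \<open>A vertex adjacent to \<open>u\<close> is outside \<open>W\<close>, because
    \<open>u\<close> has no neighbour there. The auxiliary \<open>w\<close> keeps \<open>u\<close>
    off \<open>F\<close>, where demanding adjacency to \<open>u\<close> could contradict
    \<open>t\<close>.\<close>
  obtain w where w: "\<forall>x\<in>F \<union> W. R x w"
    using ext[of "F \<union> W" "{}"] fin by auto
  obtain u where u: "\<forall>x\<in>insert w (F \<union> W). \<not> R x u"
    using ext[of "{}" "insert w (F \<union> W)"] fin by auto
  then have "u \<notin> F \<union> W"
    using w sym by blast
  then obtain v where "\<forall>x\<in>insert u {x \<in> F. t x}. R x v" "\<forall>x\<in>{x \<in> F. \<not> t x}. \<not> R x v"
    using ext[of "insert u {x \<in> F. t x}" "{x \<in> F. \<not> t x}"] fin by auto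
  moreover from this have "v \<notin> W"
    using u sym by blast
  ultimately show ?thesis
    by blast
qed

text \<open>The set to be caught is the family \<^term>\<open>k i\<close>, \<open>i \<in> I\<close>, with inverses \<^term>\<open>l i\<close>; \<^term>\<open>f'\<close> is the
  inverse of \<^term>\<open>f\<close>, and \<^term>\<open>P\<close> is the union of its finite orbits. Assumption \<open>extv\<close> says that a
  finite type is realised off the orbits by a vertex whose adjacency to its own image is the one
  forced by its type over \<^term>\<open>P\<close>, namely \<^term>\<open>cf\<close>; \<^term>\<open>cr\<close> and \<^term>\<open>cl\<close> carry this value to the two
  sides of the \<^term>\<open>k i\<close>. Everything is symmetric under exchanging \<^term>\<open>k\<close> with \<^term>\<open>l\<close>, \<^term>\<open>f\<close> with
  \<^term>\<open>f'\<close> and \<^term>\<open>cr\<close> with \<^term>\<open>cl\<close>.\<close>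

locale conj_setup =
  fixes R :: "'v::countable \<Rightarrow> 'v \<Rightarrow> bool"
    and k l :: "'i \<Rightarrow> 'v \<Rightarrow> 'v"
    and f f' :: "'v \<Rightarrow> 'v"
    and I :: "'i set"
    and P :: "'v set"
    and cf cr cl :: "'v \<Rightarrow> bool"
  assumes random: "random_graph R"
    and kl: "i \<in> I \<Longrightarrow> k i (l i x) = x"
    and lk: "i \<in> I \<Longrightarrow> l i (k i x) = x"
    and kR: "i \<in> I \<Longrightarrow> R (k i x) (k i y) \<longleftrightarrow> R x y"
    and fink: "finite ((\<lambda>i. k i x) ` I)"
    and finl: "finite ((\<lambda>i. l i x) ` I)"
    and ff': "f (f' x) = x"
    and f'f: "f' (f x) = x"
    and fR: "R (f x) (f y) \<longleftrightarrow> R x y"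
    and finP: "finite P"
    and nonper: "0 < n \<Longrightarrow> (f ^^ n) x = x \<Longrightarrow> x \<in> P"
    and extv: "finite F \<Longrightarrow> P \<subseteq> F \<Longrightarrow> \<exists>v. (\<forall>x\<in>F. R x v \<longleftrightarrow> t x) \<and> (R (f v) v \<longleftrightarrow> cf v) \<and>
        (\<forall>n. \<forall>u\<in>F. (f ^^ n) u \<noteq> v \<and> (f ^^ n) v \<noteq> u)"
    and ccoh: "i \<in> I \<Longrightarrow> cr (k i z) = cl z"
begin

lemma sym: "R x y \<longleftrightarrow> R y x"
  using random by (auto simp: random_graph_def symp_def)

lemma irr: "\<not> R x x"
  using random by (auto simp: random_graph_def irreflp_def)

lemma lR: "i \<in> I \<Longrightarrow> R (l i x) (l i y) \<longleftrightarrow> R x y"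
  using kR[of i "l i x" "l i y"] by (simp add: kl)

lemma f'R: "R (f' x) (f' y) \<longleftrightarrow> R x y"
  using fR[of "f' x" "f' y"] by (simp add: ff')

lemma f_eq: "f x = y \<longleftrightarrow> x = f' y"
  using ff' f'f by metis

lemma fn_eq: "(f ^^ n) x = y \<longleftrightarrow> x = (f' ^^ n) y"
proof (induction n arbitrary: x)
  case (Suc n)
  have "(f ^^ Suc n) x = y \<longleftrightarrow> (f ^^ n) (f x) = y"
    by (simp add: funpow_swap1)
  also have "\<dots> \<longleftrightarrow> x = (f' ^^ Suc n) y"
    by (simp add: Suc f_eq)
  finally show ?case .
qed simp

lemma dual: "conj_setup R l k f' f I P cf cl cr"
proof
  fix n x assume "0 < n" "(f' ^^ n) x = x"
  then show "x \<in> P"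
    using nonper[of n x] fn_eq[of n x x] by metis
next
  fix F t assume "finite F" "P \<subseteq> F"
  from extv[OF this, of t] obtain v where v: "(\<forall>x\<in>F. R x v \<longleftrightarrow> t x) \<and> (R (f v) v \<longleftrightarrow> cf v) \<and>
        (\<forall>n. \<forall>u\<in>F. (f ^^ n) u \<noteq> v \<and> (f ^^ n) v \<noteq> u)" by blast
  \<comment> \<open>Adjacency to the image and adjacency to the preimage are the same datum, so
    \<open>cf\<close> serves for \<open>f'\<close> unchanged.\<close>
  moreover have "R (f' v) v \<longleftrightarrow> R (f v) v"
    using fR[of "f' v" v] by (simp add: ff' sym)
  ultimately show "\<exists>v. (\<forall>x\<in>F. R x v = t x) \<and> R (f' v) v = cf v \<and> (\<forall>n. \<forall>u\<in>F. (f' ^^ n) u \<noteq> v \<and> (f' ^^ n) v \<noteq> u)"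
    unfolding fn_eq by metis
next
  fix i z assume i: "i \<in> I"
  show "cl (l i z) = cr z"
    using ccoh[OF i, of "l i z"] i by (simp add: kl)
qed (simp_all add: random kl lk lR fink finl ff' f'f f'R finP)

section \<open>Vertices that separate the indices\<close>

definition KI :: "'v set \<Rightarrow> 'v set" where "KI A = (\<Union>i\<in>I. k i ` A)"
definition LI :: "'v set \<Rightarrow> 'v set" where "LI A = (\<Union>i\<in>I. l i ` A)"

lemma fin_KI: "finite A \<Longrightarrow> finite (KI A)"
proof -
  assume "finite A"
  moreover have "KI A = (\<Union>x\<in>A. (\<lambda>i. k i x) ` I)" by (auto simp: KI_def)
  ultimately show ?thesis by (simp add: fink)
qed

lemma fin_LI: "finite A \<Longrightarrow> finite (LI A)"
proof -
  assume "finite A"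
  moreover have "LI A = (\<Union>x\<in>A. (\<lambda>i. l i x) ` I)" by (auto simp: LI_def)
  ultimately show ?thesis by (simp add: finl)
qed

text \<open>A vertex \<open>b\<close> adjacent to \<open>q\<close> and to no other point of the
  finite set \<open>LI (KI {q})\<close> remembers where \<open>q\<close> goes: if
  \<open>k i b = k j b\<close>, then \<open>l j (k i q)\<close> is adjacent to \<open>b\<close>,
  hence equal to \<open>q\<close>. The wanted \<open>y\<close> cannot remember \<open>q\<close>
  directly, since its adjacencies on \<open>F\<close> are prescribed; it remembers an intermediate
  \<open>b\<close> whose translates avoid \<open>F\<close>.\<close>

lemma separating_type:
  assumes "finite Q" "finite F" "finite W"
  shows "\<exists>y. y \<notin> W \<and> (\<forall>q\<in>F. R q y \<longleftrightarrow> t q) \<and>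
    (\<forall>i\<in>I. \<forall>j\<in>I. k i y = k j y \<longrightarrow> (\<forall>q\<in>Q. k i q = k j q))"
  using assms
proof (induction Q arbitrary: F t rule: finite_induct)
  case empty
  then show ?case using random_graph_type[OF random, of F W t] by auto
next
  case (insert q Q)
  have sep: "k i q = k j q"
    if b: "R q b" "\<And>z. z \<in> LI (KI {q}) \<Longrightarrow> R z b \<Longrightarrow> z = q" and ij: "i \<in> I" "j \<in> I" "k i b = k j b"
    for q b i j
  proof -
    have "R (k i q) (k i b)" using b(1) kR[OF ij(1)] by blast
    then have "R (k i q) (k j b)" by (simp only: ij(3))
    then have "R (l j (k i q)) (l j (k j b))" using lR[OF ij(2)] by blast
    then have "R (l j (k i q)) b" using ij lk by simp
    moreover have "l j (k i q) \<in> LI (KI {q})" using ij by (auto simp: LI_def KI_def)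
    ultimately have "l j (k i q) = q" using b by blast
    then show ?thesis using kl ij by metis
  qed
  obtain b where b: "b \<notin> LI (KI F)" "\<forall>z\<in>insert q (LI (KI {q})). R z b \<longleftrightarrow> z = q"
    using random_graph_type[OF random, of "insert q (LI (KI {q}))" "LI (KI F)" "\<lambda>z. z = q"]
    fin_KI fin_LI insert.prems by auto
  have disj: "z \<notin> F" if "z \<in> LI (KI {b})" for z
  proof
    assume "z \<in> F"
    from that obtain i j where ij: "i \<in> I" "j \<in> I" "z = l i (k j b)" by (auto simp: LI_def KI_def)
    then have "b = l j (k i z)" using kl lk by simp
    then show False using b(1) ij \<open>z \<in> F\<close> by (auto simp: LI_def KI_def)
  qed
  \<comment> \<open>The additional demands concern only translates of \<open>b\<close>, which miss
    \<open>F\<close>, so they can be passed to the induction hypothesis together with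
    \<open>t\<close>.\<close>
  define F' where "F' = F \<union> LI (KI {b})"
  have "finite F'" using insert.prems fin_KI fin_LI by (simp add: F'_def)
  from insert.IH[OF this insert.prems(2), of "\<lambda>z. if z \<in> F then t z else z = b"]
  obtain y where y: "y \<notin> W" "\<forall>z\<in>F'. R z y \<longleftrightarrow> (if z \<in> F then t z else z = b)"
    "\<forall>i\<in>I. \<forall>j\<in>I. k i y = k j y \<longrightarrow> (\<forall>q\<in>Q. k i q = k j q)"
    by auto
  have "k i q = k j q" if ij: "i \<in> I" "j \<in> I" "k i y = k j y" for i j
  proof -
    have "b \<in> LI (KI {b})"
      using ij lk[of i b] by (force simp: LI_def KI_def)
    then have "R b y" using y(2) disj by (auto simp: F'_def)
    moreover have "z = b" if "z \<in> LI (KI {b})" "R z y" for z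
      using y(2) disj that by (auto simp: F'_def)
    ultimately have "k i b = k j b" using sep[of b y i j] ij by blast
    then show ?thesis using sep[of q b i j] ij b by auto
  qed
  moreover have "\<forall>z\<in>F. R z y \<longleftrightarrow> t z" using y(2) by (auto simp: F'_def)
  ultimately show ?case using y(1,3) by blast
qed

text \<open>For a finite approximation \<^term>\<open>G\<close> (a graph) of the automorphism sought, \<^term>\<open>k i\<close> after \<^term>\<open>G\<close>
  is a partial injection. \<open>M\<close> is its field, \<open>E\<close> and \<open>S\<close> are the ends and the starts of its chains.\<close>

definition M :: "('v \<times> 'v) set \<Rightarrow> 'i \<Rightarrow> 'v set" where "M G i = Domain G \<union> k i ` Range G"
definition E :: "('v \<times> 'v) set \<Rightarrow> 'i \<Rightarrow> 'v set" where "E G i = k i ` Range G - Domain G"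
definition S :: "('v \<times> 'v) set \<Rightarrow> 'i \<Rightarrow> 'v set" where "S G i = Domain G - k i ` Range G"
text \<open>Everything about an index that the approximation \<open>G\<close> can see. Since values
  and preimages are finite in number, it divides the indices into finitely many classes.\<close>

definition agree :: "('v \<times> 'v) set \<Rightarrow> 'i \<Rightarrow> 'i \<Rightarrow> bool" where
  "agree G i j \<longleftrightarrow> (\<forall>y\<in>Range G. k i y = k j y) \<and> (\<forall>x\<in>Domain G. l i x = l j x)"

text \<open>Weaker than having \<open>u\<close> in the image of \<open>\<psi> i\<close>: in the
  limit the image is a union of orbits, so meeting each orbit is enough for surjectivity.\<close>

definition covers :: "('v \<times> 'v) set \<Rightarrow> ('i \<Rightarrow> 'v \<Rightarrow> 'v) \<Rightarrow> 'i \<Rightarrow> 'v \<Rightarrow> bool" where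
  "covers G \<psi> i u \<longleftrightarrow> (\<exists>m\<in>M G i. \<exists>n. (f ^^ n) (\<psi> i m) = u \<or> (f ^^ n) u = \<psi> i m)"

end

text \<open>\<^term>\<open>\<psi> i\<close> is a partial conjugacy from \<^term>\<open>k i\<close> after \<^term>\<open>G\<close> to \<^term>\<open>f\<close>. Prolonging the chain of the
  end \<^term>\<open>e\<close> by \<^term>\<open>G\<close>-image \<^term>\<open>y\<close> prescribes the adjacency of \<^term>\<open>y\<close> to \<^term>\<open>l i d\<close> for every start
  \<^term>\<open>d\<close>; \<open>tau_ES\<close> says that the prescriptions coming from different \<^term>\<open>i\<close> do not conflict. \<open>tau_c\<close>
  covers the pairs for which a new chain would have to start, where the value is beyond control.\<close>

locale conj_state = conj_setup R k l f f' I P cf cr cl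
  for R :: "'v::countable \<Rightarrow> 'v \<Rightarrow> bool" and k l :: "'i \<Rightarrow> 'v \<Rightarrow> 'v" and f f' I P cf cr cl +
  fixes G :: "('v \<times> 'v) set" and \<psi> :: "'i \<Rightarrow> 'v \<Rightarrow> 'v" and \<tau> :: "'v \<Rightarrow> 'v \<Rightarrow> bool"
  assumes finG: "finite G"
    and G_eq: "(x, y) \<in> G \<Longrightarrow> (x', y') \<in> G \<Longrightarrow> x = x' \<longleftrightarrow> y = y'"
    and G_R: "(x, y) \<in> G \<Longrightarrow> (x', y') \<in> G \<Longrightarrow> R x x' \<longleftrightarrow> R y y'"
    and psi_inj: "i \<in> I \<Longrightarrow> a \<in> M G i \<Longrightarrow> b \<in> M G i \<Longrightarrow> \<psi> i a = \<psi> i b \<Longrightarrow> a = b"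
    and psi_R: "i \<in> I \<Longrightarrow> a \<in> M G i \<Longrightarrow> b \<in> M G i \<Longrightarrow> R (\<psi> i a) (\<psi> i b) \<longleftrightarrow> R a b"
    and psi_eq: "i \<in> I \<Longrightarrow> (x, y) \<in> G \<Longrightarrow> \<psi> i (k i y) = f (\<psi> i x)"
    and psi_agree: "i \<in> I \<Longrightarrow> j \<in> I \<Longrightarrow> agree G i j \<Longrightarrow> m \<in> M G i \<Longrightarrow> \<psi> i m = \<psi> j m"
    and endO: "i \<in> I \<Longrightarrow> e \<in> E G i \<Longrightarrow> 0 < n \<Longrightarrow> (f ^^ n) (\<psi> i e) \<notin> \<psi> i ` M G i"
    and startO: "i \<in> I \<Longrightarrow> d \<in> S G i \<Longrightarrow> 0 < n \<Longrightarrow> (f' ^^ n) (\<psi> i d) \<notin> \<psi> i ` M G i"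
    and tau_ES: "i \<in> I \<Longrightarrow> e \<in> E G i \<Longrightarrow> d \<in> S G i \<Longrightarrow> R (f (\<psi> i e)) (\<psi> i d) \<longleftrightarrow> \<tau> e (l i d)"
    and tau_c: "i \<in> I \<Longrightarrow> \<tau> (k i z) z = cr (k i z)"
    and P_sub: "i \<in> I \<Longrightarrow> P \<subseteq> \<psi> i ` M G i"
    and c_type: "i \<in> I \<Longrightarrow> (\<And>m. m \<in> M G i \<Longrightarrow> R v (\<psi> i m) \<longleftrightarrow> R x m) \<Longrightarrow> cf v = cr x"
begin

section \<open>Duality between the two directions\<close>

lemma image_lk: "i \<in> I \<Longrightarrow> l i ` k i ` A = A"
  by (simp add: image_image lk)

lemma inj_l: "i \<in> I \<Longrightarrow> inj (l i)"
  using kl by (metis injI)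

lemma dual_M: "i \<in> I \<Longrightarrow> conj_setup.M l (G\<inverse>) i = l i ` M G i"
  by (auto simp: conj_setup.M_def[OF dual] M_def image_Un image_lk)

lemma dual_E: "i \<in> I \<Longrightarrow> conj_setup.E l (G\<inverse>) i = l i ` S G i"
  by (simp add: conj_setup.E_def[OF dual] S_def image_set_diff[OF inj_l] image_lk)

lemma dual_S: "i \<in> I \<Longrightarrow> conj_setup.S l (G\<inverse>) i = l i ` E G i"
  by (simp add: conj_setup.S_def[OF dual] E_def image_set_diff[OF inj_l] image_lk)

text \<open>The inverse of \<open>k i \<circ> g\<close>, conjugated by \<open>k i\<close>, is
  \<open>l i \<circ> g\<inverse>\<close>. So a conjugacy \<open>\<psi> i\<close> to \<open>f\<close>
  turns into the conjugacy \<open>\<psi> i \<circ> k i\<close> to \<open>f'\<close>. Ends and starts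
  change places, which transposes \<open>\<tau>\<close>.\<close>

lemma dual_state: "conj_state R l k f' f I P cf cl cr (G\<inverse>) (\<lambda>i. \<psi> i \<circ> k i) (\<lambda>z e. \<tau> e z)"
proof -
  interpret d: conj_setup R l k f' f I P cf cl cr by (rule dual)
  have im: "(\<psi> i \<circ> k i) ` d.M (G\<inverse>) i = \<psi> i ` M G i" if "i \<in> I" for i
    using that by (force simp: dual_M kl image_iff)
  show ?thesis
  proof
    show "finite (G\<inverse>)" using finG by simp
  next
    fix i a b assume i: "i \<in> I" and a: "a \<in> d.M (G\<inverse>) i" "b \<in> d.M (G\<inverse>) i"
    then have kab: "k i a \<in> M G i" "k i b \<in> M G i" by (auto simp: dual_M kl)
    show "R ((\<psi> i \<circ> k i) a) ((\<psi> i \<circ> k i) b) \<longleftrightarrow> R a b"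
      using psi_R[OF i kab] kR i by simp
    assume "(\<psi> i \<circ> k i) a = (\<psi> i \<circ> k i) b"
    then show "a = b" using psi_inj[OF i kab] i lk by (metis comp_apply)
  next
    fix i x y assume i: "i \<in> I" and "(x, y) \<in> G\<inverse>"
    then show "(\<psi> i \<circ> k i) (l i y) = f' ((\<psi> i \<circ> k i) x)"
      using psi_eq[of i y x] by (simp add: kl f'f)
  next
    fix i j m assume i: "i \<in> I" "j \<in> I" and ag: "d.agree (G\<inverse>) i j" and m: "m \<in> d.M (G\<inverse>) i"
    have ag': "agree G i j" using ag unfolding d.agree_def agree_def by auto
    have "k i m = k j m"
    proof -
      consider "m \<in> Range G" | x where "x \<in> Domain G" "m = l i x"
        using m unfolding d.M_def by auto
      then show ?thesis
      proof cases
        case 1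
        then show ?thesis using ag' unfolding agree_def by blast
      next
        case 2
        then have "m = l j x" using ag' unfolding agree_def by auto
        then show ?thesis using 2(2) i kl by metis
      qed
    qed
    moreover have "k i m \<in> M G i" using m i by (auto simp: dual_M kl)
    ultimately show "(\<psi> i \<circ> k i) m = (\<psi> j \<circ> k j) m"
      using psi_agree[OF i ag'] by simp
  next
    fix i e and n :: nat assume "i \<in> I" "e \<in> d.E (G\<inverse>) i" "0 < n"
    then show "(f' ^^ n) ((\<psi> i \<circ> k i) e) \<notin> (\<psi> i \<circ> k i) ` d.M (G\<inverse>) i"
      using startO[of i "k i e" n] unfolding im[OF \<open>i \<in> I\<close>] by (auto simp: dual_E kl)
  next
    fix i e and n :: nat assume "i \<in> I" "e \<in> d.S (G\<inverse>) i" "0 < n"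
    then show "(f ^^ n) ((\<psi> i \<circ> k i) e) \<notin> (\<psi> i \<circ> k i) ` d.M (G\<inverse>) i"
      using endO[of i "k i e" n] unfolding im[OF \<open>i \<in> I\<close>] by (auto simp: dual_S kl)
  next
    fix i e d assume i: "i \<in> I" and "e \<in> d.E (G\<inverse>) i" "d \<in> d.S (G\<inverse>) i"
    then have 1: "k i e \<in> S G i" "k i d \<in> E G i" by (auto simp: dual_E dual_S kl)
    have "R (f' ((\<psi> i \<circ> k i) e)) ((\<psi> i \<circ> k i) d) \<longleftrightarrow> R (\<psi> i (k i e)) (f (\<psi> i (k i d)))"
      using fR[of "f' (\<psi> i (k i e))" "\<psi> i (k i d)"] by (simp add: ff')
    also have "\<dots> \<longleftrightarrow> \<tau> (k i d) e"
      using tau_ES[OF i 1(2,1)] i by (simp add: sym lk)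
    finally show "R (f' ((\<psi> i \<circ> k i) e)) ((\<psi> i \<circ> k i) d) \<longleftrightarrow> \<tau> (k i d) e" .
  next
    fix i z assume "i \<in> I"
    then show "\<tau> z (l i z) = cl (l i z)" using tau_c[of i "l i z"] ccoh[of i "l i z"] by (simp add: kl)
  next
    fix i assume "i \<in> I"
    then show "P \<subseteq> (\<psi> i \<circ> k i) ` d.M (G\<inverse>) i" unfolding im[OF \<open>i \<in> I\<close>] by (rule P_sub)
  next
    fix i v x assume i: "i \<in> I" and t: "\<And>m. m \<in> d.M (G\<inverse>) i \<Longrightarrow> R v ((\<psi> i \<circ> k i) m) = R x m"
    have "R v (\<psi> i m) \<longleftrightarrow> R (k i x) m" if "m \<in> M G i" for m
      using t[of "l i m"] that i kR[of i x "l i m"] by (auto simp: dual_M kl)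
    then show "cf v = cl x" using c_type[OF i, of v "k i x"] ccoh i by simp
  qed (use G_eq G_R in auto)
qed

section \<open>Adding one edge to an approximation\<close>

lemma fin_M: "finite (M G i)"
  using finG by (simp add: M_def finite_Domain finite_Range)

lemma fin_E: "finite (E G i)"
  using finG by (simp add: E_def finite_Range)

lemma fin_S: "finite (S G i)"
  using finG by (simp add: S_def finite_Domain)

lemma E_M: "e \<in> E G i \<Longrightarrow> e \<in> M G i"
  by (auto simp: E_def M_def)

lemma S_M: "d \<in> S G i \<Longrightarrow> d \<in> M G i"
  by (auto simp: S_def M_def)

lemma agree_kR: "agree G i j \<Longrightarrow> k i ` Range G = k j ` Range G"
  by (auto simp: agree_def image_iff)

lemma agree_M: "agree G i j \<Longrightarrow> M G i = M G j"
  using agree_kR by (simp add: M_def)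

lemma agree_E: "agree G i j \<Longrightarrow> E G i = E G j"
  using agree_kR by (simp add: E_def)

lemma agree_S: "agree G i j \<Longrightarrow> S G i = S G j"
  using agree_kR by (simp add: S_def)

text \<open>\<open>endO\<close> and \<open>startO\<close> keep the points \<open>\<psi> i m\<close>,
  \<open>f (\<psi> i e)\<close> and \<open>f' (\<psi> i d)\<close> distinct, so all demands form one
  finite type, which \<open>extv\<close> realises off the orbits; demands on \<open>f v\<close> are
  pulled back along \<open>f'\<close>. \<open>c_type\<close> turns the value \<open>cf v\<close>
  delivered by \<open>extv\<close> into \<open>cr x\<close>. Non-adjacency to an uncovered
  \<open>u\<close> is what later keeps index sets coherent.\<close>

lemma new_orbit_type:
  assumes i: "i \<in> I" and x: "x \<notin> M G i"
  shows "\<exists>v. (\<forall>n. \<forall>m\<in>M G i. (f ^^ n) (\<psi> i m) \<noteq> v \<and> (f ^^ n) v \<noteq> \<psi> i m) \<and>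
    (\<forall>m\<in>M G i. R v (\<psi> i m) \<longleftrightarrow> R x m) \<and>
    (\<forall>e\<in>E G i. R v (f (\<psi> i e)) \<longleftrightarrow> \<sigma> e (l i x)) \<and>
    (\<forall>d\<in>S G i. R (f v) (\<psi> i d) \<longleftrightarrow> \<sigma> x (l i d)) \<and>
    (R (f v) v \<longleftrightarrow> cr x) \<and> (\<not> covers G \<psi> i u \<longrightarrow> \<not> R v u)"
proof -
  let ?F = "insert u (\<psi> i ` M G i \<union> (\<lambda>e. f (\<psi> i e)) ` E G i \<union> (\<lambda>d. f' (\<psi> i d)) ` S G i)"
  have E1: "f (\<psi> i e) \<noteq> \<psi> i m" if "e \<in> E G i" "m \<in> M G i" for e m
    using endO[OF i that(1), of 1] that by auto
  have S1: "f' (\<psi> i d) \<noteq> \<psi> i m" if "d \<in> S G i" "m \<in> M G i" for d m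
    using startO[OF i that(1), of 1] that by auto
  \<comment> \<open>Equality would put the second iterate of \<open>\<psi> i e\<close> into the
    image, against \<open>endO\<close>.\<close>
  have ES: "f (\<psi> i e) \<noteq> f' (\<psi> i d)" if "e \<in> E G i" "d \<in> S G i" for d e
    using endO[OF i that(1), of 2] S_M[OF that(2)] ff' by (auto simp: numeral_2_eq_2 image_iff)
  have Einj: "e = e'" if "e \<in> E G i" "e' \<in> E G i" "f (\<psi> i e) = f (\<psi> i e')" for e e'
    using psi_inj[OF i E_M E_M] that f'f by metis
  have Sinj: "e = e'" if "e \<in> S G i" "e' \<in> S G i" "f' (\<psi> i e) = f' (\<psi> i e')" for e e'
    using psi_inj[OF i S_M S_M] that ff' by metis
  define t where "t u \<longleftrightarrow> (\<exists>m\<in>M G i. u = \<psi> i m \<and> R x m) \<or>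
    (\<exists>e\<in>E G i. u = f (\<psi> i e) \<and> \<sigma> e (l i x)) \<or> (\<exists>d\<in>S G i. u = f' (\<psi> i d) \<and> \<sigma> x (l i d))" for u
  have "finite ?F"
    by (simp add: fin_M fin_E fin_S)
  moreover have "P \<subseteq> ?F" using P_sub[OF i] by auto
  ultimately obtain v where v: "\<forall>u\<in>?F. R u v \<longleftrightarrow> t u" "R (f v) v \<longleftrightarrow> cf v"
    "\<forall>n. \<forall>u\<in>?F. (f ^^ n) u \<noteq> v \<and> (f ^^ n) v \<noteq> u"
    using extv[of ?F t] by auto
  have tM: "t (\<psi> i m) \<longleftrightarrow> R x m" if "m \<in> M G i" for m
    using that psi_inj[OF i] E1 S1 unfolding t_def by metis
  have tE: "t (f (\<psi> i e)) \<longleftrightarrow> \<sigma> e (l i x)" if "e \<in> E G i" for e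
    using that Einj E1 ES unfolding t_def by metis
  have tS: "t (f' (\<psi> i d)) \<longleftrightarrow> \<sigma> x (l i d)" if "d \<in> S G i" for d
    using that Sinj S1 ES unfolding t_def by metis
  have 1: "\<forall>m\<in>M G i. R v (\<psi> i m) \<longleftrightarrow> R x m"
    using v(1) tM by (auto simp: sym[of v])
  moreover have "\<forall>e\<in>E G i. R v (f (\<psi> i e)) \<longleftrightarrow> \<sigma> e (l i x)"
    using v(1) tE by (auto simp: sym[of v])
  moreover have "R (f v) (\<psi> i d) \<longleftrightarrow> \<sigma> x (l i d)" if "d \<in> S G i" for d
    using v(1) tS that fR[of v "f' (\<psi> i d)"] by (auto simp: sym[of v] ff')
  moreover have "cf v = cr x"
    using c_type[OF i, of v x] 1 by blast
  moreover have "\<not> R v u" if nc: "\<not> covers G \<psi> i u"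
  proof -
    have "(f ^^ n) (\<psi> i m) \<noteq> u \<and> (f ^^ n) u \<noteq> \<psi> i m" if "m \<in> M G i" for n m
      using nc that unfolding covers_def by blast
    from this[of _ 0] this[of _ 1] have "\<not> t u"
      using E_M S_M ff' unfolding t_def by fastforce
    then show ?thesis using v(1) by (auto simp: sym[of v])
  qed
  ultimately show ?thesis
    using v(2,3) by blast
qed

text \<open>The new value \<^term>\<open>y\<close> separates the indices: \<^term>\<open>k i y = k j y\<close> only if \<^term>\<open>i\<close> and \<^term>\<open>j\<close> agree on
  everything seen so far. Hence new ends never cause a conflict.\<close>

lemma step:
  fixes v :: "'i \<Rightarrow> 'v" and \<sigma> :: "'v \<Rightarrow> 'v \<Rightarrow> bool"
  assumes x: "x \<notin> Domain G"
    and vO: "\<And>i n m. i \<in> I \<Longrightarrow> x \<notin> M G i \<Longrightarrow> m \<in> M G i \<Longrightarrow> (f ^^ n) (\<psi> i m) \<noteq> v i \<and> (f ^^ n) (v i) \<noteq> \<psi> i m"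
    and vM: "\<And>i m. i \<in> I \<Longrightarrow> x \<notin> M G i \<Longrightarrow> m \<in> M G i \<Longrightarrow> R (v i) (\<psi> i m) \<longleftrightarrow> R x m"
    and vE: "\<And>i e. i \<in> I \<Longrightarrow> x \<notin> M G i \<Longrightarrow> e \<in> E G i \<Longrightarrow> R (v i) (f (\<psi> i e)) \<longleftrightarrow> \<sigma> e (l i x)"
    and vS: "\<And>i d. i \<in> I \<Longrightarrow> x \<notin> M G i \<Longrightarrow> d \<in> S G i \<Longrightarrow> R (f (v i)) (\<psi> i d) \<longleftrightarrow> \<sigma> x (l i d)"
    and vx: "\<And>i. i \<in> I \<Longrightarrow> x \<notin> M G i \<Longrightarrow> R (f (v i)) (v i) \<longleftrightarrow> \<sigma> x (l i x)"
    and v_agree: "\<And>i j. i \<in> I \<Longrightarrow> j \<in> I \<Longrightarrow> x \<notin> M G i \<Longrightarrow> agree G i j \<Longrightarrow> l i x = l j x \<Longrightarrow> v i = v j"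
    and s_c: "\<And>i z. i \<in> I \<Longrightarrow> k i z \<noteq> x \<Longrightarrow> \<sigma> (k i z) z = cr (k i z)"
    and s_ES: "\<And>i e d. i \<in> I \<Longrightarrow> e \<in> E G i \<Longrightarrow> d \<in> S G i \<Longrightarrow> R (f (\<psi> i e)) (\<psi> i d) \<longleftrightarrow> \<sigma> e (l i d)"
  shows "\<exists>y \<psi>' \<tau>'. conj_state R k l f f' I P cf cr cl (insert (x, y) G) \<psi>' \<tau>' \<and>
    (\<forall>i\<in>I. (\<forall>m\<in>M G i. \<psi>' i m = \<psi> i m) \<and> (x \<notin> M G i \<longrightarrow> \<psi>' i x = v i)) \<and>
    (\<forall>i\<in>I. k i y \<noteq> x \<and> (\<forall>j\<in>I. k i y \<notin> M G j)) \<and>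
    (\<forall>i\<in>I. \<forall>j\<in>I. k i y = k j y \<longrightarrow> agree G i j \<and> l i x = l j x)"
proof -
  define L where "L = LI (insert x (Domain G))"
  have L: "l i d \<in> L" if "i \<in> I" "d = x \<or> d \<in> Domain G" for i d
    using that by (auto simp: L_def LI_def)
  \<comment> \<open>Avoiding these preimages makes \<open>k i y\<close> new for all indices at once.
    The part \<open>KI L\<close> ensures that a new end \<open>k i y\<close> is never of the form
    \<open>k j (l i d)\<close> with \<open>d\<close> a start, so \<open>tau_c\<close> and
    \<open>tau_ES\<close> do not compete there.\<close>
  define W where "W = Range G \<union> LI (insert x (Domain G) \<union> KI (Range G) \<union> KI L)"
  \<comment> \<open>On \<open>Range G\<close> the adjacencies of \<open>y\<close> copy those of
    \<open>x\<close>, on the vertices \<open>l i d\<close> they follow \<open>\<sigma>\<close>.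
    Giving precedence to the first does no harm: if \<open>l i d\<close> is in
    \<open>Range G\<close>, then \<open>d\<close> is not a start for \<open>i\<close>.\<close>
  define t where "t z \<longleftrightarrow> (if z \<in> Range G then \<exists>x'. (x', z) \<in> G \<and> R x x' else \<sigma> x z)" for z
  have finD: "finite (Domain G)" "finite (Range G)" using finG by (simp_all add: finite_Domain finite_Range)
  have finL: "finite L" using finD fin_LI by (simp add: L_def)
  have finW: "finite W" using finD fin_LI fin_KI finL by (simp add: W_def)
  obtain y where y: "y \<notin> W" "\<forall>q\<in>Range G \<union> L. R q y \<longleftrightarrow> t q"
    and y_sep: "\<forall>i\<in>I. \<forall>j\<in>I. k i y = k j y \<longrightarrow> (\<forall>q\<in>Range G \<union> L. k i q = k j q)"
    using separating_type[of "Range G \<union> L" "Range G \<union> L" W t] finL finW finD by auto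
  have yR: "y \<notin> Range G" using y by (simp add: W_def)
  have yx: "k i y \<noteq> x" if "i \<in> I" for i
    using y that lk[of i y] by (force simp: W_def LI_def)
  have yD: "k i y \<notin> Domain G" if "i \<in> I" for i
    using y that lk[of i y] by (force simp: W_def LI_def)
  have yK: "k i y \<noteq> k j z" if "i \<in> I" "j \<in> I" "z \<in> Range G" for i j z
    using y that lk[of i y] by (force simp: W_def LI_def KI_def)
  have yL: "k i y \<noteq> k j z" if "i \<in> I" "j \<in> I" "z \<in> L" for i j z
    using y that lk[of i y] by (force simp: W_def LI_def KI_def)
  have yM: "k i y \<notin> M G i" if "i \<in> I" for i
    using yD[OF that] yK[OF that that] unfolding M_def by blast
  \<comment> \<open>As \<open>x\<close> is outside \<open>Domain G\<close>, it is either an end for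
    \<open>i\<close>, whose chain is now prolonged, or new for \<open>i\<close>, and then it opens
    the orbit of \<open>v i\<close>.\<close>
  define w where "w i = (if x \<in> M G i then \<psi> i x else v i)" for i
  define \<psi>' where "\<psi>' i = (\<psi> i)(x := w i, k i y := f (w i))" for i
  define G' where "G' = insert (x, y) G"
  have psiM: "\<psi>' i m = \<psi> i m" if "i \<in> I" "m \<in> M G i" for i m
    using that yM by (auto simp: \<psi>'_def w_def)
  have psix: "\<psi>' i x = w i" if "i \<in> I" for i
    using yx[OF that] by (auto simp: \<psi>'_def)
  have psiy: "\<psi>' i (k i y) = f (w i)" for i
    by (simp add: \<psi>'_def)
  have M': "M G' i = insert x (insert (k i y) (M G i))" for i
    by (auto simp: G'_def M_def)
  have E': "E G' i = insert (k i y) (E G i - {x})" if "i \<in> I" for i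
    using yD yx that by (auto simp: G'_def E_def)
  have S': "S G' i = (if x \<in> M G i then S G i else insert x (S G i))" if "i \<in> I" for i
    using yD[OF that] yx[OF that] x by (auto simp: G'_def S_def M_def)
  have xM: "x \<in> M G i \<longleftrightarrow> x \<in> E G i" for i
    using x by (auto simp: M_def E_def)
  have xS: "x \<notin> S G i" for i
    using x by (auto simp: S_def)
  have wO: "(f ^^ n) (\<psi> i m) \<noteq> w i" "(f ^^ n) (w i) \<noteq> \<psi> i m"
    if "i \<in> I" "x \<notin> M G i" "m \<in> M G i" for i n m
    using vO[OF that] that(2) by (auto simp: w_def)
  have wR: "R (w i) (\<psi> i m) \<longleftrightarrow> R x m" if "i \<in> I" "m \<in> M G i" for i m
    using psi_R[OF that(1)] that vM by (auto simp: w_def)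
  have winj: "w i \<noteq> \<psi> i m" if "i \<in> I" "m \<in> M G i" "m \<noteq> x" for i m
    using psi_inj[OF that(1)] wO[OF that(1) _ that(2), of 0] that by (auto simp: w_def)
  have w_nonper: "(f ^^ n) (w i) \<noteq> w i" if "i \<in> I" "0 < n" for i n
  proof (cases "x \<in> M G i")
    case True
    then show ?thesis using endO[OF that(1) _ that(2), of x] xM by (auto simp: w_def)
  next
    case False
    show ?thesis
    proof
      assume "(f ^^ n) (w i) = w i"
      then have "w i \<in> P" using nonper that by blast
      then show False using P_sub[OF that(1)] wO[OF that(1) False, of _ 0] by auto
    qed
  qed
  have w_endO: "(f ^^ n) (w i) \<noteq> \<psi> i m" if "i \<in> I" "m \<in> M G i" "0 < n" for i m n
  proof (cases "x \<in> M G i")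
    case True
    then show ?thesis using endO[OF that(1) _ that(3), of x] xM that by (auto simp: w_def)
  qed (use wO that in auto)
  have fwR: "R (f (w i)) (\<psi> i m) \<longleftrightarrow> R (k i y) m" if i: "i \<in> I" and m: "m \<in> M G i" for i m
  proof -
    consider z where "z \<in> Range G" "m = k i z" | "m \<in> Domain G" "m \<notin> k i ` Range G"
      using m by (auto simp: M_def)
    then show ?thesis
    proof cases
      case (1 z)
      then obtain x' where x': "(x', z) \<in> G" by auto
      have "R (f (w i)) (\<psi> i m) \<longleftrightarrow> R (w i) (\<psi> i x')"
        using psi_eq[OF i x'] 1 fR by simp
      also have "\<dots> \<longleftrightarrow> R x x'"
        using wR[OF i, of x'] x' by (auto simp: M_def)
      also have "\<dots> \<longleftrightarrow> t z"
        using x' G_eq[OF x'] unfolding t_def by auto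
      also have "\<dots> \<longleftrightarrow> R (k i y) m"
        using y(2) 1 kR[OF i] sym by auto
      finally show ?thesis .
    next
      case 2
      then have mS: "m \<in> S G i" by (simp add: S_def)
      have lm: "l i m \<in> L" "l i m \<notin> Range G" using 2 i kl[OF i, of m] L by (auto intro: rev_image_eqI)
      have "R (f (w i)) (\<psi> i m) \<longleftrightarrow> \<sigma> x (l i m)"
        using s_ES[OF i _ mS, of x] vS[OF i _ mS] xM by (auto simp: w_def)
      also have "\<dots> \<longleftrightarrow> R (l i m) y" using y(2) lm by (simp add: t_def)
      also have "\<dots> \<longleftrightarrow> R m (k i y)" using kR[OF i, of "l i m" y] kl[OF i] by simp
      finally show ?thesis by (simp add: sym)
    qed
  qed
  have fwwR: "R (f (w i)) (w i) \<longleftrightarrow> R (k i y) x" if i: "i \<in> I" for i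
  proof (cases "x \<in> M G i")
    case True
    then show ?thesis using fwR[OF i True] by (simp add: w_def)
  next
    case False
    then have lm: "l i x \<in> L" "l i x \<notin> Range G" using i kl[OF i, of x] L by (auto simp: M_def intro: rev_image_eqI)
    have "R (f (w i)) (w i) \<longleftrightarrow> \<sigma> x (l i x)" using vx[OF i False] False by (simp add: w_def)
    also have "\<dots> \<longleftrightarrow> R (l i x) y" using y(2) lm by (simp add: t_def)
    also have "\<dots> \<longleftrightarrow> R x (k i y)" using kR[OF i, of "l i x" y] kl[OF i] by simp
    finally show ?thesis by (simp add: sym)
  qed
  have agree': "k i q = k j q" if "i \<in> I" "j \<in> I" "k i y = k j y" "q \<in> Range G \<or> q \<in> L" for i j q
    using y_sep that by blast
  have agree_l: "l i d = l j d" if "i \<in> I" "j \<in> I" "k i y = k j y" "d = x \<or> d \<in> Domain G" for i j d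
    using agree'[OF that(1-3), of "l i d"] L that(1,2,4) kl lk by metis
  have agree_y: "agree G i j" if "i \<in> I" "j \<in> I" "k i y = k j y" for i j
    using agree'[OF that] agree_l[OF that] by (auto simp: agree_def)
  have w_agree: "w i = w j" if ij: "i \<in> I" "j \<in> I" and a: "agree G i j" "l i x = l j x" for i j
    using psi_agree[OF ij a(1)] v_agree[OF ij _ a] agree_M[OF a(1)] by (auto simp: w_def)
  have psi_agree': "\<psi>' i m = \<psi>' j m"
    if ij: "i \<in> I" "j \<in> I" and a: "agree G i j" "l i x = l j x" "k i y = k j y" and m: "m \<in> M G' i" for i j m
  proof -
    consider "m \<in> M G i" | "m = x" | "m = k i y" using m M' by auto
    then show ?thesis
    proof cases
      case 1
      then have "m \<in> M G j" using agree_M[OF a(1)] by simp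
      then show ?thesis using 1 ij psiM psi_agree[OF ij a(1)] by simp
    next
      case 2
      then show ?thesis using psix ij w_agree[OF ij a(1,2)] by simp
    next
      case 3
      then show ?thesis using psiy[of i] psiy[of j] a(3) w_agree[OF ij a(1,2)] by simp
    qed
  qed
  \<comment> \<open>At a new end \<open>k i y\<close> the value is read off the images, and by
    \<open>agree_y\<close> it is the same for every index with this end; on the pairs governed by
    \<open>tau_c\<close> it is \<open>cr\<close>. The vertex \<open>x\<close> is no longer an end,
    so only \<open>tau_c\<close> constrains it. All other ends keep \<open>\<sigma>\<close>.\<close>
  define \<tau>' where "\<tau>' e z \<longleftrightarrow> (if \<exists>i\<in>I. e = k i y then
      (if \<exists>j\<in>I. e = k j z then cr e else \<exists>i\<in>I. e = k i y \<and> R (f (\<psi>' i e)) (\<psi>' i (k i z)))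
    else if e = x then cr e else \<sigma> e z)" for e z
  have "conj_state R k l f f' I P cf cr cl G' \<psi>' \<tau>'"
  proof
    show "finite G'" using finG by (simp add: G'_def)
  next
    fix a b a' b' assume "(a, b) \<in> G'" "(a', b') \<in> G'"
    then show "(a = a') = (b = b')" using G_eq x yR by (auto simp: G'_def)
  next
    have tR: "R x a' \<longleftrightarrow> R y b'" if "(a', b') \<in> G" for a' b'
    proof -
      have "R b' y \<longleftrightarrow> t b'" using y(2) that by auto
      also have "\<dots> \<longleftrightarrow> R x a'" using that G_eq[OF that] unfolding t_def by auto
      finally show ?thesis by (simp add: sym)
    qed
    fix a b a' b' assume "(a, b) \<in> G'" "(a', b') \<in> G'"
    then show "R a a' = R b b'" using G_R tR sym irr by (auto simp: G'_def)
  next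
    fix i a b assume i: "i \<in> I" and "a \<in> M G' i" "b \<in> M G' i"
    moreover have "f (w i) \<noteq> w i" using w_nonper[OF i, of 1] by simp
    moreover have "f (w i) \<noteq> \<psi> i m" if "m \<in> M G i" for m using w_endO[OF i that, of 1] by simp
    moreover have "w i = \<psi> i m \<longleftrightarrow> m = x" if "m \<in> M G i" for m using winj[OF i that] that unfolding w_def by metis
    ultimately show "\<psi>' i a = \<psi>' i b \<Longrightarrow> a = b"
      using psiM[OF i] psix[OF i] psiy[of i] psi_inj[OF i] yx[OF i] unfolding M' insert_iff by metis
  next
    fix i a b assume i: "i \<in> I" and "a \<in> M G' i" "b \<in> M G' i"
    then show "R (\<psi>' i a) (\<psi>' i b) = R a b"
      using psiM[OF i] psix[OF i] psiy[of i] psi_R[OF i] wR[OF i] fwR[OF i] fwwR[OF i] sym irr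
      unfolding M' insert_iff by metis
  next
    fix i a b assume i: "i \<in> I" and ab: "(a, b) \<in> G'"
    show "\<psi>' i (k i b) = f (\<psi>' i a)"
    proof (cases "(a, b) \<in> G")
      case True
      then have "a \<in> M G i" "k i b \<in> M G i" by (auto simp: M_def)
      then show ?thesis using psiM[OF i] psi_eq[OF i True] by simp
    next
      case False
      then show ?thesis using ab psix[OF i] psiy[of i] by (simp add: G'_def)
    qed
  next
    fix i j m assume ij: "i \<in> I" "j \<in> I" and a: "agree G' i j" and m: "m \<in> M G' i"
    have "agree G i j" "l i x = l j x" "k i y = k j y"
      using a by (auto simp: agree_def G'_def)
    then show "\<psi>' i m = \<psi>' j m" using psi_agree' ij m by blast
  next
    fix i e and n :: nat assume i: "i \<in> I" and e: "e \<in> E G' i" and n: "0 < n"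
    have "(f ^^ n) (\<psi>' i e) \<noteq> \<psi>' i m" if m: "m \<in> M G' i" for m
    proof (cases "e = k i y")
      case True
      have eq: "(f ^^ n) (f (w i)) = (f ^^ Suc n) (w i)" by (simp add: funpow_swap1)
      have "(f ^^ n) (f (w i)) \<noteq> f (w i)"
        using w_nonper[OF i n] f'f unfolding eq by (metis comp_apply funpow.simps(2))
      moreover have "(f ^^ n) (f (w i)) \<noteq> w i"
        unfolding eq by (rule w_nonper[OF i zero_less_Suc])
      moreover have "(f ^^ n) (f (w i)) \<noteq> \<psi> i m'" if "m' \<in> M G i" for m'
        unfolding eq by (rule w_endO[OF i that zero_less_Suc])
      ultimately show ?thesis
        using m psiM[OF i] psix[OF i] psiy[of i] True unfolding M' insert_iff by metis
    next
      case False
      then have eE: "e \<in> E G i" "e \<noteq> x" using e E'[OF i] by auto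
      then have pe: "\<psi>' i e = \<psi> i e" using psiM[OF i] E_M by blast
      have 1: "(f ^^ j) (\<psi> i e) \<noteq> w i" for j
      proof (cases "x \<in> M G i")
        case True
        have "\<psi> i e \<noteq> \<psi> i x" using psi_inj[OF i E_M[OF eE(1)] True] eE by auto
        then show ?thesis using endO[OF i eE(1), of j] True by (cases "j = 0") (auto simp: w_def)
      qed (use wO i eE E_M in auto)
      obtain n' where n': "n = Suc n'" using n by (cases n) auto
      have "(f ^^ n) (\<psi> i e) \<noteq> f (w i)" using 1[of n'] f'f unfolding n' by (metis comp_apply funpow.simps(2))
      then show ?thesis
        using m 1 endO[OF i eE(1) n] pe psiM[OF i] psix[OF i] psiy[of i] unfolding M' by auto
    qed
    then show "(f ^^ n) (\<psi>' i e) \<notin> \<psi>' i ` M G' i" by auto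
  next
    fix i d and n :: nat assume i: "i \<in> I" and d: "d \<in> S G' i" and n: "0 < n"
    have "\<psi>' i d \<noteq> (f ^^ n) (\<psi>' i m)" if m: "m \<in> M G' i" for m
    proof (cases "d = x")
      case True
      then have xM': "x \<notin> M G i" using d S'[OF i] xS by (auto split: if_splits)
      have "(f ^^ n) (f (w i)) \<noteq> w i" using w_nonper[OF i, of "Suc n"] by (simp add: funpow_swap1)
      then show ?thesis
        using m True psiM[OF i] psix[OF i] psiy[of i] w_nonper[OF i n] wO(1)[OF i xM', of _ n] unfolding M' by fastforce
    next
      case False
      then have dS: "d \<in> S G i" using d S'[OF i] by (auto split: if_splits)
      then have pd: "\<psi>' i d = \<psi> i d" using psiM[OF i] S_M by blast
      have 1: "\<psi> i d \<noteq> (f ^^ n) (w i)" if "0 < n" for n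
        using w_endO[OF i S_M[OF dS] that] by metis
      have "(f ^^ n) (f (w i)) \<noteq> \<psi> i d" using 1[of "Suc n"] by (metis funpow_swap1 comp_apply funpow.simps(2) zero_less_Suc)
      moreover have "\<psi> i d \<noteq> (f ^^ n) (\<psi> i m)" if "m \<in> M G i" for m
        using startO[OF i dS n] that fn_eq by (metis imageI)
      ultimately show ?thesis
        using m 1[OF n] pd psiM[OF i] psix[OF i] psiy[of i] unfolding M' by fastforce
    qed
    then show "(f' ^^ n) (\<psi>' i d) \<notin> \<psi>' i ` M G' i" using fn_eq[of n _ "\<psi>' i d"] by (metis imageE)
  next
    fix i e d assume i: "i \<in> I" and e: "e \<in> E G' i" and d: "d \<in> S G' i"
    have dD: "d = x \<or> d \<in> Domain G" using d unfolding S_def G'_def by auto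
    have dL: "l i d \<in> L" using L[OF i dD] .
    show "R (f (\<psi>' i e)) (\<psi>' i d) = \<tau>' e (l i d)"
    proof (cases "e = k i y")
      case True
      have "\<not> (\<exists>j\<in>I. e = k j (l i d))" using yL[OF i _ dL] True by auto
      then have "\<tau>' e (l i d) \<longleftrightarrow> (\<exists>j\<in>I. e = k j y \<and> R (f (\<psi>' j e)) (\<psi>' j (k j (l i d))))"
        using True i unfolding \<tau>'_def by auto
      also have "\<dots> \<longleftrightarrow> R (f (\<psi>' i e)) (\<psi>' i d)"
      proof -
        have "R (f (\<psi>' j e)) (\<psi>' j (k j (l i d))) \<longleftrightarrow> R (f (\<psi>' i e)) (\<psi>' i d)" if j: "j \<in> I" "e = k j y" for j
        proof -
          have ky: "k i y = k j y" using True j by simp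
          have "k j (l i d) = d" using agree'[OF i j(1) ky, of "l i d"] dL kl[OF i] by simp
          moreover have "e \<in> M G' i" using True M' by simp
          moreover have "d \<in> M G' i" using dD unfolding M_def G'_def by auto
          ultimately show ?thesis
            using psi_agree'[OF i j(1) agree_y[OF i j(1) ky] agree_l[OF i j(1) ky] ky] by simp
        qed
        then show ?thesis using True i by blast
      qed
      finally show ?thesis by simp
    next
      case False
      then have eE: "e \<in> E G i" "e \<noteq> x" using e E'[OF i] by auto
      have "\<not> (\<exists>j\<in>I. e = k j y)" using eE(1) yK i unfolding E_def by (metis DiffD1 imageE)
      then have "\<tau>' e (l i d) \<longleftrightarrow> \<sigma> e (l i d)" using eE unfolding \<tau>'_def by simp
      also have "\<dots> \<longleftrightarrow> R (f (\<psi>' i e)) (\<psi>' i d)"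
      proof (cases "d = x")
        case True
        then have "x \<notin> M G i" using d S'[OF i] xS by (auto split: if_splits)
        then show ?thesis
          using True vE[OF i _ eE(1)] psiM[OF i E_M[OF eE(1)]] psix[OF i] by (simp add: w_def sym)
      next
        case False
        then have "d \<in> S G i" using d S'[OF i] by (auto split: if_splits)
        then show ?thesis using s_ES[OF i eE(1)] psiM[OF i] E_M eE S_M by simp
      qed
      finally show ?thesis by simp
    qed
  next
    fix i z assume "i \<in> I"
    then show "\<tau>' (k i z) z = cr (k i z)" using s_c unfolding \<tau>'_def by auto
  next
    fix i assume i: "i \<in> I"
    have "\<psi> i ` M G i = \<psi>' i ` M G i" using psiM[OF i] by simp
    then show "P \<subseteq> \<psi>' i ` M G' i" using P_sub[OF i] unfolding M' by blast
  next
    fix i u x' assume i: "i \<in> I" and t: "\<And>m. m \<in> M G' i \<Longrightarrow> R u (\<psi>' i m) = R x' m"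
    have "R u (\<psi> i m) = R x' m" if "m \<in> M G i" for m
      using t[of m] psiM[OF i that] that unfolding M' by simp
    then show "cf u = cr x'" by (rule c_type[OF i])
  qed
  moreover have "k i y \<notin> M G j" if "i \<in> I" "j \<in> I" for i j
    using yD[OF that(1)] yK[OF that] unfolding M_def by blast
  moreover have "\<psi>' i x = v i" if "i \<in> I" "x \<notin> M G i" for i
    using psix that by (simp add: w_def)
  ultimately show ?thesis
    using psiM yx agree_y agree_l unfolding G'_def
    by (intro exI[of _ y] exI[of _ \<psi>'] exI[of _ \<tau>']) blast
qed

end

section \<open>Reaching every orbit of \<open>f\<close>\<close>

context conj_setup
begin

abbreviation "st G \<psi> \<tau> \<equiv> conj_state R k l f f' I P cf cr cl G \<psi> \<tau>"

definition extends :: "('v \<times> 'v) set \<Rightarrow> ('i \<Rightarrow> 'v \<Rightarrow> 'v) \<Rightarrow> ('v \<times> 'v) set \<Rightarrow> ('i \<Rightarrow> 'v \<Rightarrow> 'v) \<Rightarrow> bool" where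
  "extends G \<psi> G' \<psi>' \<longleftrightarrow> G \<subseteq> G' \<and> (\<forall>i\<in>I. \<forall>m\<in>M G i. \<psi>' i m = \<psi> i m)"

text \<open>The condition under which one new vertex \<^term>\<open>x\<close> can be sent to \<^term>\<open>u\<close> by all \<^term>\<open>\<psi> i\<close>, \<open>i \<in> L\<close>, whose
  orbits do not contain \<^term>\<open>u\<close> yet. Unlike agreement, it survives the treatment of other sets of
  indices, so that finitely many steps suffice for all of \<^term>\<open>I\<close>.\<close>

definition coherent :: "'v \<Rightarrow> ('v \<times> 'v) set \<Rightarrow> ('i \<Rightarrow> 'v \<Rightarrow> 'v) \<Rightarrow> 'i set \<Rightarrow> bool" where
  "coherent u G \<psi> L \<longleftrightarrow> (\<forall>i\<in>L. \<forall>j\<in>L. \<not> covers G \<psi> i u \<longrightarrow> \<not> covers G \<psi> j u \<longrightarrow>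
    (\<forall>m\<in>M G i \<inter> M G j. R u (\<psi> i m) \<longleftrightarrow> R u (\<psi> j m)) \<and>
    (\<forall>z. k i z \<in> S G i \<longrightarrow> k j z \<in> S G j \<longrightarrow> (R (f u) (\<psi> i (k i z)) \<longleftrightarrow> R (f u) (\<psi> j (k j z)))))"

text \<open>Interface between a single extension and the covering argument. The clauses on
  non-adjacency to \<open>u\<close> and on agreeing indices are the ones that preserve coherence of
  index sets not yet treated.\<close>

definition fresh_step :: "'v \<Rightarrow> ('v \<times> 'v) set \<Rightarrow> ('i \<Rightarrow> 'v \<Rightarrow> 'v) \<Rightarrow> 'v \<Rightarrow> 'i set \<Rightarrow> 'v \<Rightarrow> ('i \<Rightarrow> 'v \<Rightarrow> 'v) \<Rightarrow> ('i \<Rightarrow> 'v) \<Rightarrow> bool" where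
  "fresh_step u G \<psi> x L y \<psi>' v \<longleftrightarrow>
    (\<forall>i\<in>I. (\<forall>m\<in>M G i. \<psi>' i m = \<psi> i m) \<and> (x \<notin> M G i \<longrightarrow> \<psi>' i x = v i)) \<and>
    (\<forall>i\<in>I. k i y \<noteq> x \<and> (\<forall>j\<in>I. k i y \<notin> M G j)) \<and>
    (\<forall>i\<in>I. \<forall>j\<in>I. k i y = k j y \<longrightarrow> agree G i j \<and> l i x = l j x) \<and>
    (\<forall>i\<in>L. v i = u) \<and>
    (\<forall>i\<in>I - L. x \<notin> M G i \<longrightarrow> \<not> covers G \<psi> i u \<longrightarrow> \<not> R (v i) u) \<and>
    (\<forall>i\<in>I. \<forall>j\<in>I. x \<notin> M G i \<longrightarrow> agree G i j \<longrightarrow> l i x = l j x \<longrightarrow> v i = v j)"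

lemma M_mono: "G \<subseteq> G' \<Longrightarrow> M G i \<subseteq> M G' i"
  by (auto simp: M_def)

lemma extends_refl: "extends G \<psi> G \<psi>"
  by (simp add: extends_def)

lemma extends_trans: "extends G \<psi> G' \<psi>' \<Longrightarrow> extends G' \<psi>' G'' \<psi>'' \<Longrightarrow> extends G \<psi> G'' \<psi>''"
  using M_mono[of G G'] unfolding extends_def by (metis subset_trans subsetD)

lemma covers_extends: "extends G \<psi> G' \<psi>' \<Longrightarrow> i \<in> I \<Longrightarrow> covers G \<psi> i u \<Longrightarrow> covers G' \<psi>' i u"
  using M_mono[of G G' i] unfolding extends_def covers_def by (metis subsetD)

end

context conj_state
begin

text \<open>Indices in \<open>L\<close> are forced onto \<open>u\<close>; for the others the start
  of a new orbit comes from \<open>new_orbit_type\<close>. Closure of \<open>L\<close> under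
  agreement is what lets the forced and the free choices together satisfy the agreement requirement
  of \<open>step\<close>.\<close>

lemma step_with:
  assumes x: "x \<notin> Domain G" and LI: "L \<subseteq> I"
    and LM: "\<And>i. i \<in> L \<Longrightarrow> x \<notin> M G i"
    and uO: "\<And>i. i \<in> L \<Longrightarrow> \<not> covers G \<psi> i u"
    and uM: "\<And>i m. i \<in> L \<Longrightarrow> m \<in> M G i \<Longrightarrow> R u (\<psi> i m) \<longleftrightarrow> R x m"
    and uE: "\<And>i e. i \<in> L \<Longrightarrow> e \<in> E G i \<Longrightarrow> R u (f (\<psi> i e)) \<longleftrightarrow> \<sigma> e (l i x)"
    and uS: "\<And>i d. i \<in> L \<Longrightarrow> d \<in> S G i \<Longrightarrow> R (f u) (\<psi> i d) \<longleftrightarrow> \<sigma> x (l i d)"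
    and ux: "\<And>i. i \<in> L \<Longrightarrow> R (f u) u \<longleftrightarrow> \<sigma> x (l i x)"
    and L_closed: "\<And>i j. i \<in> L \<Longrightarrow> j \<in> I \<Longrightarrow> agree G i j \<Longrightarrow> l i x = l j x \<Longrightarrow> j \<in> L"
    and s_x: "\<And>i. i \<in> I \<Longrightarrow> i \<notin> L \<Longrightarrow> x \<notin> M G i \<Longrightarrow> \<sigma> x (l i x) = cr x"
    and s_c: "\<And>i z. i \<in> I \<Longrightarrow> k i z \<noteq> x \<Longrightarrow> \<sigma> (k i z) z = cr (k i z)"
    and s_ES: "\<And>i e d. i \<in> I \<Longrightarrow> e \<in> E G i \<Longrightarrow> d \<in> S G i \<Longrightarrow> R (f (\<psi> i e)) (\<psi> i d) \<longleftrightarrow> \<sigma> e (l i d)"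
  shows "\<exists>y \<psi>' \<tau>' v. st (insert (x, y) G) \<psi>' \<tau>' \<and>
    fresh_step u G \<psi> x L y \<psi>' v"
proof -
  define \<Phi> where "\<Phi> i v \<longleftrightarrow> (\<forall>n. \<forall>m\<in>M G i. (f ^^ n) (\<psi> i m) \<noteq> v \<and> (f ^^ n) v \<noteq> \<psi> i m) \<and>
    (\<forall>m\<in>M G i. R v (\<psi> i m) \<longleftrightarrow> R x m) \<and>
    (\<forall>e\<in>E G i. R v (f (\<psi> i e)) \<longleftrightarrow> \<sigma> e (l i x)) \<and>
    (\<forall>d\<in>S G i. R (f v) (\<psi> i d) \<longleftrightarrow> \<sigma> x (l i d)) \<and>
    (R (f v) v \<longleftrightarrow> cr x) \<and> (\<not> covers G \<psi> i u \<longrightarrow> \<not> R v u)" for i v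
  define v where "v i = (if i \<in> L then u else SOME v. \<Phi> i v)" for i
  have \<Phi>: "\<Phi> i (v i)" if "i \<in> I" "x \<notin> M G i" "i \<notin> L" for i
  proof -
    have "\<exists>v. \<Phi> i v" using new_orbit_type[OF that(1,2), of \<sigma> u] unfolding \<Phi>_def .
    then show ?thesis using someI_ex[of "\<Phi> i"] that(3) by (simp add: v_def)
  qed
  have \<Phi>_imp: "\<Phi> j w" if ij: "i \<in> I" "j \<in> I" "agree G i j" "l i x = l j x" and w: "\<Phi> i w" for i j w
  proof -
    have 1: "\<psi> i m = \<psi> j m" if "m \<in> M G i" for m using psi_agree[OF ij(1-3) that] .
    have 2: "l i d = l j d" if "d \<in> S G i" for d using ij(3) that by (auto simp: agree_def S_def)
    have 3: "covers G \<psi> i u = covers G \<psi> j u"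
      using 1 agree_M[OF ij(3)] unfolding covers_def by simp
    show ?thesis
      using w 1 2 ij(4) E_M S_M
      unfolding \<Phi>_def 3 agree_M[OF ij(3), symmetric] agree_E[OF ij(3), symmetric] agree_S[OF ij(3), symmetric]
      by auto
  qed
  have sym_agree: "agree G i j \<Longrightarrow> agree G j i" for i j by (simp add: agree_def)
  \<comment> \<open>The predicates must be equal, not just both satisfiable: only then does the
    choice operator return the same vertex for agreeing indices.\<close>
  have \<Phi>_eq: "\<Phi> i = \<Phi> j" if "i \<in> I" "j \<in> I" "agree G i j" "l i x = l j x" for i j
    using \<Phi>_imp[OF that] \<Phi>_imp[OF that(2,1) sym_agree[OF that(3)] that(4)[symmetric]] by (auto simp: fun_eq_iff)
  have v_agree: "v i = v j" if "i \<in> I" "j \<in> I" "x \<notin> M G i" "agree G i j" "l i x = l j x" for i j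
  proof -
    have "i \<in> L \<longleftrightarrow> j \<in> L"
      using L_closed[of i j] L_closed[of j i] that sym_agree[OF that(4)] by auto
    then show ?thesis using \<Phi>_eq[OF that(1,2,4,5)] by (simp add: v_def)
  qed
  have vL: "v i = u" if "i \<in> L" for i using that by (simp add: v_def)
  have "\<exists>y \<psi>' \<tau>'. st (insert (x, y) G) \<psi>' \<tau>' \<and>
    (\<forall>i\<in>I. (\<forall>m\<in>M G i. \<psi>' i m = \<psi> i m) \<and> (x \<notin> M G i \<longrightarrow> \<psi>' i x = v i)) \<and>
    (\<forall>i\<in>I. k i y \<noteq> x \<and> (\<forall>j\<in>I. k i y \<notin> M G j)) \<and>
    (\<forall>i\<in>I. \<forall>j\<in>I. k i y = k j y \<longrightarrow> agree G i j \<and> l i x = l j x)"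
  proof (rule step[where \<sigma> = \<sigma>])
    show "x \<notin> Domain G" by (rule x)
    show "v i = v j" if "i \<in> I" "j \<in> I" "x \<notin> M G i" "agree G i j" "l i x = l j x" for i j
      using v_agree that .
    show "(f ^^ n) (\<psi> i m) \<noteq> v i \<and> (f ^^ n) (v i) \<noteq> \<psi> i m" if "i \<in> I" "x \<notin> M G i" "m \<in> M G i" for i n m
      using \<Phi>[OF that(1,2)] uO[of i] vL[of i] that(3) unfolding \<Phi>_def covers_def by metis
    show "R (v i) (\<psi> i m) \<longleftrightarrow> R x m" if "i \<in> I" "x \<notin> M G i" "m \<in> M G i" for i m
      using \<Phi>[OF that(1,2)] uM[of i] vL[of i] that(3) unfolding \<Phi>_def by metis
    show "R (v i) (f (\<psi> i e)) \<longleftrightarrow> \<sigma> e (l i x)" if "i \<in> I" "x \<notin> M G i" "e \<in> E G i" for i e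
      using \<Phi>[OF that(1,2)] uE[of i] vL[of i] that(3) unfolding \<Phi>_def by metis
    show "R (f (v i)) (\<psi> i d) \<longleftrightarrow> \<sigma> x (l i d)" if "i \<in> I" "x \<notin> M G i" "d \<in> S G i" for i d
      using \<Phi>[OF that(1,2)] uS[of i] vL[of i] that(3) unfolding \<Phi>_def by metis
    show "R (f (v i)) (v i) \<longleftrightarrow> \<sigma> x (l i x)" if "i \<in> I" "x \<notin> M G i" for i
      using \<Phi>[OF that(1,2)] ux[of i] vL[of i] s_x[OF that(1) _ that(2)] unfolding \<Phi>_def by metis
  qed (use s_c s_ES in auto)
  moreover have "\<forall>i\<in>I - L. x \<notin> M G i \<longrightarrow> \<not> covers G \<psi> i u \<longrightarrow> \<not> R (v i) u"
    using \<Phi> unfolding \<Phi>_def by blast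
  ultimately show ?thesis
    using vL v_agree unfolding fresh_step_def by blast
qed

lemma forward: "\<exists>G' \<psi>' \<tau>'. st G' \<psi>' \<tau>' \<and> extends G \<psi> G' \<psi>' \<and> x \<in> Domain G'"
proof (cases "x \<in> Domain G")
  case True
  have "st G \<psi> \<tau>" by unfold_locales
  then show ?thesis using True extends_refl by blast
next
  case False
  have c: "\<tau> x (l i x) = cr x" if "i \<in> I" for i
    using tau_c[OF that, of "l i x"] that by (simp add: kl)
  \<comment> \<open>With \<open>L\<close> empty, every index for which \<open>x\<close> is new opens
    its own orbit. \<open>\<tau>\<close> can be kept as \<open>\<sigma>\<close>, because
    \<open>tau_c\<close> applies to \<open>x = k i (l i x)\<close>.\<close>
  have "\<exists>y \<psi>' \<tau>' v. st (insert (x, y) G) \<psi>' \<tau>' \<and> fresh_step undefined G \<psi> x {} y \<psi>' v"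
  proof (rule step_with[where \<sigma> = \<tau>])
    show "x \<notin> Domain G" by (rule False)
  qed (use c tau_c tau_ES in simp_all)
  then obtain y \<psi>' \<tau>' v where 1: "st (insert (x, y) G) \<psi>' \<tau>'" "fresh_step undefined G \<psi> x {} y \<psi>' v"
    by blast
  have "extends G \<psi> (insert (x, y) G) \<psi>'"
    using 1(2) unfolding extends_def fresh_step_def by blast
  moreover have "x \<in> Domain (insert (x, y) G)" by blast
  ultimately show ?thesis using 1(1) by blast
qed

text \<open>A value of \<open>G\<close> is an argument of \<open>G\<inverse>\<close>, so a forward
  step of the dual state suffices; composing with \<open>l i\<close> undoes the passage to the
  dual.\<close>

lemma backward: "\<exists>G' \<psi>' \<tau>'. st G' \<psi>' \<tau>' \<and> extends G \<psi> G' \<psi>' \<and> y \<in> Range G'"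
proof -
  interpret d: conj_state R l k f' f I P cf cl cr "G\<inverse>" "\<lambda>i. \<psi> i \<circ> k i" "\<lambda>z e. \<tau> e z"
    by (rule dual_state)
  obtain G' \<psi>' \<tau>' where 1: "d.st G' \<psi>' \<tau>'" "d.extends (G\<inverse>) (\<lambda>i. \<psi> i \<circ> k i) G' \<psi>'" "y \<in> Domain G'"
    using d.forward[of y] by blast
  have 2: "st (G'\<inverse>) (\<lambda>i. \<psi>' i \<circ> l i) (\<lambda>z e. \<tau>' e z)"
    using conj_state.dual_state[OF 1(1)] .
  have "\<psi>' i (l i m) = \<psi> i m" if "i \<in> I" "m \<in> M G i" for i m
  proof -
    have "l i m \<in> d.M (G\<inverse>) i" using that dual_M by auto
    then show ?thesis using 1(2) that by (auto simp: d.extends_def kl)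
  qed
  then have "extends G \<psi> (G'\<inverse>) (\<lambda>i. \<psi>' i \<circ> l i)"
    using 1(2) by (auto simp: extends_def d.extends_def)
  then show ?thesis using 2 1(3) by blast
qed

text \<open>A new vertex \<open>x\<close> receives over the finite set \<open>Z\<close> the type
  under which the uncovered indices of \<open>L0\<close> see \<open>u\<close>. By coherence these
  views do not contradict each other, so all these indices can send the same \<open>x\<close> to
  \<open>u\<close>. Demands at the ends cannot collide either, since \<open>x\<close> is chosen to
  separate the indices under the maps \<open>l i\<close>.\<close>

lemma cover_class:
  assumes L0: "L0 \<subseteq> I" "coherent u G \<psi> L0"
    and cl: "\<And>i j. i \<in> L0 \<Longrightarrow> j \<in> I \<Longrightarrow> agree G i j \<Longrightarrow> j \<in> L0"
  shows "\<exists>G' \<psi>' \<tau>'. st G' \<psi>' \<tau>' \<and> extends G \<psi> G' \<psi>' \<and> (\<forall>i\<in>L0. covers G' \<psi>' i u) \<and>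
    (\<forall>L2\<subseteq>I. coherent u G \<psi> L2 \<longrightarrow> coherent u G' \<psi>' L2)"
proof -
  define L where "L = {i \<in> L0. \<not> covers G \<psi> i u}"
  have LI: "i \<in> I" if "i \<in> L" for i using that L0(1) by (auto simp: L_def)
  have nc: "\<not> covers G \<psi> i u" if "i \<in> L" for i using that by (simp add: L_def)
  have cohM: "R u (\<psi> i m) \<longleftrightarrow> R u (\<psi> j m)" if "i \<in> L" "j \<in> L" "m \<in> M G i" "m \<in> M G j" for i j m
    using L0(2) that unfolding coherent_def L_def by blast
  have cohS: "R (f u) (\<psi> i (k i z)) \<longleftrightarrow> R (f u) (\<psi> j (k j z))"
    if "i \<in> L" "j \<in> L" "k i z \<in> S G i" "k j z \<in> S G j" for i j z
    using L0(2) that unfolding coherent_def L_def by blast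
  have finD: "finite (Domain G)" "finite (Range G)" using finG by (simp_all add: finite_Domain finite_Range)
  define Z where "Z = Domain G \<union> KI (Range G)"
  have finZ: "finite Z" using finD fin_KI by (simp add: Z_def)
  have M_Z: "M G i \<subseteq> Z" if "i \<in> I" for i using that by (auto simp: M_def Z_def KI_def)
  interpret d: conj_setup R l k f' f I P cf cl cr by (rule dual)
  \<comment> \<open>Keeping \<open>x\<close> out of \<open>KI (LI Z)\<close> makes each
    \<open>l i x\<close> differ from each \<open>l j z\<close> with \<open>z\<close> in
    \<open>Z\<close>, so the demands involving \<open>x\<close> are distinct from all earlier
    ones.\<close>
  obtain x where x: "x \<notin> Z \<union> KI (LI Z)"
    "\<forall>m\<in>Z. R m x \<longleftrightarrow> (\<exists>i\<in>L. m \<in> M G i \<and> R u (\<psi> i m))"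
    and x_sep: "\<forall>i\<in>I. \<forall>j\<in>I. l i x = l j x \<longrightarrow> (\<forall>q\<in>Z. l i q = l j q)"
    using d.separating_type[of Z Z "Z \<union> KI (LI Z)" "\<lambda>m. \<exists>i\<in>L. m \<in> M G i \<and> R u (\<psi> i m)"]
      fin_KI fin_LI finZ by auto
  have xM: "x \<notin> M G i" if "i \<in> I" for i using x M_Z[OF that] by blast
  have E_Z: "e \<in> Z" if "e \<in> E G i" "i \<in> I" for e i using that M_Z E_M by blast
  have S_Z: "e \<in> Z" if "e \<in> S G i" "i \<in> I" for e i using that M_Z S_M by blast
  have xl: "l i x \<noteq> l j z" if "i \<in> I" "j \<in> I" "z \<in> Z" for i j z
  proof
    assume "l i x = l j z"
    then have "x = k i (l j z)" using kl that by metis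
    then show False using x(1) that by (auto simp: KI_def LI_def)
  qed
  have x_agree: "agree G i j" if "i \<in> I" "j \<in> I" "l i x = l j x" for i j
  proof -
    have "k i z = k j z" if z: "z \<in> Range G" for z
    proof -
      have "k i z \<in> Z" using z \<open>i \<in> I\<close> by (auto simp: KI_def Z_def)
      then have "l i (k i z) = l j (k i z)" using x_sep \<open>i \<in> I\<close> \<open>j \<in> I\<close> \<open>l i x = l j x\<close> by blast
      then show ?thesis using lk kl \<open>i \<in> I\<close> \<open>j \<in> I\<close> by metis
    qed
    moreover have "l i z = l j z" if "z \<in> Domain G" for z
      using x_sep \<open>i \<in> I\<close> \<open>j \<in> I\<close> \<open>l i x = l j x\<close> that unfolding Z_def by blast
    ultimately show ?thesis unfolding agree_def by blast
  qed
  have L_cl: "j \<in> L" if "i \<in> L" "j \<in> I" "l i x = l j x" for i j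
  proof -
    have a: "agree G i j" using x_agree[OF LI[OF that(1)] that(2,3)] .
    have "covers G \<psi> i u \<longleftrightarrow> covers G \<psi> j u"
      using psi_agree[OF LI[OF that(1)] that(2) a] agree_M[OF a] unfolding covers_def by simp
    then show ?thesis using that cl[of i j] a by (simp add: L_def)
  qed
  \<comment> \<open>\<^term>\<open>x\<close> and its preimages are new, so \<^term>\<open>\<tau>\<close> may be redefined there to what the image \<^term>\<open>u\<close> dictates.\<close>
  define \<sigma> where "\<sigma> e z \<longleftrightarrow>
    (if e = x then
      if \<exists>i\<in>L. z = l i x then R (f u) u
      else if \<exists>i\<in>L. k i z \<in> S G i then \<exists>i\<in>L. k i z \<in> S G i \<and> R (f u) (\<psi> i (k i z))
      else cr x
     else if \<exists>i\<in>L. z = l i x \<and> e \<in> E G i then \<exists>i\<in>L. z = l i x \<and> e \<in> E G i \<and> R u (f (\<psi> i e)) else \<tau> e z)" for e z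
  have "\<exists>y \<psi>' \<tau>' v. st (insert (x, y) G) \<psi>' \<tau>' \<and>
    fresh_step u G \<psi> x L y \<psi>' v"
  proof (rule step_with[where \<sigma> = \<sigma>])
    show "x \<notin> Domain G" using x by (simp add: Z_def)
    show "L \<subseteq> I" using LI by blast
    show "x \<notin> M G i" if "i \<in> L" for i using xM LI that by blast
    show "\<not> covers G \<psi> i u" if "i \<in> L" for i using nc that .
    show "R u (\<psi> i m) \<longleftrightarrow> R x m" if i: "i \<in> L" and m: "m \<in> M G i" for i m
    proof -
      have "m \<in> Z" using m M_Z LI[OF i] by blast
      then show ?thesis using x(2) cohM[OF i _ m] i m sym[of x m] by blast
    qed
    show "R u (f (\<psi> i e)) \<longleftrightarrow> \<sigma> e (l i x)" if i: "i \<in> L" and e: "e \<in> E G i" for i e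
    proof -
      have "e \<noteq> x" using that xM[OF LI] E_M by auto
      have "\<psi> i e = \<psi> j e" if "j \<in> L" "l i x = l j x" for j
        using psi_agree[OF LI[OF i] LI[OF that(1)] x_agree[OF LI[OF i] LI[OF that(1)] that(2)]] E_M[OF e] .
      then have "(\<exists>j\<in>L. l i x = l j x \<and> e \<in> E G j \<and> R u (f (\<psi> j e))) \<longleftrightarrow> R u (f (\<psi> i e))"
        using i e by metis
      moreover have "\<exists>j\<in>L. l i x = l j x \<and> e \<in> E G j" using i e by blast
      ultimately show ?thesis unfolding \<sigma>_def by (simp only: if_True if_False \<open>e \<noteq> x\<close>)
    qed
    show "R (f u) (\<psi> i d) \<longleftrightarrow> \<sigma> x (l i d)" if i: "i \<in> L" and d: "d \<in> S G i" for i d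
    proof -
      have 1: "\<not> (\<exists>j\<in>L. l i d = l j x)" using xl[OF LI LI[OF i] S_Z[OF d LI[OF i]]] by metis
      have ki: "k i (l i d) = d" using kl LI i by blast
      have "R (f u) (\<psi> j (k j (l i d))) \<longleftrightarrow> R (f u) (\<psi> i d)" if "j \<in> L" "k j (l i d) \<in> S G j" for j
        using cohS[OF i that(1), of "l i d"] that(2) ki d by simp
      then have "(\<exists>j\<in>L. k j (l i d) \<in> S G j \<and> R (f u) (\<psi> j (k j (l i d)))) \<longleftrightarrow> R (f u) (\<psi> i d)"
        using i d ki by metis
      moreover have "\<exists>j\<in>L. k j (l i d) \<in> S G j" using i d ki by metis
      ultimately show ?thesis using 1 unfolding \<sigma>_def by (simp only: if_True if_False simp_thms)
    qed
    show "R (f u) u \<longleftrightarrow> \<sigma> x (l i x)" if "i \<in> L" for i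
    proof -
      have "\<exists>j\<in>L. l i x = l j x" using that by blast
      then show ?thesis unfolding \<sigma>_def by (simp only: if_True simp_thms)
    qed
    show "j \<in> L" if "i \<in> L" "j \<in> I" "agree G i j" "l i x = l j x" for i j
      using L_cl that by blast
    show "\<sigma> x (l i x) = cr x" if i: "i \<in> I" "i \<notin> L" for i
    proof -
      have "\<not> (\<exists>j\<in>L. l i x = l j x)" using L_cl i by metis
      have "k j (l i x) \<notin> S G j" if "j \<in> L" for j
        using xl[OF i(1) LI[OF that], of "k j (l i x)"] S_Z[OF _ LI[OF that]] lk LI that by metis
      then have "\<not> (\<exists>j\<in>L. k j (l i x) \<in> S G j)" by blast
      with \<open>\<not> (\<exists>j\<in>L. l i x = l j x)\<close> show ?thesis unfolding \<sigma>_def by (simp only: if_True if_False simp_thms)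
    qed
    show "\<sigma> (k i z) z = cr (k i z)" if i: "i \<in> I" "k i z \<noteq> x" for i z
    proof -
      have "z \<noteq> l j x" if "j \<in> L" "k i z \<in> E G j" for j
        using xl[OF LI[OF that(1)] i(1) E_Z[OF that(2) LI[OF that(1)]]] lk[OF i(1)] by metis
      then have "\<not> (\<exists>j\<in>L. z = l j x \<and> k i z \<in> E G j)" by blast
      then show ?thesis using i(2) tau_c[OF i(1)] unfolding \<sigma>_def by (simp only: if_False simp_thms)
    qed
    show "R (f (\<psi> i e)) (\<psi> i d) \<longleftrightarrow> \<sigma> e (l i d)" if i: "i \<in> I" and e: "e \<in> E G i" and d: "d \<in> S G i" for i e d
    proof -
      have "e \<noteq> x" using e xM[OF i] E_M by blast
      have "\<not> (\<exists>j\<in>L. l i d = l j x)" using xl[OF LI i S_Z[OF d i]] by metis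
      then have "\<not> (\<exists>j\<in>L. l i d = l j x \<and> e \<in> E G j)" by blast
      with \<open>e \<noteq> x\<close> have "\<sigma> e (l i d) \<longleftrightarrow> \<tau> e (l i d)" unfolding \<sigma>_def by (simp only: if_False simp_thms)
      then show ?thesis using tau_ES[OF i e d] by simp
    qed
  qed
  then obtain y \<psi>' \<tau>' v where st': "st (insert (x, y) G) \<psi>' \<tau>'" and fs: "fresh_step u G \<psi> x L y \<psi>' v"
    by blast
  have psi': "\<psi>' i m = \<psi> i m" if "i \<in> I" "m \<in> M G i" for i m
    using fs that unfolding fresh_step_def by blast
  have psix: "\<psi>' i x = v i" if "i \<in> I" for i
    using fs that xM unfolding fresh_step_def by blast
  have yx: "k i y \<noteq> x" if "i \<in> I" for i
    using fs that unfolding fresh_step_def by blast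
  have yM: "k i y \<notin> M G j" if "i \<in> I" "j \<in> I" for i j
    using fs that unfolding fresh_step_def by blast
  have y_agree: "agree G i j \<and> l i x = l j x" if "i \<in> I" "j \<in> I" "k i y = k j y" for i j
    using fs that unfolding fresh_step_def by blast
  have vL: "v i = u" if "i \<in> L" for i
    using fs that unfolding fresh_step_def by blast
  have vnL: "\<not> R (v i) u" if "i \<in> I" "i \<notin> L" "\<not> covers G \<psi> i u" for i
    using fs that xM unfolding fresh_step_def by blast
  have v_agree: "v i = v j" if "i \<in> I" "j \<in> I" "agree G i j" "l i x = l j x" for i j
    using fs that xM unfolding fresh_step_def by blast
  let ?G = "insert (x, y) G"
  interpret s': conj_state R k l f f' I P cf cr cl ?G \<psi>' \<tau>' by (rule st')
  have ext: "extends G \<psi> ?G \<psi>'" using psi' by (auto simp: extends_def)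
  have covL: "covers ?G \<psi>' i u" if "i \<in> L" for i
  proof -
    have "\<psi>' i x = u" using psix[OF LI[OF that]] vL[OF that] by simp
    then show ?thesis unfolding covers_def M_def by (intro bexI[of _ x] exI[of _ 0]) auto
  qed
  \<comment> \<open>Only \<open>x\<close> and a common value \<open>k i y = k j y\<close> are new
    shared points. At \<open>x\<close> both adjacencies to \<open>u\<close> are false by the choice
    of \<open>v\<close>; a common value forces agreement, hence equal images. Among starts only
    \<open>x\<close> can be new, and by \<open>xl\<close> it can be paired only with itself.\<close>
  have "coherent u ?G \<psi>' L2" if L2: "L2 \<subseteq> I" "coherent u G \<psi> L2" for L2
    unfolding coherent_def
  proof (intro ballI impI conjI allI)
    fix i j assume ij: "i \<in> L2" "j \<in> L2" and nc': "\<not> covers ?G \<psi>' i u" "\<not> covers ?G \<psi>' j u"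
    have I: "i \<in> I" "j \<in> I" using ij L2 by auto
    have nL: "i \<notin> L" "j \<notin> L" using covL nc' by auto
    have ncG: "\<not> covers G \<psi> i u" "\<not> covers G \<psi> j u" using covers_extends[OF ext] I nc' by auto
    have psiy: "\<psi>' i (k i y) = f (v i)" if "i \<in> I" for i
      using s'.psi_eq[OF that, of x y] psix[OF that] by simp
    {
      fix m assume "m \<in> M ?G i \<inter> M ?G j"
      then consider "m = x" | "m = k i y" "m = k j y" | "m \<in> M G i" "m \<in> M G j"
        using yx[OF I(1)] yx[OF I(2)] yM[OF I] yM[OF I(2,1)] xM[OF I(1)] xM[OF I(2)] by (auto simp: M_def)
      then show "R u (\<psi>' i m) \<longleftrightarrow> R u (\<psi>' j m)"
      proof cases
        case 1
        then show ?thesis using vnL[OF I(1) nL(1) ncG(1)] vnL[OF I(2) nL(2) ncG(2)] psix I sym by auto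
      next
        case 2
        then have "k i y = k j y" by (rule subst)
        then have "v i = v j" using y_agree[OF I] v_agree[OF I] by blast
        moreover have "\<psi>' i m = f (v i)" unfolding 2(1) by (rule psiy[OF I(1)])
        moreover have "\<psi>' j m = f (v j)" unfolding 2(2) by (rule psiy[OF I(2)])
        ultimately show ?thesis by (simp only:)
      next
        case 3
        then have "R u (\<psi> i m) \<longleftrightarrow> R u (\<psi> j m)"
          using L2(2) ij ncG unfolding coherent_def by blast
        then show ?thesis using psi'[OF I(1) 3(1)] psi'[OF I(2) 3(2)] by (simp only:)
      qed
    }
    fix z assume z: "k i z \<in> S ?G i" "k j z \<in> S ?G j"
    have old: "k i z \<in> S G i" if "k i z \<in> S ?G i" "k i z \<noteq> x" for i
      using that by (auto simp: S_def)
    show "R (f u) (\<psi>' i (k i z)) \<longleftrightarrow> R (f u) (\<psi>' j (k j z))"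
    proof (cases "k i z = x"; cases "k j z = x")
      assume x': "k i z = x" "k j z = x"
      then have "l i x = l j x" using lk I by metis
      then have "v i = v j" using x_agree[OF I] v_agree[OF I] by blast
      then show ?thesis using psix I x' by simp
    next
      assume x': "k i z = x" "k j z \<noteq> x"
      then have "l i x = l j (k j z)" using lk I by metis
      then show ?thesis using xl[OF I S_Z[OF old[OF z(2) x'(2)] I(2)]] by blast
    next
      assume x': "k i z \<noteq> x" "k j z = x"
      then have "l j x = l i (k i z)" using lk I by metis
      then show ?thesis using xl[OF I(2,1) S_Z[OF old[OF z(1) x'(1)] I(1)]] by blast
    next
      assume x': "k i z \<noteq> x" "k j z \<noteq> x"
      have "k i z \<in> S G i" "k j z \<in> S G j" using old z x' by auto
      then have "R (f u) (\<psi> i (k i z)) \<longleftrightarrow> R (f u) (\<psi> j (k j z))"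
        using L2(2) ij ncG unfolding coherent_def by blast
      then show ?thesis
        using psi'[OF I(1) S_M[OF old[OF z(1) x'(1)]]] psi'[OF I(2) S_M[OF old[OF z(2) x'(2)]]] by (simp only:)
    qed
  qed
  moreover have "covers ?G \<psi>' i u" if "i \<in> L0" for i
    using covL[of i] covers_extends[OF ext, of i u] that L0(1) by (auto simp: L_def)
  ultimately show ?thesis using st' ext by blast
qed

text \<open>One step per agreement class of the initial \<open>G\<close> is enough. Later steps
  refine agreement and may split a class, but the class stays coherent and closed under the finer
  agreement, so it can still be treated as a whole.\<close>

lemma cover_all: "\<exists>G' \<psi>' \<tau>'. st G' \<psi>' \<tau>' \<and> extends G \<psi> G' \<psi>' \<and> (\<forall>i\<in>I. covers G' \<psi>' i u)"
proof -
  have st: "st G \<psi> \<tau>" by unfold_locales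
  define C where "C j = {i \<in> I. agree G j i}" for j
  have coh: "coherent u G \<psi> (C j)" if "j \<in> I" for j
    unfolding coherent_def
  proof (intro ballI impI conjI allI)
    fix i i' assume i: "i \<in> C j" "i' \<in> C j"
    then have a: "agree G i i'" and I: "i \<in> I" "i' \<in> I" by (auto simp: C_def agree_def)
    show "R u (\<psi> i m) \<longleftrightarrow> R u (\<psi> i' m)" if "m \<in> M G i \<inter> M G i'" for m
      using psi_agree[OF I a] that by simp
    fix z assume z: "k i z \<in> S G i" "k i' z \<in> S G i'"
    have "l i (k i z) = l i' (k i z)" using a z by (auto simp: agree_def S_def)
    then have "k i z = k i' z" using lk kl I by metis
    then show "R (f u) (\<psi> i (k i z)) \<longleftrightarrow> R (f u) (\<psi> i' (k i' z))"
      using psi_agree[OF I a S_M[OF z(1)]] by simp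
  qed
  have *: "\<exists>G' \<psi>' \<tau>'. st G' \<psi>' \<tau>' \<and> extends G \<psi> G' \<psi>' \<and> (\<forall>j\<in>J. \<forall>i\<in>C j. covers G' \<psi>' i u) \<and>
      (\<forall>L2\<subseteq>I. coherent u G \<psi> L2 \<longrightarrow> coherent u G' \<psi>' L2)"
    if "finite J" "J \<subseteq> I" for J
    using that
  proof (induction J rule: finite_induct)
    case empty
    then show ?case using extends_refl st by blast
  next
    case (insert j J)
    then obtain G1 \<psi>1 \<tau>1 where 1: "st G1 \<psi>1 \<tau>1" "extends G \<psi> G1 \<psi>1"
      "\<forall>j\<in>J. \<forall>i\<in>C j. covers G1 \<psi>1 i u" "\<forall>L2\<subseteq>I. coherent u G \<psi> L2 \<longrightarrow> coherent u G1 \<psi>1 L2" by auto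
    interpret s1: conj_state R k l f f' I P cf cr cl G1 \<psi>1 \<tau>1 by (rule 1)
    have "C j \<subseteq> I" by (auto simp: C_def)
    moreover have "coherent u G1 \<psi>1 (C j)" using 1(4) coh insert.prems \<open>C j \<subseteq> I\<close> by auto
    moreover have "i' \<in> C j" if "i \<in> C j" "i' \<in> I" "agree G1 i i'" for i i'
    proof -
      have "G \<subseteq> G1" using 1(2) by (simp add: extends_def)
      then have "agree G i i'" using that(3) unfolding agree_def by blast
      then show ?thesis using that by (auto simp: C_def agree_def)
    qed
    ultimately obtain G2 \<psi>2 \<tau>2 where 2: "st G2 \<psi>2 \<tau>2" "extends G1 \<psi>1 G2 \<psi>2"
      "\<forall>i\<in>C j. covers G2 \<psi>2 i u" "\<forall>L2\<subseteq>I. coherent u G1 \<psi>1 L2 \<longrightarrow> coherent u G2 \<psi>2 L2"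
      using s1.cover_class[of "C j" u] by blast
    have "\<forall>j\<in>J. \<forall>i\<in>C j. covers G2 \<psi>2 i u"
      using 1(3) covers_extends[OF 2(2)] by (auto simp: C_def)
    then show ?case
      using 2 1(4) extends_trans[OF 1(2) 2(2)] by (intro exI[of _ G2] exI[of _ \<psi>2] exI[of _ \<tau>2]) auto
  qed
  \<comment> \<open>A code for the agreement class of \<open>i\<close>, with values in a finite
    product of the value sets.\<close>
  define h where "h i = (restrict (k i) (Range G), restrict (l i) (Domain G))" for i
  have finD: "finite (Domain G)" "finite (Range G)" using finG by (simp_all add: finite_Domain finite_Range)
  have "h ` I \<subseteq> (\<Pi>\<^sub>E x\<in>Range G. (\<lambda>i. k i x) ` I) \<times> (\<Pi>\<^sub>E x\<in>Domain G. (\<lambda>i. l i x) ` I)"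
    by (auto simp: h_def)
  moreover have "finite ((\<Pi>\<^sub>E x\<in>Range G. (\<lambda>i. k i x) ` I) \<times> (\<Pi>\<^sub>E x\<in>Domain G. (\<lambda>i. l i x) ` I))"
    using finD fink finl by (intro finite_cartesian_product finite_PiE) auto
  ultimately have "finite (h ` I)" by (rule finite_subset)
  then obtain J where J: "J \<subseteq> I" "finite J" "h ` I = h ` J"
    using finite_subset_image[OF _ subset_refl, of h I] by blast
  have "\<exists>j\<in>J. i \<in> C j" if "i \<in> I" for i
  proof -
    have "h i \<in> h ` J" unfolding J(3)[symmetric] using that by (rule imageI)
    then obtain j where j: "j \<in> J" "h i = h j" by (rule imageE)
    have "k j y = k i y" if "y \<in> Range G" for y
      using j(2) that unfolding h_def by (metis Pair_inject restrict_apply')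
    moreover have "l j y = l i y" if "y \<in> Domain G" for y
      using j(2) that unfolding h_def by (metis Pair_inject restrict_apply')
    ultimately show ?thesis using j(1) that unfolding C_def agree_def by blast
  qed
  then show ?thesis using *[OF J(2,1)] by blast
qed

section \<open>Passage to the limit\<close>

lemma extend_all:
  "\<exists>G' \<psi>' \<tau>'. st G' \<psi>' \<tau>' \<and> extends G \<psi> G' \<psi>' \<and> x \<in> Domain G' \<and> x \<in> Range G' \<and> (\<forall>i\<in>I. covers G' \<psi>' i x)"
proof -
  obtain G1 \<psi>1 \<tau>1 where 1: "st G1 \<psi>1 \<tau>1" "extends G \<psi> G1 \<psi>1" "x \<in> Domain G1"
    using forward by blast
  interpret s1: conj_state R k l f f' I P cf cr cl G1 \<psi>1 \<tau>1 by (rule 1)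
  obtain G2 \<psi>2 \<tau>2 where 2: "st G2 \<psi>2 \<tau>2" "extends G1 \<psi>1 G2 \<psi>2" "x \<in> Range G2"
    using s1.backward by blast
  interpret s2: conj_state R k l f f' I P cf cr cl G2 \<psi>2 \<tau>2 by (rule 2)
  obtain G3 \<psi>3 \<tau>3 where 3: "st G3 \<psi>3 \<tau>3" "extends G2 \<psi>2 G3 \<psi>3" "\<forall>i\<in>I. covers G3 \<psi>3 i x"
    using s2.cover_all by blast
  have "extends G \<psi> G3 \<psi>3"
    using extends_trans[OF extends_trans[OF 1(2) 2(2)] 3(2)] .
  moreover have "x \<in> Domain G3" "x \<in> Range G3"
    using 1(3) 2(2,3) 3(2) unfolding extends_def by blast+
  ultimately show ?thesis using 3 by blast
qed

text \<open>Vertex number \<open>n\<close> is treated at step \<open>n\<close>, and the union of the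
  approximations is taken. Each \<open>\<theta>\<close> is onto because its image is a union of
  \<open>f\<close>-orbits, \<open>k i \<circ> g\<close> being a bijection, and by
  \<open>covers\<close> it meets every orbit.\<close>

theorem limit:
  "\<exists>g. bij g \<and> (\<forall>x y. R (g x) (g y) \<longleftrightarrow> R x y) \<and>
    (\<forall>i\<in>I. \<exists>\<theta>. bij \<theta> \<and> (\<forall>x y. R (\<theta> x) (\<theta> y) \<longleftrightarrow> R x y) \<and> (\<forall>x. \<theta> (k i (g x)) = f (\<theta> x)))"
proof -
  let ?P = "\<lambda>(n::nat) (G, \<psi>, \<tau>). st G \<psi> \<tau>"
  let ?Q = "\<lambda>n (G, \<psi>, \<tau>) (G', \<psi>', \<tau>'). extends G \<psi> G' \<psi>' \<and>
    from_nat n \<in> Domain G' \<and> from_nat n \<in> Range G' \<and> (\<forall>i\<in>I. covers G' \<psi>' i (from_nat n))"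
  have "\<exists>s. \<forall>n. ?P n (s n) \<and> ?Q n (s n) (s (Suc n))"
  proof (rule dependent_nat_choice)
    have "st G \<psi> \<tau>" by unfold_locales
    then show "\<exists>s. ?P 0 s" by blast
  next
    fix s and n :: nat assume "?P n s"
    moreover obtain G1 \<psi>1 \<tau>1 where s: "s = (G1, \<psi>1, \<tau>1)" by (cases s)
    ultimately interpret s1: conj_state R k l f f' I P cf cr cl G1 \<psi>1 \<tau>1 by simp
    show "\<exists>y. ?P (Suc n) y \<and> ?Q n s y"
      using s1.extend_all[of "from_nat n"] s by auto
  qed
  then obtain s where s: "\<forall>n. ?P n (s n) \<and> ?Q n (s n) (s (Suc n))" by (rule exE)
  define Gs where "Gs n = fst (s n)" for n
  define ps where "ps n = fst (snd (s n))" for n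
  define ts where "ts n = snd (snd (s n))" for n
  have st: "st (Gs n) (ps n) (ts n)" for n using spec[OF s, of n] by (simp add: Gs_def ps_def ts_def case_prod_unfold)
  have ext1: "extends (Gs n) (ps n) (Gs (Suc n)) (ps (Suc n))" for n
    using spec[OF s, of n] by (simp add: Gs_def ps_def case_prod_unfold)
  have D: "x \<in> Domain (Gs (Suc (to_nat x)))" and Rg: "x \<in> Range (Gs (Suc (to_nat x)))" for x
    using spec[OF s, of "to_nat x"] by (auto simp: Gs_def case_prod_unfold)
  have cov: "covers (Gs (Suc (to_nat x))) (ps (Suc (to_nat x))) i x" if "i \<in> I" for i x
    using spec[OF s, of "to_nat x"] that by (simp add: Gs_def ps_def case_prod_unfold)
  have ext: "extends (Gs m) (ps m) (Gs n) (ps n)" if "m \<le> n" for m n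
    using that by (induction n rule: dec_induct) (auto intro: extends_refl extends_trans[OF _ ext1])
  have sub: "Gs m \<subseteq> Gs n" if "m \<le> n" for m n using ext[OF that] by (simp add: extends_def)
  define H where "H = (\<Union>n. Gs n)"
  have H2: "\<exists>n. a \<in> Gs n \<and> b \<in> Gs n" if ab: "a \<in> H" "b \<in> H" for a b
  proof -
    obtain m n where "a \<in> Gs m" "b \<in> Gs n" using ab unfolding H_def by blast
    then have "a \<in> Gs (max m n)" "b \<in> Gs (max m n)" using sub[of m "max m n"] sub[of n "max m n"] by auto
    then show ?thesis by blast
  qed
  have H_eq: "x = x' \<longleftrightarrow> y = y'" and H_R: "R x x' \<longleftrightarrow> R y y'" if "(x, y) \<in> H" "(x', y') \<in> H" for x y x' y'
    using H2[OF that] conj_state.G_eq[OF st] conj_state.G_R[OF st] by blast+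
  have HD: "\<exists>y. (x, y) \<in> H" and HR: "\<exists>y. (y, x) \<in> H" for x
    using D[of x] Rg[of x] unfolding H_def by blast+
  define g where "g x = (SOME y. (x, y) \<in> H)" for x
  have g: "(x, g x) \<in> H" for x using HD[of x] unfolding g_def by (rule someI_ex)
  have "bij g"
  proof (rule bijI)
    show "inj g" using H_eq[OF g g] by (auto intro: injI)
    show "surj g" using HR g H_eq by (metis surjI)
  qed
  moreover have "R (g x) (g y) \<longleftrightarrow> R x y" for x y using H_R[OF g g] by simp
  moreover have "\<exists>\<theta>. bij \<theta> \<and> (\<forall>x y. R (\<theta> x) (\<theta> y) \<longleftrightarrow> R x y) \<and> (\<forall>x. \<theta> (k i (g x)) = f (\<theta> x))"
    if i: "i \<in> I" for i
  proof -
    \<comment> \<open>Step \<open>to_nat x\<close> treats \<open>x\<close>, so the approximation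
      with the next index is sure to contain it; \<open>extends\<close> keeps the value from then
      on.\<close>
    define \<theta> where "\<theta> x = ps (Suc (to_nat x)) i x" for x
    have M: "x \<in> M (Gs (Suc (to_nat x))) i" for x using D[of x] by (simp add: M_def)
    have M_up: "x \<in> M (Gs n) i" if "to_nat x < n" for x n
      using M[of x] M_mono[OF sub[of "Suc (to_nat x)" n]] that by auto
    have \<theta>: "\<theta> x = ps n i x" if "x \<in> M (Gs n) i" for x n
    proof -
      have up: "ps b i m = ps a i m" if "a \<le> b" "m \<in> M (Gs a) i" for a b m
        using ext[OF that(1)] that(2) i unfolding extends_def by blast
      show ?thesis
        using up[of n "max n (Suc (to_nat x))" x] up[of "Suc (to_nat x)" "max n (Suc (to_nat x))" x] that M[of x]
        by (simp add: \<theta>_def)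
    qed
    have two: "\<exists>n. x \<in> M (Gs n) i \<and> y \<in> M (Gs n) i" for x y
      by (rule exI[of _ "Suc (max (to_nat x) (to_nat y))"]) (auto intro: M_up)
    have \<theta>_R: "R (\<theta> x) (\<theta> y) \<longleftrightarrow> R x y" for x y
      using two[of x y] \<theta> conj_state.psi_R[OF st i] by metis
    have \<theta>_inj: "\<theta> x = \<theta> y \<Longrightarrow> x = y" for x y
      using two[of x y] \<theta> conj_state.psi_inj[OF st i] by metis
    have \<theta>_eq: "\<theta> (k i (g x)) = f (\<theta> x)" for x
    proof -
      obtain n where n: "(x, g x) \<in> Gs n" using g[of x] by (auto simp: H_def)
      then have "x \<in> M (Gs n) i" "k i (g x) \<in> M (Gs n) i" by (auto simp: M_def)
      then show ?thesis using \<theta> conj_state.psi_eq[OF st i n] by simp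
    qed
    define c where "c = k i \<circ> g"
    have "bij (k i)" using kl[OF i] lk[OF i] by (metis bijI')
    then have c: "bij c" unfolding c_def using \<open>bij g\<close> by (rule bij_comp[rotated])
    have pow: "\<theta> ((c ^^ n) x) = (f ^^ n) (\<theta> x)" for n x
      by (induction n) (simp_all add: c_def \<theta>_eq)
    have "\<exists>x. \<theta> x = u" for u
    proof -
      obtain m n where "(f ^^ n) (\<theta> m) = u \<or> (f ^^ n) u = \<theta> m"
        using cov[OF i, of u] \<theta> unfolding covers_def by metis
      then show ?thesis
      proof
        assume "(f ^^ n) (\<theta> m) = u"
        then show ?thesis using pow by metis
      next
        assume a: "(f ^^ n) u = \<theta> m"
        have "surj (c ^^ n)" using c by (simp add: bij_is_surj surj_fn)
        then obtain x where "(c ^^ n) x = m" by (metis surjD)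
        then have "(f ^^ n) (\<theta> x) = (f ^^ n) u" using pow a by metis
        then have "\<theta> x = u" unfolding fn_eq using fn_eq by metis
        then show ?thesis by blast
      qed
    qed
    then have "bij \<theta>" using \<theta>_inj by (metis bijI')
    then show ?thesis using \<theta>_R \<theta>_eq by blast
  qed
  ultimately show ?thesis by blast
qed

end

section \<open>Automorphisms and their orbits\<close>

lemma Aut_iff: "f \<in> carrier (Aut R) \<longleftrightarrow> bij f \<and> (\<forall>x y. R (f x) (f y) \<longleftrightarrow> R x y)"
  by (simp add: Aut_def)

lemma Aut_mult: "f \<otimes>\<^bsub>Aut R\<^esub> g = f \<circ> g"
  by (simp add: Aut_def)

lemma Aut_one: "\<one>\<^bsub>Aut R\<^esub> = id"
  by (simp add: Aut_def)

lemma Aut_inv_carrier: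
  assumes "f \<in> carrier (Aut R)"
  shows "inv_into UNIV f \<in> carrier (Aut R)"
proof -
  have f: "bij f" using assms by (simp add: Aut_iff)
  have "R (inv_into UNIV f x) (inv_into UNIV f y) \<longleftrightarrow> R x y" for x y
    using assms f by (metis Aut_iff bij_inv_eq_iff)
  then show ?thesis using bij_imp_bij_inv[OF f] by (simp add: Aut_iff)
qed

lemma Aut_inv:
  assumes "f \<in> carrier (Aut R)"
  shows "inv\<^bsub>Aut R\<^esub> f = inv_into UNIV f"
proof (rule group.inv_equality[OF group_Aut])
  show "inv_into UNIV f \<otimes>\<^bsub>Aut R\<^esub> f = \<one>\<^bsub>Aut R\<^esub>"
    using assms by (simp add: Aut_iff Aut_mult Aut_one bij_is_inj)
qed (use assms Aut_inv_carrier in auto)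

lemma Aut_comp: "f \<in> carrier (Aut R) \<Longrightarrow> g \<in> carrier (Aut R) \<Longrightarrow> f \<circ> g \<in> carrier (Aut R)"
  by (simp add: Aut_iff bij_comp)

lemma Aut_nat_pow: "f [^]\<^bsub>Aut R\<^esub> (n::nat) = f ^^ n"
proof (induction n)
  case 0
  then show ?case by (simp add: nat_pow_def Aut_one)
next
  case (Suc n)
  have "f [^]\<^bsub>Aut R\<^esub> Suc n = f [^]\<^bsub>Aut R\<^esub> n \<otimes>\<^bsub>Aut R\<^esub> f"
    by (simp add: nat_pow_def)
  then show ?case using Suc by (simp add: Aut_mult funpow_swap1 fun_eq_iff)
qed

lemma bij_funpow_inv:
  fixes f :: "'a \<Rightarrow> 'a"
  assumes "bij f"
  shows "inv_into UNIV (f ^^ n) u = v \<longleftrightarrow> (f ^^ n) v = u"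
  using bij_inv_eq_iff[OF bij_fn[OF assms]] by metis

lemma Aut_funpow: "f \<in> carrier (Aut R) \<Longrightarrow> f ^^ n \<in> carrier (Aut R)"
  by (induction n) (auto simp: Aut_iff bij_comp)

text \<open>Lets all later arguments use iteration \<open>^^\<close> alone, negative powers being
  expressed by exchanging the two points.\<close>

lemma mem_orb:
  assumes f: "f \<in> carrier (Aut R)"
  shows "v \<in> orb R f A \<longleftrightarrow> (\<exists>u\<in>A. \<exists>n. (f ^^ n) u = v \<or> (f ^^ n) v = u)"
proof -
  have bf: "bij f" using f by (simp add: Aut_iff)
  have pow: "f [^]\<^bsub>Aut R\<^esub> (z::int) = (if z < 0 then inv_into UNIV (f ^^ nat (- z)) else f ^^ nat z)" for z
    by (simp add: int_pow_def2 Aut_nat_pow Aut_inv[OF Aut_funpow[OF f]])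
  have "(\<exists>z. (f [^]\<^bsub>Aut R\<^esub> (z::int)) u = v) \<longleftrightarrow> (\<exists>n. (f ^^ n) u = v \<or> (f ^^ n) v = u)" for u
  proof
    assume "\<exists>z. (f [^]\<^bsub>Aut R\<^esub> (z::int)) u = v"
    then show "\<exists>n. (f ^^ n) u = v \<or> (f ^^ n) v = u"
      unfolding pow using bij_funpow_inv[OF bf] by (metis (full_types))
  next
    assume "\<exists>n. (f ^^ n) u = v \<or> (f ^^ n) v = u"
    then obtain n where n: "(f ^^ n) u = v \<or> (f ^^ n) v = u" by blast
    show "\<exists>z. (f [^]\<^bsub>Aut R\<^esub> (z::int)) u = v"
    proof (cases "(f ^^ n) u = v")
      case True
      then show ?thesis by (intro exI[of _ "int n"]) (simp add: pow)
    next
      case False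
      then have v: "(f ^^ n) v = u" using n by blast
      \<comment> \<open>At \<open>n = 0\<close> the exponent \<open>- int n\<close> would fall into
        the non-negative branch of \<open>pow\<close>.\<close>
      then have "n \<noteq> 0" using False by (cases n) auto
      then show ?thesis using v bij_funpow_inv[OF bf] by (intro exI[of _ "- int n"]) (simp add: pow)
    qed
  qed
  moreover have "v \<in> orb R f A \<longleftrightarrow> (\<exists>u\<in>A. \<exists>z. (f [^]\<^bsub>Aut R\<^esub> (z::int)) u = v)"
    unfolding orb_def by auto
  ultimately show ?thesis by simp
qed

section \<open>Periodic points and good automorphisms\<close>

definition periodic_points :: "('v \<Rightarrow> 'v) \<Rightarrow> 'v set" where
  "periodic_points f = {v. \<exists>n>0. (f ^^ n) v = v}"

lemma inj_funpow: "inj (f :: 'a \<Rightarrow> 'a) \<Longrightarrow> (f ^^ n) x = (f ^^ n) y \<Longrightarrow> x = y"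
  using inj_fn[of f n] by (simp add: inj_eq)

lemma funpow_diff_fixed:
  fixes f :: "'a \<Rightarrow> 'a"
  assumes "inj f" "(f ^^ i) v = (f ^^ j) v" "i < j"
  shows "(f ^^ (j - i)) v = v"
proof -
  have "(f ^^ i) ((f ^^ (j - i)) v) = (f ^^ i) v"
    using assms(2,3) by (simp flip: comp_apply[of "f ^^ i"] funpow_add)
  then show ?thesis using inj_funpow[OF assms(1)] by blast
qed

lemma funpow_fixed_mult: "(f ^^ n) v = v \<Longrightarrow> (f ^^ (n * m)) v = v"
  by (induction m) (simp_all add: funpow_add)

lemma finite_orb_iff:
  assumes f: "f \<in> carrier (Aut R)"
  shows "finite (orb R f {v}) \<longleftrightarrow> v \<in> periodic_points f"
proof
  have inj: "inj f" using f by (simp add: Aut_iff bij_is_inj)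
  assume fin: "finite (orb R f {v})"
  have "range (\<lambda>n. (f ^^ n) v) \<subseteq> orb R f {v}" using mem_orb[OF f] by blast
  then have "\<not> inj (\<lambda>n. (f ^^ n) v)" using fin finite_subset finite_imageD infinite_UNIV_nat by metis
  then obtain i j where "(f ^^ i) v = (f ^^ j) v" "i < j"
    unfolding inj_def by (metis linorder_neqE_nat)
  then show "v \<in> periodic_points f"
    using funpow_diff_fixed[OF inj] unfolding periodic_points_def by (metis (mono_tags, lifting) mem_Collect_eq zero_less_diff)
next
  have inj: "inj f" using f by (simp add: Aut_iff bij_is_inj)
  assume "v \<in> periodic_points f"
  then obtain n where n: "n > 0" "(f ^^ n) v = v" by (auto simp: periodic_points_def)
  have red: "(f ^^ m) v = (f ^^ (m mod n)) v" for m
  proof -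
    have "(f ^^ (m mod n + n * (m div n))) v = (f ^^ (m mod n)) v"
      unfolding funpow_add comp_apply funpow_fixed_mult[OF n(2)] ..
    then show ?thesis by simp
  qed
  have "w \<in> (\<lambda>m. (f ^^ m) v) ` {..<n}" if w: "w \<in> orb R f {v}" for w
  proof -
    obtain m where "(f ^^ m) v = w \<or> (f ^^ m) w = v" using w mem_orb[OF f] by auto
    \<comment> \<open>A negative power is a positive one modulo the period: \<open>- m\<close> and
      \<open>m * (n - 1)\<close> differ by \<open>m * n\<close>.\<close>
    moreover have "w = (f ^^ (m * (n - 1))) v" if "(f ^^ m) w = v"
    proof -
      have "m + m * (n - 1) = n * m" using n(1) by (cases n) (auto simp: algebra_simps)
      then have "(f ^^ m) ((f ^^ (m * (n - 1))) v) = v"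
        using funpow_fixed_mult[OF n(2), of m] by (simp flip: comp_apply[of "f ^^ m"] funpow_add)
      then show ?thesis using inj_funpow[OF inj] that by metis
    qed
    ultimately obtain m where "w = (f ^^ m) v" by blast
    then show ?thesis using red[of m] n(1) by auto
  qed
  then show "finite (orb R f {v})" by (meson finite_imageI finite_lessThan finite_subset subsetI)
qed

lemma self_mem_orb: "f \<in> carrier (Aut R) \<Longrightarrow> v \<in> orb R f {v}"
  using mem_orb[of f R v "{v}"] by (metis funpow_0 insertI1)

lemma finitely_many_finite_orbits_iff:
  assumes f: "f \<in> carrier (Aut R)"
  shows "finitely_many_finite_orbits R f \<longleftrightarrow> finite (periodic_points f)"
proof -
  let ?X = "{W \<in> orbits_of R f. finite W}"
  have X: "?X = (\<lambda>v. orb R f {v}) ` periodic_points f"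
    using finite_orb_iff[OF f] by (auto simp: orbits_of_def)
  have "periodic_points f \<subseteq> \<Union>?X"
    using self_mem_orb[OF f] unfolding X by blast
  then have "finite ?X \<Longrightarrow> finite (periodic_points f)"
    by (auto intro: finite_subset)
  moreover have "finite (periodic_points f) \<Longrightarrow> finite ?X" unfolding X by simp
  ultimately show ?thesis unfolding finitely_many_finite_orbits_def by blast
qed

lemma no_finite_orbits_iff:
  assumes f: "f \<in> carrier (Aut R)"
  shows "no_finite_orbits R f \<longleftrightarrow> periodic_points f = {}"
  using finite_orb_iff[OF f] unfolding no_finite_orbits_def orbits_of_def by blast

text \<open>One finite set with a predicate replaces the two disjoint sets, so that types can be
  shifted, merged and restricted; \<open>extv\<close> has the same form.\<close>

lemma extension_off_orbits_iff:
  assumes f: "f \<in> carrier (Aut R)"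
  shows "extension_off_orbits R f \<longleftrightarrow> (\<forall>F t. finite F \<longrightarrow>
    (\<exists>v. (\<forall>x\<in>F. R x v \<longleftrightarrow> t x) \<and> (\<forall>n. \<forall>u\<in>F. (f ^^ n) u \<noteq> v \<and> (f ^^ n) v \<noteq> u)))"
    (is "_ \<longleftrightarrow> ?rhs")
proof
  assume E: "extension_off_orbits R f"
  show ?rhs
  proof (intro allI impI)
    fix F :: "'a set" and t assume F: "finite F"
    have "{x \<in> F. t x} \<union> {x \<in> F. \<not> t x} = F" by blast
    moreover have "\<exists>v. (\<forall>x\<in>{x \<in> F. t x}. R x v) \<and> (\<forall>y\<in>{x \<in> F. \<not> t x}. \<not> R y v) \<and>
      v \<notin> orb R f ({x \<in> F. t x} \<union> {x \<in> F. \<not> t x})"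
      by (rule E[unfolded extension_off_orbits_def, rule_format]) (use F in auto)
    ultimately obtain v where "\<forall>x\<in>{x \<in> F. t x}. R x v" "\<forall>y\<in>{x \<in> F. \<not> t x}. \<not> R y v" "v \<notin> orb R f F"
      by auto
    then show "\<exists>v. (\<forall>x\<in>F. R x v \<longleftrightarrow> t x) \<and> (\<forall>n. \<forall>u\<in>F. (f ^^ n) u \<noteq> v \<and> (f ^^ n) v \<noteq> u)"
      using mem_orb[OF f] by blast
  qed
next
  assume r: ?rhs
  show "extension_off_orbits R f"
    unfolding extension_off_orbits_def
  proof (intro allI impI)
    fix A B :: "'a set" assume AB: "finite A \<and> finite B \<and> A \<inter> B = {}"
    then have fin: "finite (A \<union> B)" by simp
    obtain v where v: "(\<forall>x\<in>A \<union> B. R x v \<longleftrightarrow> x \<in> A) \<and> (\<forall>n. \<forall>u\<in>A \<union> B. (f ^^ n) u \<noteq> v \<and> (f ^^ n) v \<noteq> u)"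
      using r[rule_format, OF fin, of "\<lambda>x. x \<in> A"] by (rule exE)
    then have "v \<notin> orb R f (A \<union> B)" unfolding mem_orb[OF f] by blast
    moreover have "(\<forall>x\<in>A. R x v) \<and> (\<forall>y\<in>B. \<not> R y v)" using v AB by blast
    ultimately show "\<exists>v. (\<forall>x\<in>A. R x v) \<and> (\<forall>y\<in>B. \<not> R y v) \<and> v \<notin> orb R f (A \<union> B)"
      by blast
  qed
qed

definition good :: "('v \<Rightarrow> 'v \<Rightarrow> bool) \<Rightarrow> ('v \<Rightarrow> 'v) \<Rightarrow> bool" where
  "good R f \<longleftrightarrow> extension_off_orbits R f \<and> finitely_many_finite_orbits R f"

text \<open>Phrased through an intertwining map instead of group conjugation, so that either
  direction can be supplied without rewriting inverses.\<close>

lemma good_conj: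
  assumes f: "f \<in> carrier (Aut R)" and f': "f' \<in> carrier (Aut R)" and h: "h \<in> carrier (Aut R)"
    and eq: "\<And>x. f' (h x) = h (f x)" and g: "good R f"
  shows "good R f'"
proof -
  have bh: "bij h" and hR: "\<And>x y. R (h x) (h y) \<longleftrightarrow> R x y" using h by (auto simp: Aut_iff)
  have pow: "(f' ^^ n) (h x) = h ((f ^^ n) x)" for n x
    by (induction n) (simp_all add: eq)
  have h_eq: "h x = h y \<longleftrightarrow> x = y" for x y using bh by (simp add: bij_is_inj inj_eq)
  have surj: "\<exists>x. y = h x" for y using bh by (metis bij_pointE)
  have "periodic_points f' = h ` periodic_points f"
  proof (rule Set.set_eqI)
    fix y obtain x where "y = h x" using surj by blast
    then show "y \<in> periodic_points f' \<longleftrightarrow> y \<in> h ` periodic_points f"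
      by (auto simp: periodic_points_def pow h_eq)
  qed
  then have "finitely_many_finite_orbits R f'"
    using g finitely_many_finite_orbits_iff[OF f] finitely_many_finite_orbits_iff[OF f'] by (simp add: good_def)
  moreover have "extension_off_orbits R f'"
    unfolding extension_off_orbits_iff[OF f']
  proof (intro allI impI)
    fix F :: "'a set" and t assume F: "finite F"
    let ?F = "h -` F"
    have "finite ?F" using F bh by (simp add: bij_is_inj finite_vimageI)
    then obtain v where v: "\<forall>x\<in>?F. R x v \<longleftrightarrow> t (h x)" "\<forall>n. \<forall>u\<in>?F. (f ^^ n) u \<noteq> v \<and> (f ^^ n) v \<noteq> u"
      using g[unfolded good_def extension_off_orbits_iff[OF f], THEN conjunct1, rule_format, of ?F "\<lambda>x. t (h x)"]
      by blast
    have "R x (h v) \<longleftrightarrow> t x" if "x \<in> F" for x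
    proof -
      obtain x' where "x = h x'" using surj by blast
      then show ?thesis using that v(1) hR by simp
    qed
    moreover have "(f' ^^ n) u \<noteq> h v \<and> (f' ^^ n) (h v) \<noteq> u" if "u \<in> F" for n u
    proof -
      obtain u' where "u = h u'" using surj by blast
      then show ?thesis using that v(2) pow h_eq by simp
    qed
    ultimately show "\<exists>v. (\<forall>x\<in>F. R x v \<longleftrightarrow> t x) \<and> (\<forall>n. \<forall>u\<in>F. (f' ^^ n) u \<noteq> v \<and> (f' ^^ n) v \<noteq> u)"
      by blast
  qed
  ultimately show ?thesis by (simp add: good_def)
qed

section \<open>Available adjacencies between a vertex and its image\<close>

lemma common_period:
  fixes f :: "'a \<Rightarrow> 'a"
  assumes "finite P" "P \<subseteq> periodic_points f"
  shows "\<exists>m>0. \<forall>a\<in>P. (f ^^ m) a = a"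
  using assms
proof (induction P rule: finite_induct)
  case empty
  then show ?case by (intro exI[of _ 1]) simp
next
  case (insert a P)
  then obtain m where m: "m > 0" "\<forall>a\<in>P. (f ^^ m) a = a" by auto
  obtain n where n: "n > 0" "(f ^^ n) a = a" using insert.prems by (auto simp: periodic_points_def)
  have "(f ^^ (n * m)) b = b" if "b \<in> insert a P" for b
    using that funpow_fixed_mult[of n f a m] funpow_fixed_mult[of m f b n] n m by (auto simp: mult.commute)
  then show ?case using m(1) n(1) by (intro exI[of _ "n * m"]) auto
qed

text \<open>Multiples of a common period fix \<open>P\<close> pointwise. Along them each
  non-periodic \<open>b\<close> runs injectively, so only finitely many multiples carry a point of
  \<open>F1\<close> into \<open>F0\<close>.\<close>

lemma avoiding_shift:
  fixes f :: "'a \<Rightarrow> 'a"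
  assumes inj: "inj f" and fin: "finite F0" "finite F1" and P: "finite P" "P \<subseteq> periodic_points f"
    and F1: "F1 \<inter> periodic_points f = {}"
  shows "\<exists>N. (\<forall>a\<in>P. (f ^^ N) a = a) \<and> (\<forall>b\<in>F1. (f ^^ N) b \<notin> F0)"
proof -
  obtain m where m: "m > 0" "\<forall>a\<in>P. (f ^^ m) a = a" using common_period[OF P] by blast
  have inj_shift: "inj (\<lambda>j. (f ^^ (m * j)) b)" if b: "b \<in> F1" for b
  proof (rule injI, rule ccontr)
    fix j j' assume eq: "(f ^^ (m * j)) b = (f ^^ (m * j')) b" and "j \<noteq> j'"
    then have "m * j < m * j' \<or> m * j' < m * j" using m(1) by auto
    then have "\<exists>n>0. (f ^^ n) b = b"
      using funpow_diff_fixed[OF inj eq] funpow_diff_fixed[OF inj eq[symmetric]] by (metis zero_less_diff)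
    then show False using F1 b by (auto simp: periodic_points_def)
  qed
  have fin2: "finite (\<Union>b\<in>F1. (\<lambda>j. (f ^^ (m * j)) b) -` F0)"
    by (rule finite_UN_I[OF fin(2) finite_vimageI[OF fin(1) inj_shift]])
  obtain j where "j \<notin> (\<Union>b\<in>F1. (\<lambda>j. (f ^^ (m * j)) b) -` F0)"
    using ex_new_if_finite[OF infinite_UNIV_nat fin2] by (rule exE)
  then have "\<forall>b\<in>F1. (f ^^ (m * j)) b \<notin> F0" by blast
  moreover have "\<forall>a\<in>P. (f ^^ (m * j)) a = a" using m(2) funpow_fixed_mult by metis
  ultimately show ?thesis by blast
qed

text \<open>If one type forbids \<^term>\<open>R (f v) v\<close> and another one forbids its negation, then so does a shift of
  the second along \<^term>\<open>f\<close>. A shift compatible with the first type gives a type that cannot be realised.\<close>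

lemma forced_edge:
  assumes f: "f \<in> carrier (Aut R)" and ext: "extension_off_orbits R f"
    and fin: "finite (periodic_points f)"
  shows "\<exists>b. \<forall>F t. finite F \<longrightarrow> periodic_points f \<subseteq> F \<longrightarrow> (\<forall>a\<in>periodic_points f. t a \<longleftrightarrow> a \<in> p) \<longrightarrow>
    (\<exists>v. (\<forall>x\<in>F. R x v \<longleftrightarrow> t x) \<and> (R (f v) v \<longleftrightarrow> b) \<and> (\<forall>n. \<forall>u\<in>F. (f ^^ n) u \<noteq> v \<and> (f ^^ n) v \<noteq> u))"
    (is "\<exists>b. \<forall>F t. ?ok b F t")
proof (rule ccontr)
  let ?P = "periodic_points f"
  let ?off = "\<lambda>F v. \<forall>n. \<forall>u\<in>F. (f ^^ n) u \<noteq> v \<and> (f ^^ n) v \<noteq> u"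
  assume *: "\<nexists>b. \<forall>F t. ?ok b F t"
  have **: "\<exists>F t. finite F \<and> ?P \<subseteq> F \<and> (\<forall>a\<in>?P. t a \<longleftrightarrow> a \<in> p) \<and>
    \<not> (\<exists>v. (\<forall>x\<in>F. R x v \<longleftrightarrow> t x) \<and> (R (f v) v \<longleftrightarrow> b) \<and> ?off F v)" for b
  proof (rule ccontr)
    assume none: "\<not> (\<exists>F t. finite F \<and> ?P \<subseteq> F \<and> (\<forall>a\<in>?P. t a \<longleftrightarrow> a \<in> p) \<and>
      \<not> (\<exists>v. (\<forall>x\<in>F. R x v \<longleftrightarrow> t x) \<and> (R (f v) v \<longleftrightarrow> b) \<and> ?off F v))"
    have "\<forall>F t. ?ok b F t"
      by (intro allI impI, rule ccontr, rule notE[OF none], intro exI conjI)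
    with * show False by (rule notE[OF _ exI])
  qed
  obtain F0 t0 where F0: "finite F0" "?P \<subseteq> F0" "\<forall>a\<in>?P. t0 a \<longleftrightarrow> a \<in> p"
    "\<not> (\<exists>v. (\<forall>x\<in>F0. R x v \<longleftrightarrow> t0 x) \<and> (R (f v) v \<longleftrightarrow> True) \<and> ?off F0 v)" using **[of True] by (elim exE conjE)
  obtain F1 t1 where F1: "finite F1" "?P \<subseteq> F1" "\<forall>a\<in>?P. t1 a \<longleftrightarrow> a \<in> p"
    "\<not> (\<exists>v. (\<forall>x\<in>F1. R x v \<longleftrightarrow> t1 x) \<and> (R (f v) v \<longleftrightarrow> False) \<and> ?off F1 v)" using **[of False] by (elim exE conjE)
  have bf: "bij f" and fR: "\<And>x y. R (f x) (f y) \<longleftrightarrow> R x y" using f by (auto simp: Aut_iff)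
  have inj: "inj f" using bf by (rule bij_is_inj)
  obtain N where N: "\<forall>a\<in>?P. (f ^^ N) a = a" "\<forall>b\<in>F1 - ?P. (f ^^ N) b \<notin> F0"
    using avoiding_shift[OF inj F0(1), of "F1 - ?P" ?P] fin F1(1) by auto
  \<comment> \<open>The two types are consistent: periodic points are fixed by the shift and both
    types follow \<open>p\<close> there, while all other shifted points miss
    \<open>F0\<close>.\<close>
  define t where "t x = (if x \<in> F0 then t0 x else \<exists>y\<in>F1. x = (f ^^ N) y \<and> t1 y)" for x
  have fin': "finite (F0 \<union> (f ^^ N) ` F1)" using F0 F1 by simp
  obtain v where v: "\<forall>x\<in>F0 \<union> (f ^^ N) ` F1. R x v \<longleftrightarrow> t x" "?off (F0 \<union> (f ^^ N) ` F1) v"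
    using ext[unfolded extension_off_orbits_iff[OF f], rule_format, OF fin', of t] by blast
  have t1: "t ((f ^^ N) y) \<longleftrightarrow> t1 y" if "y \<in> F1" for y
  proof (cases "y \<in> ?P")
    case True
    then have "(f ^^ N) y = y" "y \<in> F0" using N F0 by auto
    then show ?thesis using F0(3) F1(3) True by (simp add: t_def)
  next
    case False
    then have "(f ^^ N) y \<notin> F0" using N that by blast
    then show ?thesis using inj_funpow[OF inj] that unfolding t_def by metis
  qed
  have "\<forall>x\<in>F0. R x v \<longleftrightarrow> t0 x" using v(1) by (simp add: t_def)
  then have nR: "\<not> R (f v) v" using F0(4) v(2) by blast
  \<comment> \<open>Realising the first type forces \<open>R (f v) v\<close> to fail. Shifting back,
    \<open>w\<close> realises the second type with the same failure, against the choice of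
    \<open>F1\<close> and \<open>t1\<close>.\<close>
  obtain w where w: "(f ^^ N) w = v" using bij_fn[OF bf, of N] by (metis bij_pointE)
  have pR: "R ((f ^^ n) x) ((f ^^ n) y) \<longleftrightarrow> R x y" for n x y
    by (induction n) (simp_all add: fR)
  have "R x w \<longleftrightarrow> t1 x" if "x \<in> F1" for x
    using v(1) that t1 pR[of N x w] w by auto
  moreover have "\<not> R (f w) w"
  proof -
    have "(f ^^ N) (f w) = f v" using w funpow_swap1[of f N w] by simp
    then show ?thesis using nR pR[of N "f w" w] w by simp
  qed
  moreover have "(f ^^ n) u \<noteq> w \<and> (f ^^ n) w \<noteq> u" if "u \<in> F1" for n u
  proof -
    have "(f ^^ n) ((f ^^ N) x) = (f ^^ N) ((f ^^ n) x)" for x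
      by (simp flip: comp_apply[of "f ^^ n"] comp_apply[of "f ^^ N"] funpow_add add: add.commute)
    then show ?thesis using v(2) that w by (metis UnCI imageI)
  qed
  ultimately show False using F1(4) by blast
qed

text \<open>The members of \<open>K\<close> index themselves. As their inverses agree on the
  periodic points, the vertices \<open>k z\<close> have the same type over these points for all
  \<open>k\<close>; this is the reason why \<open>cf (k0 z)\<close> can play the part of
  \<open>cl z\<close>.\<close>

lemma catching:
  fixes R :: "'v::countable \<Rightarrow> 'v \<Rightarrow> bool"
  assumes R: "random_graph R" and f: "f \<in> carrier (Aut R)" and g: "good R f"
    and K: "K \<subseteq> carrier (Aut R)" "k0 \<in> K"
    and fin: "\<And>x. finite ((\<lambda>k. k x) ` K)" "\<And>x. finite ((\<lambda>k. inv_into UNIV k x) ` K)"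
    and k0: "\<And>k a. k \<in> K \<Longrightarrow> a \<in> periodic_points f \<Longrightarrow> k (inv_into UNIV k0 a) = a"
  shows "\<exists>g\<in>carrier (Aut R). \<forall>k\<in>K. k \<circ> g \<in> conjugacy_class (Aut R) f"
proof -
  let ?P = "periodic_points f"
  have finP: "finite ?P" using g finitely_many_finite_orbits_iff[OF f] by (simp add: good_def)
  have ext: "extension_off_orbits R f" using g by (simp add: good_def)
  have bf: "bij f" and fR: "\<And>x y. R (f x) (f y) \<longleftrightarrow> R x y" using f by (auto simp: Aut_iff)
  have sym: "R x y \<longleftrightarrow> R y x" for x y using R by (auto simp: random_graph_def symp_def)
  obtain B where B: "\<forall>p. \<forall>F t. finite F \<longrightarrow> ?P \<subseteq> F \<longrightarrow> (\<forall>a\<in>?P. t a \<longleftrightarrow> a \<in> p) \<longrightarrow>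
    (\<exists>v. (\<forall>x\<in>F. R x v \<longleftrightarrow> t x) \<and> (R (f v) v \<longleftrightarrow> B p) \<and> (\<forall>n. \<forall>u\<in>F. (f ^^ n) u \<noteq> v \<and> (f ^^ n) v \<noteq> u))"
    using choice[OF allI[OF forced_edge[OF f ext finP]]] by (rule exE)
  \<comment> \<open>\<open>B p\<close> is a value available for every finite type that extends
    \<open>p\<close>; \<open>cf\<close> reads \<open>p\<close> off the vertex.\<close>
  define cf where "cf v = B {a \<in> ?P. R a v}" for v
  have cf_eq: "cf v = cf w" if "\<And>a. a \<in> ?P \<Longrightarrow> R a v \<longleftrightarrow> R a w" for v w
  proof -
    have "{a \<in> ?P. R a v} = {a \<in> ?P. R a w}" using that by blast
    then show ?thesis by (simp add: cf_def)
  qed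
  have kb: "bij k" and kR: "\<And>x y. R (k x) (k y) \<longleftrightarrow> R x y" if "k \<in> K" for k
    using K(1) that by (auto simp: Aut_iff)
  let ?l = "inv_into UNIV"
  have fP: "f a \<in> ?P" if a: "a \<in> ?P" for a
  proof -
    obtain n where "n > 0" "(f ^^ n) a = a" using a by (auto simp: periodic_points_def)
    then have "(f ^^ n) (f a) = f a" by (metis funpow_swap1)
    then show ?thesis using \<open>n > 0\<close> by (auto simp: periodic_points_def)
  qed
  have kP: "k (?l k0 a) = a" if "k \<in> K" "a \<in> ?P" for k a using k0 that .
  have "conj_setup R (\<lambda>k. k) ?l f (?l f) K ?P cf cf (\<lambda>z. cf (k0 z))"
  proof
    show "random_graph R" by (rule R)
    show "k (?l k x) = x" "?l k (k x) = x" if "k \<in> K" for k x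
      using kb[OF that] by (simp_all add: bij_is_inj bij_is_surj surj_f_inv_f)
    show "R (k x) (k y) = R x y" if "k \<in> K" for k x y using kR[OF that] .
    show "f (?l f x) = x" "?l f (f x) = x" for x using bf by (simp_all add: bij_is_inj bij_is_surj surj_f_inv_f)
    show "R (f x) (f y) = R x y" for x y by (rule fR)
    show "finite ?P" by (rule finP)
    show "x \<in> ?P" if "0 < n" "(f ^^ n) x = x" for n x using that by (auto simp: periodic_points_def)
    show "\<exists>v. (\<forall>x\<in>F. R x v = t x) \<and> R (f v) v = cf v \<and> (\<forall>n. \<forall>u\<in>F. (f ^^ n) u \<noteq> v \<and> (f ^^ n) v \<noteq> u)"
      if F: "finite F" "?P \<subseteq> F" for F t
    proof -
      obtain v where v: "\<forall>x\<in>F. R x v \<longleftrightarrow> t x" "R (f v) v \<longleftrightarrow> B {a \<in> ?P. t a}"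
        "\<forall>n. \<forall>u\<in>F. (f ^^ n) u \<noteq> v \<and> (f ^^ n) v \<noteq> u"
        using B[rule_format, OF F, of t "{a \<in> ?P. t a}"] by auto
      have "{a \<in> ?P. t a} = {a \<in> ?P. R a v}" using v(1) F(2) by blast
      then have "R (f v) v = cf v" using v(2) by (simp add: cf_def)
      then show ?thesis using v(1,3) by blast
    qed
    show "cf (k z) = cf (k0 z)" if k: "k \<in> K" for k z
    proof (rule cf_eq)
      fix a assume a: "a \<in> ?P"
      have "R a (k' z) \<longleftrightarrow> R (?l k0 a) z" if "k' \<in> K" for k'
        using kR[OF that, of "?l k0 a" z] kP[OF that a] by simp
      then show "R a (k z) = R a (k0 z)" using k K(2) by simp
    qed
  qed (use fin in auto)
  then interpret c: conj_setup R "\<lambda>k. k" ?l f "?l f" K ?P cf cf "\<lambda>z. cf (k0 z)" .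
  \<comment> \<open>With this start, \<open>k\<close> after \<open>G\<close> equals \<open>f\<close>
    on the periodic points for every member \<open>k\<close>. The identity is then a partial
    conjugacy with closed chains only, so there are no ends or starts and \<open>\<tau>\<close> has
    just \<open>tau_c\<close> to satisfy.\<close>
  define G where "G = (\<lambda>a. (a, ?l k0 (f a))) ` ?P"
  have fPP: "f ` ?P = ?P"
    using endo_inj_surj[OF finP, of f] fP bf by (meson bij_is_inj image_subsetI inj_on_subset subset_UNIV)
  have kG: "k ` Range G = ?P" if "k \<in> K" for k
  proof -
    have "k ` Range G = (\<lambda>a. k (?l k0 (f a))) ` ?P" by (auto simp: G_def)
    also have "\<dots> = f ` ?P" using kP[OF that fP] by simp
    finally show ?thesis using fPP by simp
  qed
  have DG: "Domain G = ?P" by (auto simp: G_def)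
  have M: "c.M G k = ?P" and E: "c.E G k = {}" and S: "c.S G k = {}" if "k \<in> K" for k
    using kG[OF that] DG by (simp_all add: c.M_def c.E_def c.S_def)
  have "conj_state R (\<lambda>k. k) ?l f (?l f) K ?P cf cf (\<lambda>z. cf (k0 z)) G (\<lambda>k x. x) (\<lambda>e z. cf e)"
  proof
    have l_eq: "?l k0 x = ?l k0 y \<longleftrightarrow> x = y" for x y
      using kb[OF K(2)] by (metis bij_inv_eq_iff)
    have l_R: "R (?l k0 x) (?l k0 y) \<longleftrightarrow> R x y" for x y
      using c.lR[OF K(2)] .
    show "finite G" using finP by (simp add: G_def)
    fix x y x' y' assume "(x, y) \<in> G" "(x', y') \<in> G"
    then have "y = ?l k0 (f x)" "y' = ?l k0 (f x')" by (auto simp: G_def)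
    then show "(x = x') = (y = y')" "R x x' = R y y'"
      using bf by (simp_all add: l_eq l_R fR bij_is_inj inj_eq)
  next
    fix k x y assume "k \<in> K" "(x, y) \<in> G"
    then show "k y = f x" using kP fP by (auto simp: G_def)
  next
    fix k v x assume k: "k \<in> K" and t: "\<And>m. m \<in> c.M G k \<Longrightarrow> R v m = R x m"
    show "cf v = cf x"
      by (rule cf_eq) (use t M[OF k] sym in blast)
  qed (simp_all add: M E S)
  then interpret s: conj_state R "\<lambda>k. k" ?l f "?l f" K ?P cf cf "\<lambda>z. cf (k0 z)" G "\<lambda>k x. x" "\<lambda>e z. cf e" .
  obtain g where g: "bij g" "\<forall>x y. R (g x) (g y) \<longleftrightarrow> R x y"
    "\<forall>k\<in>K. \<exists>\<theta>. bij \<theta> \<and> (\<forall>x y. R (\<theta> x) (\<theta> y) \<longleftrightarrow> R x y) \<and> (\<forall>x. \<theta> (k (g x)) = f (\<theta> x))"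
    using s.limit by blast
  have "g \<in> carrier (Aut R)" using g by (simp add: Aut_iff)
  moreover have "k \<circ> g \<in> conjugacy_class (Aut R) f" if k: "k \<in> K" for k
  proof -
    obtain \<theta> where \<theta>: "bij \<theta>" "\<forall>x y. R (\<theta> x) (\<theta> y) \<longleftrightarrow> R x y" "\<forall>x. \<theta> (k (g x)) = f (\<theta> x)"
      using g(3) k by blast
    then have th: "\<theta> \<in> carrier (Aut R)" by (simp add: Aut_iff)
    let ?h = "?l \<theta>"
    have h: "?h \<in> carrier (Aut R)" using Aut_inv_carrier[OF th] .
    have "?h \<otimes>\<^bsub>Aut R\<^esub> f \<otimes>\<^bsub>Aut R\<^esub> inv\<^bsub>Aut R\<^esub> ?h = ?h \<circ> f \<circ> \<theta>"
      using Aut_inv[OF h] inv_inv_eq[OF \<theta>(1)] by (simp add: Aut_mult)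
    also have "\<dots> = k \<circ> g"
    proof
      fix x
      have "?h (f (\<theta> x)) = ?h (\<theta> (k (g x)))" using \<theta>(3) by simp
      also have "\<dots> = k (g x)" using \<theta>(1) by (simp add: bij_is_inj)
      finally show "(?h \<circ> f \<circ> \<theta>) x = (k \<circ> g) x" by simp
    qed
    finally have eq: "?h \<otimes>\<^bsub>Aut R\<^esub> f \<otimes>\<^bsub>Aut R\<^esub> inv\<^bsub>Aut R\<^esub> ?h = k \<circ> g" .
    show ?thesis unfolding conjugacy_class_def by (intro CollectI exI[of _ ?h] conjI eq[symmetric] h)
  qed
  ultimately show ?thesis by blast
qed

section \<open>Compact sets and tightness in the automorphism group\<close>

lemma Aut_topology_basis:
  assumes U: "openin (Aut_topology R) U" and f: "f \<in> U"
  shows "\<exists>F. finite F \<and> {g \<in> carrier (Aut R). \<forall>v\<in>F. g v = f v} \<subseteq> U"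
proof -
  obtain W where W: "openin (product_topology (\<lambda>_. discrete_topology UNIV) UNIV) W" "U = W \<inter> carrier (Aut R)"
    using U unfolding Aut_topology_def openin_subtopology by blast
  obtain Y where Y: "finite {i \<in> UNIV. Y i \<noteq> topspace (discrete_topology UNIV)}" "f \<in> Pi\<^sub>E UNIV Y" "Pi\<^sub>E UNIV Y \<subseteq> W"
    using W f unfolding openin_product_topology_alt by blast
  let ?F = "{i. Y i \<noteq> UNIV}"
  have "g \<in> Pi\<^sub>E UNIV Y" if "\<forall>v\<in>?F. g v = f v" for g
  proof -
    have "g i \<in> Y i" for i
      using that Y(2) by (cases "Y i = UNIV") (auto simp: PiE_def Pi_def)
    then show ?thesis by (simp add: PiE_def extensional_def)
  qed
  then have "{g \<in> carrier (Aut R). \<forall>v\<in>?F. g v = f v} \<subseteq> U" using Y(3) W(2) by blast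
  moreover have "finite ?F" using Y(1) by simp
  ultimately show ?thesis by blast
qed

lemma openin_eval: "openin (Aut_topology R) {f \<in> carrier (Aut R). f v = w}"
proof -
  have "continuous_map (product_topology (\<lambda>_. discrete_topology UNIV) UNIV) (discrete_topology UNIV) (\<lambda>f. f v)"
    by (rule continuous_map_product_projection) simp
  then have "continuous_map (Aut_topology R) (discrete_topology UNIV) (\<lambda>f. f v)"
    unfolding Aut_topology_def by (rule continuous_map_from_subtopology)
  from openin_continuous_map_preimage[OF this, of "{w}"]
  show ?thesis by (simp add: topspace_Aut_topology)
qed

lemma openin_agree:
  assumes "finite P"
  shows "openin (Aut_topology R) {f \<in> carrier (Aut R). \<forall>a\<in>P. f (s a) = a}"
  using assms
proof (induction P rule: finite_induct)
  case empty
  then show ?case using openin_topspace[of "Aut_topology R"] by (simp add: topspace_Aut_topology)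
next
  case (insert a P)
  have eq: "{f \<in> carrier (Aut R). \<forall>a\<in>insert a P. f (s a) = a} =
    {f \<in> carrier (Aut R). f (s a) = a} \<inter> {f \<in> carrier (Aut R). \<forall>a\<in>P. f (s a) = a}" by blast
  show ?case unfolding eq by (intro openin_Int openin_eval insert.IH)
qed

text \<open>The sets on which an evaluation takes a fixed value form an open cover, and a finite
  subcover bounds the values. Preimages are evaluations read backwards.\<close>

lemma compactin_finite_values:
  assumes K: "compactin (Aut_topology R) K"
  shows "finite ((\<lambda>k. k v) ` K)" and "finite ((\<lambda>k. inv_into UNIV k v) ` K)"
proof -
  have sub: "K \<subseteq> carrier (Aut R)"
    using compactin_subset_topspace[OF K] by (simp add: topspace_Aut_topology)
  have cover: "finite (h ` K)"
    if op: "\<And>w. openin (Aut_topology R) {f \<in> carrier (Aut R). h f = w}" for h :: "('a \<Rightarrow> 'a) \<Rightarrow> 'a"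
  proof -
    let ?U = "range (\<lambda>w. {f \<in> carrier (Aut R). h f = w})"
    have "K \<subseteq> \<Union>?U" using sub by blast
    moreover have "Ball ?U (openin (Aut_topology R))" using op by blast
    ultimately have "\<exists>\<F>. finite \<F> \<and> \<F> \<subseteq> ?U \<and> K \<subseteq> \<Union>\<F>"
      using K unfolding compactin_def by blast
    then obtain \<F> where \<F>: "finite \<F>" "\<F> \<subseteq> ?U" "K \<subseteq> \<Union>\<F>" by (elim exE conjE)
    obtain W where W: "finite W" "\<F> = (\<lambda>w. {f \<in> carrier (Aut R). h f = w}) ` W"
      using finite_subset_image[OF \<F>(1,2)] by blast
    have "h ` K \<subseteq> W" using \<F>(3) W(2) by blast
    then show ?thesis using W(1) finite_subset by blast
  qed
  show "finite ((\<lambda>k. k v) ` K)" by (rule cover) (rule openin_eval)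
  show "finite ((\<lambda>k. inv_into UNIV k v) ` K)"
  proof (rule cover)
    fix w
    have "{f \<in> carrier (Aut R). inv_into UNIV f v = w} = {f \<in> carrier (Aut R). f w = v}"
      by (auto simp: Aut_iff bij_is_surj bij_is_inj surj_f_inv_f)
    then show "openin (Aut_topology R) {f \<in> carrier (Aut R). inv_into UNIV f v = w}"
      using openin_eval by simp
  qed
qed

lemma catching_translate:
  fixes R :: "'v::countable \<Rightarrow> 'v \<Rightarrow> bool"
  assumes R: "random_graph R" and f: "f \<in> carrier (Aut R)" and g: "good R f"
    and K: "K \<subseteq> carrier (Aut R)" "k0 \<in> K"
    and fin: "\<And>x. finite ((\<lambda>k. k x) ` K)" "\<And>x. finite ((\<lambda>k. inv_into UNIV k x) ` K)"
    and k0: "\<And>k a. k \<in> K \<Longrightarrow> a \<in> periodic_points f \<Longrightarrow> k (inv_into UNIV k0 a) = a"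
  shows "\<exists>g\<in>carrier (Aut R). \<exists>h\<in>carrier (Aut R). two_sided_translate (Aut R) g K h \<subseteq> conjugacy_class (Aut R) f"
proof -
  have "\<exists>h\<in>carrier (Aut R). \<forall>k\<in>K. k \<circ> h \<in> conjugacy_class (Aut R) f"
    by (rule catching[OF R f g K]) (rule fin(1), rule fin(2), rule k0)
  then obtain h where h: "h \<in> carrier (Aut R)" "\<forall>k\<in>K. k \<circ> h \<in> conjugacy_class (Aut R) f"
    by blast
  have "id \<in> carrier (Aut R)" by (simp add: Aut_iff)
  moreover have "two_sided_translate (Aut R) id K h \<subseteq> conjugacy_class (Aut R) f"
    using h(2) by (auto simp: two_sided_translate_def Aut_mult)
  ultimately show ?thesis using h(1) by blast
qed

lemma conjugacy_class_biter:
  fixes R :: "'v::countable \<Rightarrow> 'v \<Rightarrow> bool"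
  assumes R: "random_graph R" and f: "f \<in> carrier (Aut R)" and g: "good R f"
  shows "compact_biter (Aut R) (Aut_topology R) (conjugacy_class (Aut R) f)"
  unfolding compact_biter_def
proof (intro allI impI)
  fix K assume K: "compactin (Aut_topology R) K \<and> K \<noteq> {}"
  then obtain k0 where k0: "k0 \<in> K" by blast
  have sub: "K \<subseteq> carrier (Aut R)"
    using K compactin_subset_topspace by (metis topspace_Aut_topology)
  have finP: "finite (periodic_points f)"
    using g finitely_many_finite_orbits_iff[OF f] by (simp add: good_def)
  \<comment> \<open>The neighbourhood of \<open>k0\<close> on which inverses agree with that of
    \<open>k0\<close> on the finite orbits; it is open because there are finitely many periodic
    points.\<close>
  define U where "U = {k \<in> carrier (Aut R). \<forall>a\<in>periodic_points f. k (inv_into UNIV k0 a) = a}"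
  have U: "openin (Aut_topology R) U" unfolding U_def by (rule openin_agree[OF finP])
  have "bij k0" using k0 sub by (auto simp: Aut_iff)
  then have k0U: "k0 \<in> U \<inter> K" using k0 sub by (auto simp: U_def bij_is_surj surj_f_inv_f)
  have "finite ((\<lambda>k. k x) ` (U \<inter> K))" "finite ((\<lambda>k. inv_into UNIV k x) ` (U \<inter> K))" for x
    using compactin_finite_values[of R K x] K by (meson Int_lower2 finite_subset image_mono)+
  then have "\<exists>g\<in>carrier (Aut R). \<exists>h\<in>carrier (Aut R).
      two_sided_translate (Aut R) g (U \<inter> K) h \<subseteq> conjugacy_class (Aut R) f"
    by (intro catching_translate[OF R f g _ k0U]) (auto simp: U_def)
  then show "\<exists>U. openin (Aut_topology R) U \<and> U \<inter> K \<noteq> {} \<and>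
      (\<exists>g\<in>carrier (Aut R). \<exists>h\<in>carrier (Aut R). two_sided_translate (Aut R) g (U \<inter> K) h \<subseteq> conjugacy_class (Aut R) f)"
    using U k0U by blast
qed

lemma conjugacy_class_catcher:
  fixes R :: "'v::countable \<Rightarrow> 'v \<Rightarrow> bool"
  assumes R: "random_graph R" and f: "f \<in> carrier (Aut R)" and g: "good R f"
    and inf: "no_finite_orbits R f"
  shows "compact_catcher (Aut R) (Aut_topology R) (conjugacy_class (Aut R) f)"
  unfolding compact_catcher_def
proof (intro allI impI)
  fix K assume K: "compactin (Aut_topology R) K"
  have sub: "K \<subseteq> carrier (Aut R)"
    using K compactin_subset_topspace by (metis topspace_Aut_topology)
  have P: "periodic_points f = {}" using inf no_finite_orbits_iff[OF f] by blast
  show "\<exists>g\<in>carrier (Aut R). \<exists>h\<in>carrier (Aut R). two_sided_translate (Aut R) g K h \<subseteq> conjugacy_class (Aut R) f"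
  \<comment> \<open>The catching argument starts from a member \<open>k0\<close>, so the empty set
    is treated apart.\<close>
  proof (cases "K = {}")
    case True
    have "id \<in> carrier (Aut R)" by (simp add: Aut_iff)
    then show ?thesis using True by (auto simp: two_sided_translate_def)
  next
    case False
    then obtain k0 where "k0 \<in> K" by blast
    then show ?thesis
      by (intro catching_translate[OF R f g sub _ compactin_finite_values[OF K]]) (auto simp: P)
  qed
qed

section \<open>Borel sets and tightness\<close>

lemma space_borel_Aut: "space (borel_of (Aut_topology R)) = carrier (Aut R)"
  by (simp add: borel_of_def space_measure_of_conv topspace_Aut_topology)

lemma open_in_sets_borel: "openin (Aut_topology R) U \<Longrightarrow> U \<in> sets (borel_of (Aut_topology R))"
proof -
  have "{U. openin (Aut_topology R) U} \<subseteq> Pow (topspace (Aut_topology R))"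
    using openin_subset by blast
  then show "openin (Aut_topology R) U \<Longrightarrow> U \<in> sets (borel_of (Aut_topology R))"
    by (auto simp: borel_of_def)
qed

lemma pred_eval [measurable]: "Measurable.pred (borel_of (Aut_topology R)) (\<lambda>f. f v = w)"
  using open_in_sets_borel[OF openin_eval[where R = R and v = v and w = w]] by (simp add: pred_def space_borel_Aut)

text \<open>Basic open sets prescribe finitely many values and are indexed by lists over a countable
  type. Every open set is therefore a countable union of them, and evaluations alone decide
  measurability.\<close>

lemma measurable_into_Aut:
  fixes R :: "'v::countable \<Rightarrow> 'v \<Rightarrow> bool"
  assumes Y: "\<And>x. x \<in> space M \<Longrightarrow> Y x \<in> carrier (Aut R)"
    and ev: "\<And>v w. {x \<in> space M. Y x v = w} \<in> sets M"
  shows "Y \<in> measurable M (borel_of (Aut_topology R))"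
  unfolding borel_of_def
proof (rule measurable_measure_of)
  show "{U. openin (Aut_topology R) U} \<subseteq> Pow (topspace (Aut_topology R))"
    using openin_subset by blast
  show "Y \<in> space M \<rightarrow> topspace (Aut_topology R)" using Y by (simp add: topspace_Aut_topology)
  fix U assume "U \<in> {U. openin (Aut_topology R) U}"
  then have U: "openin (Aut_topology R) U" by simp
  define C where "C s = {g \<in> carrier (Aut R). \<forall>p\<in>set s. g (fst p) = snd p}" for s :: "('v \<times> 'v) list"
  have C_sets: "Y -` C s \<inter> space M \<in> sets M" for s
  proof -
    have "Y -` C s \<inter> space M = {x \<in> space M. \<forall>p\<in>set s. Y x (fst p) = snd p}"
      using Y by (auto simp: C_def)
    also have "\<dots> \<in> sets M"
      by (rule sets.sets_Collect_finite_All[OF ev]) auto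
    finally show ?thesis .
  qed
  have "U \<subseteq> \<Union>(C ` {s. C s \<subseteq> U})"
  proof
    fix f assume f: "f \<in> U"
    then obtain F where F: "finite F" "{g \<in> carrier (Aut R). \<forall>v\<in>F. g v = f v} \<subseteq> U"
      using Aut_topology_basis[OF U] by blast
    obtain xs where xs: "set xs = F" using finite_list[OF F(1)] by blast
    have "C (map (\<lambda>v. (v, f v)) xs) = {g \<in> carrier (Aut R). \<forall>v\<in>F. g v = f v}"
      using xs by (auto simp: C_def)
    moreover have "f \<in> carrier (Aut R)"
      using f openin_subset[OF U] by (auto simp: topspace_Aut_topology)
    ultimately show "f \<in> \<Union>(C ` {s. C s \<subseteq> U})" using F(2) by blast
  qed
  then have "U = (\<Union>s\<in>{s. C s \<subseteq> U}. C s)" by blast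
  then have "Y -` U \<inter> space M = (\<Union>s\<in>{s. C s \<subseteq> U}. Y -` C s \<inter> space M)" by blast
  also have "\<dots> \<in> sets M" using C_sets by (intro sets.countable_UN') auto
  finally show "Y -` U \<inter> space M \<in> sets M" .
qed

lemma pred_funpow [measurable]:
  fixes R :: "'v::countable \<Rightarrow> 'v \<Rightarrow> bool"
  shows "Measurable.pred (borel_of (Aut_topology R)) (\<lambda>f. (f ^^ n) v = w)"
proof (induction n arbitrary: w)
  case (Suc n)
  have "(\<lambda>f. (f ^^ Suc n) v = w) = (\<lambda>f. \<exists>x. (f ^^ n) v = x \<and> f x = w)" by auto
  moreover note Suc[measurable]
  have "Measurable.pred (borel_of (Aut_topology R)) (\<lambda>f. \<exists>x. (f ^^ n) v = x \<and> f x = w)"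
    by measurable
  ultimately show ?case by (simp only:)
qed simp

text \<open>Lists replace finite sets so that every quantifier ranges over a countable type;
  measurability then reduces to \<open>pred_funpow\<close>.\<close>

lemma good_iff_countable:
  fixes R :: "'v::countable \<Rightarrow> 'v \<Rightarrow> bool"
  assumes f: "f \<in> carrier (Aut R)"
  shows "good R f \<longleftrightarrow>
    (\<forall>xs ys. set xs \<inter> set ys = {} \<longrightarrow> (\<exists>v. ((\<forall>x\<in>set xs. R x v) \<and> (\<forall>y\<in>set ys. \<not> R y v)) \<and>
      (\<forall>u. u \<in> set xs \<union> set ys \<longrightarrow> (\<forall>n. (f ^^ n) u \<noteq> v \<and> (f ^^ n) v \<noteq> u)))) \<and>
    (\<exists>xs. \<forall>v. v \<notin> set xs \<longrightarrow> (\<forall>n. 0 < n \<longrightarrow> (f ^^ n) v \<noteq> v))"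
proof -
  have "extension_off_orbits R f \<longleftrightarrow>
    (\<forall>xs ys. set xs \<inter> set ys = {} \<longrightarrow> (\<exists>v. ((\<forall>x\<in>set xs. R x v) \<and> (\<forall>y\<in>set ys. \<not> R y v)) \<and>
      v \<notin> orb R f (set xs \<union> set ys)))"
    unfolding extension_off_orbits_def
  proof (intro iffI allI impI)
    fix A B :: "'v set"
    assume a: "\<forall>xs ys. set xs \<inter> set ys = {} \<longrightarrow> (\<exists>v. ((\<forall>x\<in>set xs. R x v) \<and> (\<forall>y\<in>set ys. \<not> R y v)) \<and>
      v \<notin> orb R f (set xs \<union> set ys))" and AB: "finite A \<and> finite B \<and> A \<inter> B = {}"
    obtain xs ys where xs: "A = set xs" "B = set ys" using AB finite_list by metis
    show "\<exists>v. (\<forall>x\<in>A. R x v) \<and> (\<forall>y\<in>B. \<not> R y v) \<and> v \<notin> orb R f (A \<union> B)"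
      using a[rule_format, of xs ys] AB unfolding xs by simp
  qed simp
  moreover have "v \<notin> orb R f F \<longleftrightarrow> (\<forall>u. u \<in> F \<longrightarrow> (\<forall>n. (f ^^ n) u \<noteq> v \<and> (f ^^ n) v \<noteq> u))" for v F
    unfolding mem_orb[OF f] by blast
  moreover have "finitely_many_finite_orbits R f \<longleftrightarrow> (\<exists>xs. \<forall>v. v \<notin> set xs \<longrightarrow> (\<forall>n. 0 < n \<longrightarrow> (f ^^ n) v \<noteq> v))"
  proof -
    have "finite (periodic_points f) \<longleftrightarrow> (\<exists>xs. periodic_points f \<subseteq> set xs)"
      using finite_list finite_subset by (metis finite_set subset_refl)
    then show ?thesis
      unfolding finitely_many_finite_orbits_iff[OF f] by (auto simp: periodic_points_def)
  qed
  ultimately show ?thesis unfolding good_def by simp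
qed

lemma sets_good:
  fixes R :: "'v::countable \<Rightarrow> 'v \<Rightarrow> bool"
  shows "{f \<in> carrier (Aut R). good R f} \<in> sets (borel_of (Aut_topology R))"
proof -
  have "Measurable.pred (borel_of (Aut_topology R)) (\<lambda>f.
    (\<forall>xs ys. set xs \<inter> set ys = {} \<longrightarrow> (\<exists>v. ((\<forall>x\<in>set xs. R x v) \<and> (\<forall>y\<in>set ys. \<not> R y v)) \<and>
      (\<forall>u. u \<in> set xs \<union> set ys \<longrightarrow> (\<forall>n. (f ^^ n) u \<noteq> v \<and> (f ^^ n) v \<noteq> u)))) \<and>
    (\<exists>xs. \<forall>v. v \<notin> set xs \<longrightarrow> (\<forall>n. 0 < n \<longrightarrow> (f ^^ n) v \<noteq> v)))"
    by measurable
  moreover have "{f \<in> carrier (Aut R). good R f} = {f \<in> carrier (Aut R).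
    (\<forall>xs ys. set xs \<inter> set ys = {} \<longrightarrow> (\<exists>v. ((\<forall>x\<in>set xs. R x v) \<and> (\<forall>y\<in>set ys. \<not> R y v)) \<and>
      (\<forall>u. u \<in> set xs \<union> set ys \<longrightarrow> (\<forall>n. (f ^^ n) u \<noteq> v \<and> (f ^^ n) v \<noteq> u)))) \<and>
    (\<exists>xs. \<forall>v. v \<notin> set xs \<longrightarrow> (\<forall>n. 0 < n \<longrightarrow> (f ^^ n) v \<noteq> v))}"
    by (rule Collect_cong, rule conj_cong[OF refl], rule good_iff_countable)
  ultimately show ?thesis
    unfolding pred_def space_borel_Aut by (simp only:)
qed

text \<open>With probability at least 1/2, all values and all preimages stay within finite ranges
  fixed in advance. This set is cut into countably many pieces according to the preimages of
  \<open>P\<close>, and some piece is not null. Compactness itself is not constructed, as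
  \<open>catching\<close> asks only for finite value sets.\<close>

lemma tight_subset:
  fixes R :: "'v::countable \<Rightarrow> 'v \<Rightarrow> bool"
  assumes "prob_space \<mu>" and sets: "sets \<mu> = sets (borel_of (Aut_topology R))" and P: "finite P"
  shows "\<exists>L k0. k0 \<in> L \<and> L \<in> sets \<mu> \<and> emeasure \<mu> L > 0 \<and>
    (\<forall>x. finite ((\<lambda>k. k x) ` L)) \<and> (\<forall>x. finite ((\<lambda>k. inv_into UNIV k x) ` L)) \<and>
    (\<forall>k\<in>L. \<forall>a\<in>P. k (inv_into UNIV k0 a) = a)"
proof -
  interpret prob_space \<mu> by fact
  have sp: "space \<mu> = carrier (Aut R)"
    using sets_eq_imp_space_eq[OF sets] by (simp add: space_borel_Aut)
  have ev: "Measurable.pred \<mu> (\<lambda>f. f v = w)" for v w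
    using pred_eval[where R = R and v = v and w = w] measurable_cong_sets[OF sets refl] by blast
  define A where "A v n = {f \<in> space \<mu>. (\<exists>w. to_nat w \<le> n \<and> f v = w) \<and> (\<exists>w. to_nat w \<le> n \<and> f w = v)}" for v :: 'v and n
  have A_sets: "A v n \<in> sets \<mu>" for v n
  proof -
    note ev[measurable]
    have "Measurable.pred \<mu> (\<lambda>f. (\<exists>w. to_nat w \<le> n \<and> f v = w) \<and> (\<exists>w. to_nat w \<le> n \<and> f w = v))"
      by measurable
    then show ?thesis unfolding A_def pred_def .
  qed
  have A_mono: "incseq (A v)" for v
    unfolding incseq_def A_def using le_trans by blast
  have A_UN: "(\<Union>n. A v n) = space \<mu>" for v
  proof -
    have "f \<in> (\<Union>n. A v n)" if f: "f \<in> space \<mu>" for f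
    proof -
      obtain w where w: "f w = v" using f sp by (metis Aut_iff bij_pointE)
      have "f \<in> A v (max (to_nat (f v)) (to_nat w))"
        using f w unfolding A_def by (auto intro: max.cobounded1 max.cobounded2)
      then show ?thesis by blast
    qed
    then show ?thesis by (auto simp: A_def)
  qed
  \<comment> \<open>The exponent \<open>to_nat v + 2\<close> makes the exceptional probabilities sum
    to at most 1/2.\<close>
  have "\<exists>n. prob (space \<mu> - A v n) < (1/2) ^ (to_nat v + 2)" for v
  proof -
    have "(\<lambda>n. prob (A v n)) \<longlonglongrightarrow> prob (\<Union>n. A v n)"
      using A_sets A_mono by (intro finite_Lim_measure_incseq) auto
    then have "(\<lambda>n. prob (A v n)) \<longlonglongrightarrow> 1" by (simp add: A_UN prob_space)
    moreover have "1 - (1/2) ^ (to_nat v + 2) < (1::real)" by simp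
    ultimately obtain n where "prob (A v n) > 1 - (1/2) ^ (to_nat v + 2)"
      by (metis (no_types, lifting) eventually_happens' order_tendstoD(1) sequentially_bot)
    then have "prob (space \<mu> - A v n) < (1/2) ^ (to_nat v + 2)" using prob_compl[OF A_sets] by simp
    then show ?thesis by blast
  qed
  then obtain N where N: "\<And>v. prob (space \<mu> - A v (N v)) < (1/2) ^ (to_nat v + 2)" by metis
  \<comment> \<open>\<open>to_nat\<close> need not be onto; numbers that code no vertex contribute
    the empty set.\<close>
  define B where "B m = (if \<exists>v::'v. to_nat v = m then space \<mu> - A (from_nat m) (N (from_nat m)) else {})" for m
  have B_sets: "B m \<in> sets \<mu>" for m using A_sets by (simp add: B_def)
  have B_le: "prob (B m) \<le> (1/4) * (1/2) ^ m" for m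
    using less_imp_le[OF N[of "from_nat m"]] by (auto simp: B_def power_add)
  have summ: "summable (\<lambda>m. (1/4) * (1/2) ^ m :: real)" by (intro summable_mult summable_geometric) simp
  have sB: "summable (\<lambda>m. prob (B m))"
    by (rule summable_comparison_test'[OF summ]) (use B_le in auto)
  have "prob (\<Union>m. B m) \<le> suminf (\<lambda>m. prob (B m))"
    using B_sets sB by (intro finite_measure_subadditive_countably) auto
  also have "\<dots> \<le> suminf (\<lambda>m. (1/4) * (1/2) ^ m)" using B_le sB summ by (rule suminf_le)
  also have "\<dots> = 1/2" using suminf_mult[OF summable_geometric, of "1/2::real" "1/4"] suminf_geometric[of "1/2::real"] by simp
  finally have Ble: "prob (\<Union>m. B m) \<le> 1/2" .
  define L where "L = space \<mu> - (\<Union>m. B m)"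
  have L_sets: "L \<in> sets \<mu>" using B_sets by (auto simp: L_def)
  have "prob L \<ge> 1/2" unfolding L_def using prob_compl[of "\<Union>m. B m"] B_sets Ble by auto
  then have L_pos: "emeasure \<mu> L \<noteq> 0" by (auto simp: measure_def)
  have LA: "f \<in> A v (N v)" if "f \<in> L" for f v
  proof -
    have "f \<notin> B (to_nat v)" "f \<in> space \<mu>" using that by (auto simp: L_def)
    then show ?thesis by (auto simp: B_def split: if_splits)
  qed
  have fin_le: "finite {w::'v. to_nat w \<le> n}" for n
    by (rule finite_imageD[of to_nat]) (auto intro: finite_subset[of _ "{..n}"] inj_on_subset[OF inj_to_nat])
  have finL: "finite ((\<lambda>k. k x) ` L)" "finite ((\<lambda>k. inv_into UNIV k x) ` L)" for x
  proof -
    have "(\<lambda>k. k x) ` L \<subseteq> {w. to_nat w \<le> N x}" using LA[of _ x] by (auto simp: A_def)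
    then show "finite ((\<lambda>k. k x) ` L)" using fin_le finite_subset by blast
    have "inv_into UNIV k x \<in> {w. to_nat w \<le> N x}" if k: "k \<in> L" for k
    proof -
      have "bij k" using k sp by (auto simp: L_def Aut_iff)
      then show ?thesis using LA[OF k, of x] by (auto simp: A_def bij_is_inj)
    qed
    then have "(\<lambda>k. inv_into UNIV k x) ` L \<subseteq> {w. to_nat w \<le> N x}" by blast
    then show "finite ((\<lambda>k. inv_into UNIV k x) ` L)" using fin_le finite_subset by blast
  qed
  obtain xs where xs: "set xs = P" using finite_list[OF P] by blast
  \<comment> \<open>The list \<open>ys\<close> records the preimages of the entries of
    \<open>xs\<close>; there are only countably many lists.\<close>
  define Ls where "Ls ys = {f \<in> L. map f ys = xs}" for ys
  have Ls_sets: "Ls ys \<in> sets \<mu>" for ys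
  proof (cases "length ys = length xs")
    case True
    note ev[measurable]
    have "Measurable.pred \<mu> (\<lambda>f. \<forall>i. i < length xs \<longrightarrow> f (ys ! i) = xs ! i)" by measurable
    then have "L \<inter> {f \<in> space \<mu>. \<forall>i. i < length xs \<longrightarrow> f (ys ! i) = xs ! i} \<in> sets \<mu>"
      using L_sets by (auto simp: pred_def)
    moreover have "Ls ys = L \<inter> {f \<in> space \<mu>. \<forall>i. i < length xs \<longrightarrow> f (ys ! i) = xs ! i}"
      using True by (auto simp: Ls_def L_def list_eq_iff_nth_eq)
    ultimately show ?thesis by simp
  next
    case False
    then have "Ls ys = {}" by (auto simp: Ls_def)
    then show ?thesis by simp
  qed
  have L_UN: "L = (\<Union>ys. Ls ys)"
  proof -
    have "f \<in> Ls (map (inv_into UNIV f) xs)" if "f \<in> L" for f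
    proof -
      have "bij f" using that sp by (auto simp: L_def Aut_iff)
      then show ?thesis using that by (simp add: Ls_def map_idI bij_is_surj surj_f_inv_f comp_def)
    qed
    then have "L \<subseteq> (\<Union>ys. Ls ys)" by blast
    moreover have "(\<Union>ys. Ls ys) \<subseteq> L" by (auto simp: Ls_def)
    ultimately show ?thesis by (rule equalityI)
  qed
  obtain ys where ys: "emeasure \<mu> (Ls ys) \<noteq> 0"
  proof (rule ccontr)
    assume "\<not> thesis"
    then have "emeasure \<mu> (Ls ys) = 0" for ys using that by blast
    then have "(\<Union>ys. Ls ys) \<in> null_sets \<mu>" using Ls_sets by (intro null_sets_UN) auto
    then show False using L_pos L_UN by auto
  qed
  then obtain k0 where k0: "k0 \<in> Ls ys" by fastforce
  have "k (inv_into UNIV k0 a) = a" if k: "k \<in> Ls ys" and a: "a \<in> P" for k a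
  proof -
    obtain i where i: "i < length xs" "a = xs ! i" using a xs by (metis in_set_conv_nth)
    have k_i: "k' (ys ! i) = a" if "k' \<in> Ls ys" for k'
      using that i by (auto simp: Ls_def)
    have "bij k0" using k0 sp by (auto simp: Ls_def L_def Aut_iff)
    then have "inv_into UNIV k0 a = ys ! i" using k_i[OF k0] by (metis bij_inv_eq_iff)
    then show ?thesis using k_i[OF k] by simp
  qed
  moreover have "finite ((\<lambda>k. k x) ` Ls ys)" "finite ((\<lambda>k. inv_into UNIV k x) ` Ls ys)" for x
  proof -
    have "Ls ys \<subseteq> L" by (auto simp: Ls_def)
    then show "finite ((\<lambda>k. k x) ` Ls ys)" "finite ((\<lambda>k. inv_into UNIV k x) ` Ls ys)"
      using finite_subset[OF image_mono finL(1)[of x]] finite_subset[OF image_mono finL(2)[of x]] by blast+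
  qed
  moreover have "emeasure \<mu> (Ls ys) > 0" using ys zero_less_iff_neq_zero by blast
  ultimately show ?thesis using k0 Ls_sets by (intro exI[of _ "Ls ys"] exI[of _ k0]) blast
qed

text \<open>Whatever the witness measure, the set of positive measure from
  \<open>tight_subset\<close> lies inside a right translate of the Borel hull \<open>B\<close>,
  which was supposed to be null.\<close>

lemma conjugacy_class_not_haar_null:
  fixes R :: "'v::countable \<Rightarrow> 'v \<Rightarrow> bool"
  assumes R: "random_graph R" and f: "f \<in> carrier (Aut R)" and g: "good R f"
  shows "\<not> haar_null (Aut R) (Aut_topology R) (conjugacy_class (Aut R) f)"
proof
  assume "haar_null (Aut R) (Aut_topology R) (conjugacy_class (Aut R) f)"
  then obtain B \<mu> where B: "conjugacy_class (Aut R) f \<subseteq> B" and \<mu>: "prob_space \<mu>" "sets \<mu> = sets (borel_of (Aut_topology R))"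
    and null: "\<forall>g\<in>carrier (Aut R). \<forall>h\<in>carrier (Aut R). two_sided_translate (Aut R) g B h \<in> null_sets \<mu>"
    unfolding haar_null_def borel_haar_null_def by blast
  have finP: "finite (periodic_points f)"
    using g finitely_many_finite_orbits_iff[OF f] by (simp add: good_def)
  obtain L k0 where L: "k0 \<in> L" "L \<in> sets \<mu>" "emeasure \<mu> L > 0"
    "\<forall>x. finite ((\<lambda>k. k x) ` L)" "\<forall>x. finite ((\<lambda>k. inv_into UNIV k x) ` L)"
    "\<forall>k\<in>L. \<forall>a\<in>periodic_points f. k (inv_into UNIV k0 a) = a"
    using tight_subset[OF \<mu> finP] by blast
  have sub: "L \<subseteq> carrier (Aut R)"
    using sets.sets_into_space[OF L(2)] sets_eq_imp_space_eq[OF \<mu>(2)] by (simp add: space_borel_Aut)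
  have "\<exists>h\<in>carrier (Aut R). \<forall>k\<in>L. k \<circ> h \<in> conjugacy_class (Aut R) f"
    by (rule catching[OF R f g sub L(1)]) (use L(4-6) in blast)+
  then obtain h where h: "h \<in> carrier (Aut R)" "\<forall>k\<in>L. k \<circ> h \<in> conjugacy_class (Aut R) f"
    by blast
  let ?h = "inv_into UNIV h"
  have id: "id \<in> carrier (Aut R)" by (simp add: Aut_iff)
  have "k \<in> two_sided_translate (Aut R) id B ?h" if "k \<in> L" for k
  proof -
    have "k = k \<circ> h \<circ> ?h"
      using h(1) by (simp add: fun_eq_iff Aut_iff bij_is_surj surj_f_inv_f)
    moreover have "k \<circ> h \<in> B" using h(2) B that by blast
    ultimately show ?thesis unfolding two_sided_translate_def Aut_mult by (metis comp_id fun.map_id id_comp imageI)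
  qed
  then have "L \<subseteq> two_sided_translate (Aut R) id B ?h" by blast
  moreover have "two_sided_translate (Aut R) id B ?h \<in> null_sets \<mu>"
    using null id Aut_inv_carrier[OF h(1)] by blast
  ultimately have "emeasure \<mu> L = 0" using L(2) null_sets_subset by blast
  then show False using L(3) by simp
qed

section \<open>A random automorphism\<close>

definition choices :: "(nat \<Rightarrow> nat) measure" where
  "choices = PiM UNIV (\<lambda>n. measure_pmf (pmf_of_set {..<2 ^ n}))"

text \<open>Stands in for measurability with respect to the first \<open>n\<close> coordinates.
  Coordinates are natural numbers, so countably many prefixes describe such an event.\<close>

definition depends :: "nat \<Rightarrow> ((nat \<Rightarrow> nat) \<Rightarrow> 'b) \<Rightarrow> bool" where
  "depends n Q \<longleftrightarrow> (\<forall>\<omega> \<omega>'. (\<forall>i<n. \<omega> i = \<omega>' i) \<longrightarrow> Q \<omega> = Q \<omega>')"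

interpretation choices: product_prob_space "\<lambda>n::nat. measure_pmf (pmf_of_set {..<2 ^ n::nat})" UNIV
  by unfold_locales

lemma prob_space_choices: "prob_space choices"
  unfolding choices_def by (rule choices.P.prob_space_axioms)

lemma space_choices: "space choices = UNIV"
  by (simp add: choices_def space_PiM PiE_def extensional_def)

lemma emeasure_choices_box:
  "emeasure choices {\<omega>. \<forall>i<n. \<omega> i \<in> A i} = (\<Prod>i<n. emeasure (measure_pmf (pmf_of_set {..<2 ^ i})) (A i))"
proof -
  have "emeasure choices {\<omega> \<in> space choices. \<forall>i\<in>{..<n}. \<omega> i \<in> A i} =
    (\<Prod>i<n. emeasure (measure_pmf (pmf_of_set {..<2 ^ i})) (A i))"
    unfolding choices_def by (rule choices.emeasure_PiM_Collect) auto
  then show ?thesis by (simp add: space_choices Ball_def)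
qed

lemma sets_choices_box: "{\<omega>. \<forall>i<n. \<omega> i \<in> A i} \<in> sets choices"
proof -
  have "{\<omega> \<in> space choices. \<forall>i\<in>{..<n}. \<omega> i \<in> A i} \<in> sets choices"
    unfolding choices_def
    by (intro sets.sets_Collect_finite_All measurable_sets_Collect[OF measurable_component_singleton]) auto
  then show ?thesis by (simp add: space_choices Ball_def)
qed

definition prefix_set :: "nat list \<Rightarrow> (nat \<Rightarrow> nat) set" where
  "prefix_set l = {\<omega>. \<forall>i<length l. \<omega> i = l ! i}"

lemma sets_prefix: "prefix_set l \<in> sets choices"
  using sets_choices_box[of "length l" "\<lambda>i. {l ! i}"] by (simp add: prefix_set_def)

lemma mem_prefix: "\<omega> \<in> prefix_set l \<longleftrightarrow> l = map \<omega> [0..<length l]"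
  unfolding prefix_set_def list_eq_iff_nth_eq[of l "map \<omega> [0..<length l]"] by auto

lemma sets_depends:
  assumes "depends n Q"
  shows "{\<omega>. Q \<omega>} \<in> sets choices"
proof -
  \<comment> \<open>\<open>(!) l\<close> is a sequence with prefix \<open>l\<close>; its entries
    beyond the list are unspecified but irrelevant by \<open>depends\<close>.\<close>
  have eq: "Q \<omega> \<longleftrightarrow> Q ((!) l)" if "\<omega> \<in> prefix_set l" "length l = n" for \<omega> l
  proof -
    have "\<forall>i<n. \<omega> i = (!) l i" using that by (simp add: prefix_set_def)
    then show ?thesis using assms[unfolded depends_def, rule_format, of \<omega> "(!) l"] by blast
  qed
  have "\<omega> \<in> (\<Union>l\<in>{l. length l = n \<and> Q ((!) l)}. prefix_set l)" if "Q \<omega>" for \<omega>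
  proof -
    have "\<omega> \<in> prefix_set (map \<omega> [0..<n])" by (simp add: prefix_set_def)
    then show ?thesis using eq[of \<omega> "map \<omega> [0..<n]"] that
      by (intro UN_I[of "map \<omega> [0..<n]"]) auto
  qed
  moreover have "Q \<omega>" if "\<omega> \<in> prefix_set l" "length l = n" "Q ((!) l)" for \<omega> l
    using eq[OF that(1,2)] that(3) by simp
  ultimately have "{\<omega>. Q \<omega>} = (\<Union>l\<in>{l. length l = n \<and> Q ((!) l)}. prefix_set l)"
    by (intro equalityI subsetI) (simp, elim UN_E, simp)
  also have "\<dots> \<in> sets choices" using sets_prefix by (intro sets.countable_UN') auto
  finally show ?thesis .
qed

lemma emeasure_prefix_next:
  "emeasure choices (prefix_set (l @ [c])) \<le> emeasure choices (prefix_set l) * ennreal ((1/2) ^ length l)"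
proof -
  let ?n = "length l"
  have 1: "emeasure choices (prefix_set l) = (\<Prod>i<length l. emeasure (measure_pmf (pmf_of_set {..<2 ^ i})) {l ! i})" for l
    using emeasure_choices_box[of "length l" "\<lambda>i. {l ! i}"] by (simp add: prefix_set_def)
  have "emeasure (measure_pmf (pmf_of_set {..<2 ^ ?n})) {c} \<le> ennreal ((1/2) ^ ?n)"
  proof -
    have "pmf (pmf_of_set {..<2 ^ ?n}) c \<le> (1/2) ^ ?n"
      by (simp add: pmf_of_set lessThan_empty_iff indicator_def power_divide)
    then show ?thesis by (simp add: emeasure_pmf_single ennreal_leI)
  qed
  moreover have "(\<Prod>i<?n. emeasure (measure_pmf (pmf_of_set {..<2 ^ i})) {(l @ [c]) ! i}) =
    (\<Prod>i<?n. emeasure (measure_pmf (pmf_of_set {..<2 ^ i})) {l ! i})"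
    by (intro prod.cong) (auto simp: nth_append)
  ultimately show ?thesis
    unfolding 1[of "l @ [c]"] 1[of l] by (simp add: mult_left_mono)
qed

text \<open>Given the first \<open>n\<close> coordinates, at most one value of coordinate
  \<open>n\<close> is compatible with \<open>D\<close>, and it has weight at most
  \<open>(1/2) ^ n\<close>. Summing over prefixes takes the place of conditional
  probabilities.\<close>

lemma prob_forced_choice:
  assumes D: "depends (Suc n) D"
    and uniq: "\<And>\<omega> \<omega>'. D \<omega> \<Longrightarrow> D \<omega>' \<Longrightarrow> (\<forall>i<n. \<omega> i = \<omega>' i) \<Longrightarrow> \<omega> n = \<omega>' n"
  shows "measure choices {\<omega>. D \<omega>} \<le> (1/2) ^ n"
proof -
  interpret prob_space choices by (rule prob_space_choices)
  let ?I = "{l::nat list. length l = n}"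
  let ?D = "\<lambda>l. {\<omega>. D \<omega>} \<inter> prefix_set l"
  have sD: "{\<omega>. D \<omega>} \<in> sets choices" by (rule sets_depends[OF D])
  have disj: "disjoint_family_on prefix_set ?I"
    unfolding disjoint_family_on_def
  proof (intro ballI impI)
    fix l l' :: "nat list" assume "l \<in> ?I" "l' \<in> ?I" "l \<noteq> l'"
    moreover have "l = l'" if "\<omega> \<in> prefix_set l" "\<omega> \<in> prefix_set l'" "length l = length l'" for \<omega>
      using that(1,2)[unfolded mem_prefix] that(3) by (metis (no_types))
    ultimately show "prefix_set l \<inter> prefix_set l' = {}" by (metis (mono_tags) IntE equals0I mem_Collect_eq)
  qed
  have UN: "(\<Union>l\<in>?I. prefix_set l) = UNIV"
  proof -
    have "\<omega> \<in> (\<Union>l\<in>?I. prefix_set l)" for \<omega>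
      by (rule UN_I[of "map \<omega> [0..<n]"]) (simp_all add: prefix_set_def)
    then show ?thesis by blast
  qed
  have le: "emeasure choices (?D l) \<le> emeasure choices (prefix_set l) * ennreal ((1/2) ^ n)" if l: "l \<in> ?I" for l
  proof (cases "?D l = {}")
    case False
    then obtain \<omega>0 where \<omega>0: "D \<omega>0" "\<omega>0 \<in> prefix_set l" by blast
    have "?D l \<subseteq> prefix_set (l @ [\<omega>0 n])"
    proof
      fix \<omega> assume \<omega>: "\<omega> \<in> ?D l"
      then have "\<omega> n = \<omega>0 n" using uniq[of \<omega> \<omega>0] \<omega>0 l by (auto simp: prefix_set_def)
      then show "\<omega> \<in> prefix_set (l @ [\<omega>0 n])"
        using \<omega> l by (auto simp: prefix_set_def nth_append less_Suc_eq)
    qed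
    then have "emeasure choices (?D l) \<le> emeasure choices (prefix_set (l @ [\<omega>0 n]))"
      by (rule emeasure_mono[OF _ sets_prefix])
    also have "\<dots> \<le> emeasure choices (prefix_set l) * ennreal ((1/2) ^ n)"
      using emeasure_prefix_next[of l "\<omega>0 n"] l by simp
    finally show ?thesis .
  qed simp
  have "emeasure choices {\<omega>. D \<omega>} = emeasure choices (\<Union>l\<in>?I. ?D l)"
  proof -
    have "(\<Union>l\<in>?I. ?D l) = {\<omega>. D \<omega>} \<inter> (\<Union>l\<in>?I. prefix_set l)" by (rule Int_UN_distrib[symmetric])
    then show ?thesis unfolding UN by (simp only: Int_UNIV_right)
  qed
  also have "\<dots> = (\<integral>\<^sup>+l. emeasure choices (?D l) \<partial>count_space ?I)"
  proof (rule emeasure_UN_countable)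
    show "disjoint_family_on ?D ?I" using disj unfolding disjoint_family_on_def by blast
    show "?D l \<in> sets choices" for l using sD sets_prefix by (rule sets.Int)
  qed simp
  also have "\<dots> \<le> (\<integral>\<^sup>+l. emeasure choices (prefix_set l) * ennreal ((1/2) ^ n) \<partial>count_space ?I)"
    using le by (intro nn_integral_mono) auto
  also have "\<dots> = (\<integral>\<^sup>+l. emeasure choices (prefix_set l) \<partial>count_space ?I) * ennreal ((1/2) ^ n)"
    by (rule nn_integral_multc) simp
  also have "(\<integral>\<^sup>+l. emeasure choices (prefix_set l) \<partial>count_space ?I) = emeasure choices (\<Union>l\<in>?I. prefix_set l)"
    by (rule emeasure_UN_countable[symmetric]) (use disj sets_prefix in simp_all)
  also have "\<dots> = 1" unfolding UN using emeasure_space_1 by (simp add: space_choices)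
  finally have "emeasure choices {\<omega>. D \<omega>} \<le> ennreal ((1/2) ^ n)" by simp
  then show ?thesis by (simp add: emeasure_eq_measure)
qed

text \<open>A form of Borel--Cantelli in which the bad events may depend on the starting time
  \<open>N\<close>. The union of the events from \<open>N\<close> on has measure at most
  \<open>2 * c * (1/2) ^ N\<close>, so the intersection of these unions is null.\<close>

lemma AE_tail_choices:
  fixes D :: "nat \<Rightarrow> nat \<Rightarrow> (nat \<Rightarrow> nat) \<Rightarrow> bool"
  assumes D: "\<And>N n. N \<le> n \<Longrightarrow> {\<omega>. D N n \<omega>} \<in> sets choices"
    and le: "\<And>N n. N \<le> n \<Longrightarrow> measure choices {\<omega>. D N n \<omega>} \<le> c * (1/2) ^ n"
  shows "AE \<omega> in choices. \<exists>N. \<forall>n\<ge>N. \<not> D N n \<omega>"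
proof -
  interpret prob_space choices by (rule prob_space_choices)
  define T where "T N = (\<Union>j. {\<omega>. D N (N + j) \<omega>})" for N
  have sT: "T N \<in> sets choices" for N unfolding T_def using D by (intro sets.countable_UN) auto
  have T_le: "measure choices (T N) \<le> 2 * c * (1/2) ^ N" for N
  proof -
    have b: "measure choices {\<omega>. D N (N + j) \<omega>} \<le> (c * (1/2) ^ N) * (1/2) ^ j" for j
      using le[of N "N + j"] by (simp add: power_add algebra_simps)
    have summ: "summable (\<lambda>j. (c * (1/2) ^ N) * (1/2) ^ j)" by (intro summable_mult summable_geometric) simp
    have s: "summable (\<lambda>j. measure choices {\<omega>. D N (N + j) \<omega>})"
      by (rule summable_comparison_test'[OF summ, of 0]) (use b in auto)
    have "measure choices (T N) \<le> suminf (\<lambda>j. measure choices {\<omega>. D N (N + j) \<omega>})"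
      unfolding T_def using D s by (intro finite_measure_subadditive_countably) auto
    also have "\<dots> \<le> suminf (\<lambda>j. (c * (1/2) ^ N) * (1/2) ^ j)" using b s summ by (rule suminf_le)
    also have "\<dots> = (c * (1/2) ^ N) * 2"
      using suminf_mult[OF summable_geometric, of "1/2::real" "c * (1/2) ^ N"] suminf_geometric[of "1/2::real"] by simp
    finally show ?thesis by simp
  qed
  have "(\<lambda>N. 2 * c * (1/2) ^ N) \<longlonglongrightarrow> 2 * c * 0" by (intro tendsto_intros LIMSEQ_power_zero) simp
  moreover have "measure choices (\<Inter>N. T N) \<le> 2 * c * (1/2) ^ N" for N
    using finite_measure_mono[of "\<Inter>N. T N" "T N"] T_le[of N] sT by force
  ultimately have "measure choices (\<Inter>N. T N) \<le> 0"
    by (metis (no_types, lifting) LIMSEQ_le_const mult_zero_right)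
  then have "(\<Inter>N. T N) \<in> null_sets choices"
    using sT by (intro null_setsI) (auto simp: emeasure_eq_measure measure_le_0_iff)
  moreover have "{\<omega> \<in> space choices. \<not> (\<exists>N. \<forall>n\<ge>N. \<not> D N n \<omega>)} \<subseteq> (\<Inter>N. T N)"
  proof (rule subsetI, rule INT_I)
    fix \<omega> N assume "\<omega> \<in> {\<omega> \<in> space choices. \<not> (\<exists>N. \<forall>n\<ge>N. \<not> D N n \<omega>)}"
    then obtain n where "n \<ge> N" "D N n \<omega>" by blast
    then have "D N (N + (n - N)) \<omega>" by simp
    then show "\<omega> \<in> T N" unfolding T_def by blast
  qed
  ultimately show ?thesis by (rule AE_I')
qed

section \<open>The random back-and-forth construction\<close>

definition partial_iso :: "('v \<Rightarrow> 'v \<Rightarrow> bool) \<Rightarrow> ('v \<times> 'v) set \<Rightarrow> bool" where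
  "partial_iso R G \<longleftrightarrow> finite G \<and>
    (\<forall>x y x' y'. (x, y) \<in> G \<longrightarrow> (x', y') \<in> G \<longrightarrow> (x = x' \<longleftrightarrow> y = y') \<and> (R x x' \<longleftrightarrow> R y y'))"

lemma partial_iso_converse: "partial_iso R (G\<inverse>) \<longleftrightarrow> partial_iso R G"
  by (auto simp: partial_iso_def)

text \<open>Injectivity matters: distinct choices must give distinct vertices, so that a forced
  vertex means a forced choice.\<close>

definition fresh_values :: "('v \<Rightarrow> 'v \<Rightarrow> bool) \<Rightarrow> ('v \<times> 'v) set \<Rightarrow> 'v \<Rightarrow> nat \<Rightarrow> 'v" where
  "fresh_values R G a =
    (SOME b. inj b \<and> (\<forall>i. b i \<notin> Range G \<and> partial_iso R (insert (a, b i) G)))"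

lemma fresh_values:
  fixes R :: "'v::countable \<Rightarrow> 'v \<Rightarrow> bool"
  assumes R: "random_graph R" and G: "partial_iso R G" and a: "a \<notin> Domain G"
  shows "inj (fresh_values R G a)" and "fresh_values R G a i \<notin> Range G"
    and "partial_iso R (insert (a, fresh_values R G a i) G)"
proof -
  have sym: "R x y \<longleftrightarrow> R y x" and irr: "\<not> R x x" for x y
    using R by (auto simp: random_graph_def symp_def irreflp_def)
  have finG: "finite G" using G by (simp add: partial_iso_def)
  let ?S = "{b. b \<notin> Range G \<and> partial_iso R (insert (a, b) G)}"
  have "\<exists>b\<in>?S. b \<notin> W" if W: "finite W" for W
  proof -
    obtain b where b: "b \<notin> W \<union> Range G" "\<forall>y\<in>Range G. R y b \<longleftrightarrow> (\<exists>x. (x, y) \<in> G \<and> R x a)"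
      using random_graph_type[OF R, of "Range G" "W \<union> Range G" "\<lambda>y. \<exists>x. (x, y) \<in> G \<and> R x a"]
        W finite_Range[OF finG] by auto
    have ab: "R x a \<longleftrightarrow> R y b" if "(x, y) \<in> G" for x y
      using b(2) that G unfolding partial_iso_def by blast
    have "partial_iso R (insert (a, b) G)"
      unfolding partial_iso_def
    proof (intro conjI allI impI)
      show "finite (insert (a, b) G)" using finG by simp
      fix x y x' y' assume xy: "(x, y) \<in> insert (a, b) G" "(x', y') \<in> insert (a, b) G"
      have old: "(x = x' \<longleftrightarrow> y = y') \<and> (R x x' \<longleftrightarrow> R y y')" if "(x, y) \<in> G" "(x', y') \<in> G"
        using G that unfolding partial_iso_def by blast
      show "x = x' \<longleftrightarrow> y = y'" using xy old a b(1) by auto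
      show "R x x' \<longleftrightarrow> R y y'" using xy old ab sym irr by (metis insertE prod.inject)
    qed
    then show ?thesis using b(1) by blast
  qed
  then have "infinite ?S" by blast
  from infinite_countable_subset[OF this] obtain b :: "nat \<Rightarrow> 'v" where b: "inj b" "range b \<subseteq> ?S" by blast
  have "\<exists>b::nat \<Rightarrow> 'v. inj b \<and> (\<forall>i. b i \<notin> Range G \<and> partial_iso R (insert (a, b i) G))"
    using b by (intro exI[of _ b]) auto
  then have "inj (fresh_values R G a) \<and> (\<forall>i. fresh_values R G a i \<notin> Range G \<and>
      partial_iso R (insert (a, fresh_values R G a i) G))"
    unfolding fresh_values_def by (rule someI_ex)
  then show "inj (fresh_values R G a)" "fresh_values R G a i \<notin> Range G"
    "partial_iso R (insert (a, fresh_values R G a i) G)" by blast+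
qed

definition half_step :: "('v \<Rightarrow> 'v \<Rightarrow> bool) \<Rightarrow> 'v \<Rightarrow> ('v \<times> 'v) set \<Rightarrow> nat \<Rightarrow> ('v \<times> 'v) set" where
  "half_step R a G i = (if a \<in> Domain G then G else insert (a, fresh_values R G a i) G)"

fun stage :: "('v::countable \<Rightarrow> 'v \<Rightarrow> bool) \<Rightarrow> (nat \<Rightarrow> nat) \<Rightarrow> nat \<Rightarrow> ('v \<times> 'v) set" where
  "stage R \<omega> 0 = {}"
| "stage R \<omega> (Suc n) =
    (if even n then half_step R (from_nat (n div 2)) (stage R \<omega> n) (\<omega> n)
     else (half_step R (from_nat (n div 2)) ((stage R \<omega> n)\<inverse>) (\<omega> n))\<inverse>)"

lemma stage_cong: "(\<forall>i<n. \<omega> i = \<omega>' i) \<Longrightarrow> stage R \<omega> n = stage R \<omega>' n"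
  by (induction n) auto

lemma depends_stage: "depends n (\<lambda>\<omega>. f (stage R \<omega> n))"
  unfolding depends_def by (metis stage_cong)

lemma stage_mono: "m \<le> n \<Longrightarrow> stage R \<omega> m \<subseteq> stage R \<omega> n"
proof (induction n rule: dec_induct)
  case (step n)
  have "stage R \<omega> n \<subseteq> stage R \<omega> (Suc n)" by (auto simp: half_step_def)
  then show ?case using step by blast
qed simp

context
  fixes R :: "'v::countable \<Rightarrow> 'v \<Rightarrow> bool"
  assumes R: "random_graph R"
begin

lemma partial_iso_half_step: "partial_iso R G \<Longrightarrow> partial_iso R (half_step R a G i)"
  using fresh_values(3)[OF R] by (simp add: half_step_def)

lemma partial_iso_stage: "partial_iso R (stage R \<omega> n)"
proof (induction n)
  case 0
  then show ?case by (simp add: partial_iso_def)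
next
  case (Suc n)
  then show ?case by (simp add: partial_iso_converse partial_iso_half_step)
qed

definition limit_rel :: "(nat \<Rightarrow> nat) \<Rightarrow> ('v \<times> 'v) set" where
  "limit_rel \<omega> = (\<Union>n. stage R \<omega> n)"

lemma limit_rel_iso:
  assumes "(x, y) \<in> limit_rel \<omega>" "(x', y') \<in> limit_rel \<omega>"
  shows "(x = x' \<longleftrightarrow> y = y') \<and> (R x x' \<longleftrightarrow> R y y')"
proof -
  obtain m n where "(x, y) \<in> stage R \<omega> m" "(x', y') \<in> stage R \<omega> n"
    using assms unfolding limit_rel_def by blast
  then have "(x, y) \<in> stage R \<omega> (max m n)" "(x', y') \<in> stage R \<omega> (max m n)"
    using stage_mono[of m "max m n" R \<omega>] stage_mono[of n "max m n" R \<omega>] by auto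
  then show ?thesis using partial_iso_stage[of \<omega> "max m n"] unfolding partial_iso_def by blast
qed

lemma limit_rel_total: "\<exists>y. (x, y) \<in> limit_rel \<omega>" "\<exists>y. (y, x) \<in> limit_rel \<omega>"
proof -
  have "x \<in> Domain (stage R \<omega> (Suc (2 * to_nat x)))" by (auto simp: half_step_def)
  then show "\<exists>y. (x, y) \<in> limit_rel \<omega>" unfolding limit_rel_def by blast
  have "x \<in> Range (stage R \<omega> (Suc (Suc (2 * to_nat x))))"
    unfolding stage.simps(2)[of _ _ "Suc (2 * to_nat x)"] by (auto simp: half_step_def simp del: stage.simps)
  then show "\<exists>y. (y, x) \<in> limit_rel \<omega>" unfolding limit_rel_def by blast
qed

definition random_aut :: "(nat \<Rightarrow> nat) \<Rightarrow> 'v \<Rightarrow> 'v" where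
  "random_aut \<omega> x = (SOME y. (x, y) \<in> limit_rel \<omega>)"

lemma random_aut_rel: "(x, random_aut \<omega> x) \<in> limit_rel \<omega>"
  using limit_rel_total(1) unfolding random_aut_def by (rule someI_ex)

lemma random_aut_eq: "random_aut \<omega> x = y \<longleftrightarrow> (x, y) \<in> limit_rel \<omega>"
  using random_aut_rel limit_rel_iso by blast

lemma random_aut_carrier: "random_aut \<omega> \<in> carrier (Aut R)"
proof -
  have "bij (random_aut \<omega>)"
  proof (rule bijI')
    show "random_aut \<omega> x = random_aut \<omega> y \<longleftrightarrow> x = y" for x y
      using limit_rel_iso[OF random_aut_rel random_aut_rel] by blast
    show "\<exists>x. y = random_aut \<omega> x" for y
      using limit_rel_total(2)[of y \<omega>] random_aut_eq by metis
  qed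
  moreover have "R (random_aut \<omega> x) (random_aut \<omega> y) \<longleftrightarrow> R x y" for x y
    using limit_rel_iso[OF random_aut_rel random_aut_rel] by blast
  ultimately show ?thesis by (simp add: Aut_iff)
qed

lemma random_aut_measurable: "random_aut \<in> measurable choices (borel_of (Aut_topology R))"
proof (rule measurable_into_Aut[OF random_aut_carrier])
  fix v w
  have "{\<omega> \<in> space choices. random_aut \<omega> v = w} = (\<Union>n. {\<omega>. (v, w) \<in> stage R \<omega> n})"
    unfolding random_aut_eq limit_rel_def space_choices by blast
  also have "\<dots> \<in> sets choices"
    using sets_depends[OF depends_stage] by (intro sets.countable_UN) auto
  finally show "{\<omega> \<in> space choices. random_aut \<omega> v = w} \<in> sets choices" .
qed

section \<open>Chains of the product with a fixed automorphism\<close>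

context
  fixes h :: "'v \<Rightarrow> 'v"
  assumes h: "h \<in> carrier (Aut R)"
begin

text \<open>The part of the graph of \<open>random_aut \<omega> \<circ> h\<close> that is decided
  before choice \<open>n\<close> is made.\<close>

definition moves :: "(nat \<Rightarrow> nat) \<Rightarrow> nat \<Rightarrow> ('v \<times> 'v) set" where
  "moves \<omega> n = {(x, b). (h x, b) \<in> stage R \<omega> n}"

text \<open>\<open>hit n u\<close>: at stage \<open>n\<close> the randomly chosen vertex links up with the chain of \<^term>\<open>u\<close>. As that chain has
  one start and one end, at most one of the \<open>2 ^ n\<close> options does so.\<close>

definition hit :: "nat \<Rightarrow> 'v \<Rightarrow> (nat \<Rightarrow> nat) \<Rightarrow> bool" where
  "hit n u \<omega> \<longleftrightarrow> (let G = stage R \<omega> n; a = from_nat (n div 2) in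
    if even n then a \<notin> Domain G \<and> (fresh_values R G a (\<omega> n), u) \<in> (moves \<omega> n)\<^sup>*
    else a \<notin> Range G \<and> (u, inv_into UNIV h (fresh_values R (G\<inverse>) a (\<omega> n))) \<in> (moves \<omega> n)\<^sup>*)"

lemma bij_h: "bij h"
  using h by (simp add: Aut_iff)

lemma moves_cong: "(\<forall>i<n. \<omega> i = \<omega>' i) \<Longrightarrow> moves \<omega> n = moves \<omega>' n"
  unfolding moves_def by (metis stage_cong)

lemma moves_single: "single_valued (moves \<omega> n)" "single_valued ((moves \<omega> n)\<inverse>)"
proof -
  have iso: "x = x' \<longleftrightarrow> y = y'" if "(x, y) \<in> stage R \<omega> n" "(x', y') \<in> stage R \<omega> n" for x y x' y'
    using partial_iso_stage that unfolding partial_iso_def by blast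
  have h_eq: "h x = h y \<longleftrightarrow> x = y" for x y using bij_h by (simp add: bij_is_inj inj_eq)
  show "single_valued (moves \<omega> n)" using iso unfolding single_valued_def moves_def by blast
  show "single_valued ((moves \<omega> n)\<inverse>)" using iso h_eq unfolding single_valued_def moves_def by blast
qed

lemma finite_moves: "finite (moves \<omega> n)"
proof -
  have "moves \<omega> n = (\<lambda>(a, b). (inv_into UNIV h a, b)) ` stage R \<omega> n"
    using bij_h by (force simp: moves_def bij_is_inj bij_is_surj surj_f_inv_f image_iff)
  then show ?thesis using partial_iso_stage by (simp add: partial_iso_def)
qed

lemma moves_mono: "m \<le> n \<Longrightarrow> moves \<omega> m \<subseteq> moves \<omega> n"
  using stage_mono[of m n R \<omega>] unfolding moves_def by blast

lemma depends_hit: "depends (Suc n) (hit n u)"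
  unfolding depends_def
proof (intro allI impI)
  fix \<omega> \<omega>' :: "nat \<Rightarrow> nat" assume "\<forall>i<Suc n. \<omega> i = \<omega>' i"
  then have "stage R \<omega> n = stage R \<omega>' n" "moves \<omega> n = moves \<omega>' n" "\<omega> n = \<omega>' n"
    using stage_cong[of n \<omega> \<omega>' R] moves_cong[of n \<omega> \<omega>'] by auto
  then show "hit n u \<omega> = hit n u \<omega>'" by (simp add: hit_def)
qed

text \<open>Backward paths cannot branch, so one of \<open>b\<close>, \<open>b'\<close> leads to the
  other; unless they coincide, the later one would lie in the range.\<close>

lemma start_unique:
  assumes "single_valued (r\<inverse>)" "(b, u) \<in> r\<^sup>*" "(b', u) \<in> r\<^sup>*" "b \<notin> Range r" "b' \<notin> Range r"
  shows "b = b'"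
proof -
  have "(u, b) \<in> (r\<inverse>)\<^sup>*" "(u, b') \<in> (r\<inverse>)\<^sup>*" using assms(2,3) by (simp_all add: rtrancl_converse)
  from single_valued_confluent[OF assms(1) this] have "(b, b') \<in> r\<^sup>* \<or> (b', b) \<in> r\<^sup>*"
    by (auto simp: rtrancl_converse)
  then show ?thesis using assms(4,5) by (metis Range.RangeI rtranclE)
qed

text \<open>At even stages the fresh vertex has no predecessor, at odd stages its
  \<open>h\<close>-preimage has no successor. The odd case is the even one for the converse
  relation.\<close>

lemma hit_unique:
  assumes hit: "hit n u \<omega>" "hit n u \<omega>'" and eq: "\<forall>i<n. \<omega> i = \<omega>' i"
  shows "\<omega> n = \<omega>' n"
proof -
  let ?G = "stage R \<omega> n" and ?a = "from_nat (n div 2) :: 'v" and ?Q = "moves \<omega> n"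
  have G': "stage R \<omega>' n = ?G" "moves \<omega>' n = ?Q" using stage_cong[OF eq] moves_cong[OF eq] by auto
  have iso: "partial_iso R ?G" "partial_iso R (?G\<inverse>)" using partial_iso_stage by (auto simp: partial_iso_converse)
  show ?thesis
  proof (cases "even n")
    case True
    let ?o = "fresh_values R ?G ?a"
    have a: "?a \<notin> Domain ?G" "(?o (\<omega> n), u) \<in> ?Q\<^sup>*" "(?o (\<omega>' n), u) \<in> ?Q\<^sup>*"
      using hit True G' by (simp_all add: hit_def Let_def)
    have "?o i \<notin> Range ?Q" for i
      using fresh_values(2)[OF R iso(1) a(1), of i] by (auto simp: moves_def)
    then have "?o (\<omega> n) = ?o (\<omega>' n)" using start_unique[OF moves_single(2) a(2,3)] by blast
    then show ?thesis using fresh_values(1)[OF R iso(1) a(1)] by (simp add: inj_eq)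
  next
    case False
    let ?o = "fresh_values R (?G\<inverse>) ?a" and ?i = "inv_into UNIV h"
    have a: "?a \<notin> Domain (?G\<inverse>)" "(u, ?i (?o (\<omega> n))) \<in> ?Q\<^sup>*" "(u, ?i (?o (\<omega>' n))) \<in> ?Q\<^sup>*"
      using hit False G' by (simp_all add: hit_def Let_def)
    have "?i (?o i) \<notin> Range (?Q\<inverse>)" for i
      using fresh_values(2)[OF R iso(2) a(1), of i] bij_h
      by (auto simp: moves_def bij_is_surj surj_f_inv_f)
    moreover have "single_valued ((?Q\<inverse>)\<inverse>)" using moves_single(1) by simp
    ultimately have "?i (?o (\<omega> n)) = ?i (?o (\<omega>' n))"
      using start_unique[of "?Q\<inverse>" "?i (?o (\<omega> n))" u "?i (?o (\<omega>' n))"] a(2,3) by (simp add: rtrancl_converse)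
    then have "?o (\<omega> n) = ?o (\<omega>' n)" using bij_h by (metis bij_inv_eq_iff)
    then show ?thesis using fresh_values(1)[OF R iso(2) a(1)] by (simp add: inj_eq)
  qed
qed

lemma prob_hit: "measure choices {\<omega>. hit n u \<omega>} \<le> (1/2) ^ n"
  by (rule prob_forced_choice[OF depends_hit[of n u]]) (rule hit_unique[of n u])

text \<open>Keeps of a new edge only what later arguments use: which endpoint is not random, and
  that a chain reached through the random endpoint has been hit.\<close>

lemma moves_Suc:
  obtains "moves \<omega> (Suc n) = moves \<omega> n"
  | p b where "moves \<omega> (Suc n) = insert (p, b) (moves \<omega> n)" "even n" "p = inv_into UNIV h (from_nat (n div 2))"
    "\<And>u. (b, u) \<in> (moves \<omega> n)\<^sup>* \<Longrightarrow> hit n u \<omega>"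
  | p b where "moves \<omega> (Suc n) = insert (p, b) (moves \<omega> n)" "odd n" "b = from_nat (n div 2)"
    "\<And>u. (u, p) \<in> (moves \<omega> n)\<^sup>* \<Longrightarrow> hit n u \<omega>"
proof -
  let ?G = "stage R \<omega> n" and ?a = "from_nat (n div 2) :: 'v"
  have ins: "{(x, y). (h x, y) \<in> insert (a, b) ?G} = insert (inv_into UNIV h a, b) (moves \<omega> n)" for a b
    using bij_h by (auto simp: moves_def bij_is_inj bij_is_surj surj_f_inv_f)
  consider "?a \<in> Domain ?G" "even n" | "?a \<in> Range ?G" "odd n" | "?a \<notin> Domain ?G" "even n" | "?a \<notin> Range ?G" "odd n"
    by blast
  then show thesis
  proof cases
    case 1
    then show thesis using that(1) by (simp add: moves_def half_step_def)
  next
    case 2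
    then show thesis using that(1) by (simp add: moves_def half_step_def)
  next
    case 3
    then have "stage R \<omega> (Suc n) = insert (?a, fresh_values R ?G ?a (\<omega> n)) ?G"
      by (simp add: half_step_def)
    then have "moves \<omega> (Suc n) = insert (inv_into UNIV h ?a, fresh_values R ?G ?a (\<omega> n)) (moves \<omega> n)"
      using ins unfolding moves_def[of \<omega> "Suc n"] by simp
    then show thesis using that(2) 3 by (simp add: hit_def Let_def)
  next
    case 4
    let ?c = "fresh_values R (?G\<inverse>) ?a (\<omega> n)"
    have "stage R \<omega> (Suc n) = insert (?c, ?a) ?G"
      using 4 by (auto simp: half_step_def)
    then have "moves \<omega> (Suc n) = insert (inv_into UNIV h ?c, ?a) (moves \<omega> n)"
      using ins unfolding moves_def[of \<omega> "Suc n"] by simp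
    then show thesis using that(3) 4 by (simp add: hit_def Let_def)
  qed
qed

text \<open>A path through the new edge joins the random endpoint to \<open>v\<close> at an even
  stage and to \<open>u\<close> at an odd one; either is a hit.\<close>

lemma no_link:
  assumes "\<not> hit n u \<omega>" "\<not> hit n v \<omega>" "(u, v) \<notin> (moves \<omega> n)\<^sup>*"
  shows "(u, v) \<notin> (moves \<omega> (Suc n))\<^sup>*"
  by (rule moves_Suc[of \<omega> n]) (use assms in \<open>auto simp: rtrancl_insert\<close>)

text \<open>The deterministic endpoint of the edge added at stage \<open>n\<close>: the edge closes a cycle only by hitting
  its chain.\<close>

definition closing_point :: "nat \<Rightarrow> 'v" where
  "closing_point n = (if even n then inv_into UNIV h (from_nat (n div 2)) else from_nat (n div 2))"

lemma no_new_cycle: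
  assumes "\<not> hit n (closing_point n) \<omega>" "(x, x) \<in> (moves \<omega> (Suc n))\<^sup>+"
  shows "(x, x) \<in> (moves \<omega> n)\<^sup>+"
proof (rule moves_Suc[of \<omega> n])
  assume "moves \<omega> (Suc n) = moves \<omega> n"
  then show ?thesis using assms(2) by simp
next
  fix p b assume a: "moves \<omega> (Suc n) = insert (p, b) (moves \<omega> n)" "even n" "p = inv_into UNIV h (from_nat (n div 2))"
    "\<And>u. (b, u) \<in> (moves \<omega> n)\<^sup>* \<Longrightarrow> hit n u \<omega>"
  have "\<not> (b, p) \<in> (moves \<omega> n)\<^sup>*" using a assms(1) by (auto simp: closing_point_def)
  then show ?thesis using assms(2) unfolding a(1) trancl_insert by (auto intro: rtrancl_trans)
next
  fix p b assume a: "moves \<omega> (Suc n) = insert (p, b) (moves \<omega> n)" "odd n" "b = from_nat (n div 2)"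
    "\<And>u. (u, p) \<in> (moves \<omega> n)\<^sup>* \<Longrightarrow> hit n u \<omega>"
  have "\<not> (b, p) \<in> (moves \<omega> n)\<^sup>*" using a assms(1) by (auto simp: closing_point_def)
  then show ?thesis using assms(2) unfolding a(1) trancl_insert by (auto intro: rtrancl_trans)
qed

lemma power_moves: "\<exists>n. (x, ((random_aut \<omega> \<circ> h) ^^ m) x) \<in> (moves \<omega> n)\<^sup>*"
proof (induction m)
  case 0
  then show ?case by simp
next
  case (Suc m)
  let ?y = "((random_aut \<omega> \<circ> h) ^^ m) x"
  obtain n where n: "(x, ?y) \<in> (moves \<omega> n)\<^sup>*" using Suc by blast
  obtain n' where n': "(h ?y, random_aut \<omega> (h ?y)) \<in> stage R \<omega> n'"
    using random_aut_rel[of "h ?y" \<omega>] unfolding limit_rel_def by blast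
  let ?N = "max n n'"
  have "(x, ?y) \<in> (moves \<omega> ?N)\<^sup>*" using n rtrancl_mono[OF moves_mono[of n ?N \<omega>]] by auto
  moreover have "(?y, random_aut \<omega> (h ?y)) \<in> moves \<omega> ?N"
    using n' moves_mono[of n' ?N \<omega>] by (auto simp: moves_def)
  ultimately have "(x, random_aut \<omega> (h ?y)) \<in> (moves \<omega> ?N)\<^sup>*" by (rule rtrancl_into_rtrancl)
  then show ?case unfolding funpow.simps(2) comp_apply by blast
qed

text \<open>A periodic point lies on a cycle of some \<open>moves \<omega> k\<close>. If no stage
  from \<open>N\<close> on closes a cycle, that cycle is already present in the finite relation
  \<open>moves \<omega> N\<close>.\<close>

lemma AE_finite_periodic: "AE \<omega> in choices. finite (periodic_points (random_aut \<omega> \<circ> h))"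
proof -
  have "AE \<omega> in choices. \<exists>N. \<forall>n\<ge>N. \<not> hit n (closing_point n) \<omega>"
  proof (rule AE_tail_choices[where c = 1])
    show "{\<omega>. hit n (closing_point n) \<omega>} \<in> sets choices" for n
      by (rule sets_depends[OF depends_hit])
    show "measure choices {\<omega>. hit n (closing_point n) \<omega>} \<le> 1 * (1/2) ^ n" for n
      using prob_hit by simp
  qed
  then show ?thesis
  proof (rule AE_mp, intro AE_I2 impI)
    fix \<omega> assume "\<exists>N. \<forall>n\<ge>N. \<not> hit n (closing_point n) \<omega>"
    then obtain N where N: "\<And>n. n \<ge> N \<Longrightarrow> \<not> hit n (closing_point n) \<omega>" by blast
    let ?f = "random_aut \<omega> \<circ> h"
    have "x \<in> Field (moves \<omega> N)" if x: "x \<in> periodic_points ?f" for x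
    proof -
      obtain m where m: "(?f ^^ Suc m) x = x"
        using x by (auto simp: periodic_points_def gr0_conv_Suc)
      obtain n where n: "(?f x, (?f ^^ m) (?f x)) \<in> (moves \<omega> n)\<^sup>*" using power_moves by blast
      have "(?f ^^ m) (?f x) = x" using m by (metis comp_apply funpow_Suc_right)
      with n have n: "(?f x, x) \<in> (moves \<omega> n)\<^sup>*" by simp
      obtain n' where n': "(h x, ?f x) \<in> stage R \<omega> n'"
        using random_aut_rel[of "h x" \<omega>] unfolding limit_rel_def by auto
      let ?k = "max N (max n n')"
      have k: "n \<le> ?k" "n' \<le> ?k" by simp_all
      have "(?f x, x) \<in> (moves \<omega> ?k)\<^sup>*" using n rtrancl_mono[OF moves_mono[OF k(1)]] by blast
      moreover have "(x, ?f x) \<in> moves \<omega> ?k"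
        using subsetD[OF stage_mono[OF k(2)] n'] by (simp add: moves_def)
      ultimately have "(x, x) \<in> (moves \<omega> ?k)\<^sup>+" by (rule rtrancl_into_trancl2[rotated])
      moreover have "(x, x) \<in> (moves \<omega> N)\<^sup>+" if "(x, x) \<in> (moves \<omega> j)\<^sup>+" "N \<le> j" for j
        using that(2,1)
      proof (induction j rule: dec_induct)
        case (step j)
        then show ?case using no_new_cycle[OF N[of j]] by simp
      qed
      ultimately have "(x, x) \<in> (moves \<omega> N)\<^sup>+" using max.cobounded1[of N "max n n'"] by blast
      then obtain z where "(x, z) \<in> moves \<omega> N" using tranclD by fast
      then show ?thesis by (rule FieldI1)
    qed
    then have "periodic_points ?f \<subseteq> Field (moves \<omega> N)" by (rule subsetI)
    then show "finite (periodic_points ?f)" by (rule finite_subset[OF _ finite_Field[OF finite_moves]])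
  qed
qed

text \<open>The candidate \<open>V \<omega> N\<close> has the required type and is untouched up to
  stage \<open>N\<close>, so at first it has no link to \<open>F\<close>; if neither it nor
  \<open>F\<close> is hit from \<open>N\<close> on, none ever arises. The candidate changes with
  \<open>N\<close>, which is why the tail lemma allows events that depend on the starting
  time.\<close>

lemma AE_type_off_orbits:
  assumes F: "finite F"
  shows "AE \<omega> in choices. \<exists>v. (\<forall>x\<in>F. R x v \<longleftrightarrow> t x) \<and>
    (\<forall>n. \<forall>u\<in>F. ((random_aut \<omega> \<circ> h) ^^ n) u \<noteq> v \<and> ((random_aut \<omega> \<circ> h) ^^ n) v \<noteq> u)"
proof -
  interpret prob_space choices by (rule prob_space_choices)
  define V where "V \<omega> N = (SOME v. v \<notin> F \<union> Field (moves \<omega> N) \<and> (\<forall>x\<in>F. R x v \<longleftrightarrow> t x))" for \<omega> N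
  have V: "V \<omega> N \<notin> F \<union> Field (moves \<omega> N) \<and> (\<forall>x\<in>F. R x (V \<omega> N) \<longleftrightarrow> t x)" for \<omega> N
    unfolding V_def
    by (rule someI_ex, rule random_graph_type[OF R F]) (use F finite_Field[OF finite_moves] in simp)
  have V_cong: "V \<omega> N = V \<omega>' N" if "\<forall>i<N. \<omega> i = \<omega>' i" for \<omega> \<omega>' N
    using moves_cong[OF that] by (simp add: V_def)
  \<comment> \<open>Coordinates before \<open>N\<close> already determine the candidate, so at stage
    \<open>n\<close> it counts as a fixed target.\<close>
  have depV: "depends (Suc n) (\<lambda>\<omega>. hit n (V \<omega> N) \<omega>)" if "N \<le> n" for N n
    unfolding depends_def
  proof (intro allI impI)
    fix \<omega> \<omega>' :: "nat \<Rightarrow> nat" assume eq: "\<forall>i<Suc n. \<omega> i = \<omega>' i"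
    then have "V \<omega> N = V \<omega>' N" using that by (intro V_cong) auto
    then show "hit n (V \<omega> N) \<omega> = hit n (V \<omega>' N) \<omega>'"
      using depends_hit[of n "V \<omega> N"] eq unfolding depends_def by metis
  qed
  have uniqV: "\<omega> n = \<omega>' n" if "N \<le> n" "hit n (V \<omega> N) \<omega>" "hit n (V \<omega>' N) \<omega>'" "\<forall>i<n. \<omega> i = \<omega>' i" for N n \<omega> \<omega>'
  proof -
    have "V \<omega> N = V \<omega>' N" using that by (intro V_cong) auto
    then show ?thesis using hit_unique[of n "V \<omega> N"] that by simp
  qed
  let ?D = "\<lambda>N n \<omega>. hit n (V \<omega> N) \<omega> \<or> (\<exists>u\<in>F. hit n u \<omega>)"
  have eq: "{\<omega>. ?D N n \<omega>} = {\<omega>. hit n (V \<omega> N) \<omega>} \<union> (\<Union>u\<in>F. {\<omega>. hit n u \<omega>})" for N n by blast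
  have sH: "{\<omega>. hit n u \<omega>} \<in> sets choices" for n u by (rule sets_depends[OF depends_hit])
  have sU: "(\<Union>u\<in>F. {\<omega>. hit n u \<omega>}) \<in> sets choices" for n using sH F by (intro sets.finite_UN) auto
  have "AE \<omega> in choices. \<exists>N. \<forall>n\<ge>N. \<not> ?D N n \<omega>"
  \<comment> \<open>One target for the candidate and \<open>card F\<close> for the points of
    \<open>F\<close>.\<close>
  proof (rule AE_tail_choices[where c = "1 + real (card F)"])
    fix N n :: nat assume Nn: "N \<le> n"
    have sV: "{\<omega>. hit n (V \<omega> N) \<omega>} \<in> sets choices" by (rule sets_depends[OF depV[OF Nn]])
    show "{\<omega>. ?D N n \<omega>} \<in> sets choices" unfolding eq using sV sU by (rule sets.Un)
    have "prob {\<omega>. ?D N n \<omega>} \<le> prob {\<omega>. hit n (V \<omega> N) \<omega>} + prob (\<Union>u\<in>F. {\<omega>. hit n u \<omega>})"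
      unfolding eq using sV sU by (rule measure_Un_le)
    also have "prob {\<omega>. hit n (V \<omega> N) \<omega>} \<le> (1/2) ^ n"
      by (rule prob_forced_choice[OF depV[OF Nn]]) (rule uniqV[OF Nn])
    also have "prob (\<Union>u\<in>F. {\<omega>. hit n u \<omega>}) \<le> (\<Sum>u\<in>F. prob {\<omega>. hit n u \<omega>})"
      using F sH by (intro finite_measure_subadditive_finite) auto
    also have "\<dots> \<le> (\<Sum>u\<in>F. (1/2) ^ n)"
      by (intro sum_mono prob_hit)
    finally show "prob {\<omega>. ?D N n \<omega>} \<le> (1 + real (card F)) * (1/2) ^ n"
      by (simp add: algebra_simps)
  qed
  then show ?thesis
  proof (rule AE_mp, intro AE_I2 impI)
    fix \<omega> assume "\<exists>N. \<forall>n\<ge>N. \<not> ?D N n \<omega>"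
    then obtain N where N: "\<And>n u. n \<ge> N \<Longrightarrow> u \<in> insert (V \<omega> N) F \<Longrightarrow> \<not> hit n u \<omega>" by blast
    let ?v = "V \<omega> N" and ?f = "random_aut \<omega> \<circ> h"
    have off: "(a, b) \<notin> (moves \<omega> n)\<^sup>*"
      if "a = ?v \<and> b \<in> F \<or> a \<in> F \<and> b = ?v" for a b n
    proof -
      have 0: "(a, b) \<notin> (moves \<omega> N)\<^sup>*"
      proof
        assume "(a, b) \<in> (moves \<omega> N)\<^sup>*"
        then have "a = b \<or> a \<in> Field (moves \<omega> N) \<and> b \<in> Field (moves \<omega> N)"
          by (metis FieldI1 FieldI2 converse_rtranclE rtranclE)
        then show False using V[of \<omega> N] that by auto
      qed
      have up: "(a, b) \<notin> (moves \<omega> j)\<^sup>*" if "N \<le> j" for j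
        using that
      proof (induction j rule: dec_induct)
        case base
        then show ?case using 0 .
      next
        case (step j)
        then show ?case using no_link[OF N[of j a] N[of j b]] \<open>a = ?v \<and> b \<in> F \<or> a \<in> F \<and> b = ?v\<close> by auto
      qed
      show ?thesis
        using up[of "max N n"] rtrancl_mono[OF moves_mono[of n "max N n" \<omega>]] by auto
    qed
    have "(?f ^^ m) u \<noteq> ?v \<and> (?f ^^ m) ?v \<noteq> u" if "u \<in> F" for m u
    proof
      obtain n where n: "(u, (?f ^^ m) u) \<in> (moves \<omega> n)\<^sup>*" using power_moves by blast
      then show "(?f ^^ m) u \<noteq> ?v" using off[of u ?v n] that by auto
      obtain n where n: "(?v, (?f ^^ m) ?v) \<in> (moves \<omega> n)\<^sup>*" using power_moves by blast
      then show "(?f ^^ m) ?v \<noteq> u" using off[of ?v u n] that by auto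
    qed
    then show "\<exists>v. (\<forall>x\<in>F. R x v \<longleftrightarrow> t x) \<and> (\<forall>n. \<forall>u\<in>F. (?f ^^ n) u \<noteq> v \<and> (?f ^^ n) v \<noteq> u)"
      using V[of \<omega> N] by blast
  qed
qed

lemma AE_good: "AE \<omega> in choices. good R (random_aut \<omega> \<circ> h)"
proof -
  \<comment> \<open>Pairs of lists code the finite types, \<open>ys\<close> naming the points where
    adjacency is wanted. Being countably many, they can be quantified inside the almost sure
    statement.\<close>
  have "AE \<omega> in choices. \<forall>xs ys. \<exists>v. (\<forall>x\<in>set xs. R x v \<longleftrightarrow> x \<in> set ys) \<and>
    (\<forall>n. \<forall>u\<in>set xs. ((random_aut \<omega> \<circ> h) ^^ n) u \<noteq> v \<and> ((random_aut \<omega> \<circ> h) ^^ n) v \<noteq> u)"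
    unfolding AE_all_countable by (intro allI AE_type_off_orbits) simp
  with AE_finite_periodic show ?thesis
  proof (eventually_elim)
    fix \<omega>
    let ?f = "random_aut \<omega> \<circ> h"
    assume fin: "finite (periodic_points ?f)"
      and t: "\<forall>xs ys. \<exists>v. (\<forall>x\<in>set xs. R x v \<longleftrightarrow> x \<in> set ys) \<and>
        (\<forall>n. \<forall>u\<in>set xs. (?f ^^ n) u \<noteq> v \<and> (?f ^^ n) v \<noteq> u)"
    have f: "?f \<in> carrier (Aut R)" by (rule Aut_comp[OF random_aut_carrier h])
    have "extension_off_orbits R ?f"
      unfolding extension_off_orbits_iff[OF f]
    proof (intro allI impI)
      fix F :: "'v set" and t' assume F: "finite F"
      obtain xs ys where xs: "set xs = F" "set ys = {x \<in> F. t' x}"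
        using F finite_list[of F] finite_list[of "{x \<in> F. t' x}"] by auto
      obtain v where "\<forall>x\<in>F. R x v \<longleftrightarrow> x \<in> {x \<in> F. t' x}" "\<forall>n. \<forall>u\<in>F. (?f ^^ n) u \<noteq> v \<and> (?f ^^ n) v \<noteq> u"
        using spec[OF spec[OF t, of xs], of ys] unfolding xs by (elim exE conjE)
      then show "\<exists>v. (\<forall>x\<in>F. R x v \<longleftrightarrow> t' x) \<and> (\<forall>n. \<forall>u\<in>F. (?f ^^ n) u \<noteq> v \<and> (?f ^^ n) v \<noteq> u)"
        by (intro exI[of _ v]) simp
    qed
    then show "good R ?f"
      using fin finitely_many_finite_orbits_iff[OF f] by (simp add: good_def)
  qed
qed

end

end

section \<open>Non-Haar null conjugacy classes\<close>

text \<open>For \<open>x = g \<circ> f \<circ> h\<close> the map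
  \<open>x \<circ> h\<inverse> \<circ> g\<inverse>\<close> is the conjugate of \<open>f\<close> by
  \<open>g\<close>. Goodness being conjugation invariant, two-sided translates reduce to composition
  with one fixed automorphism on the right.\<close>

lemma translate_not_good:
  assumes g: "g \<in> carrier (Aut R)" and h: "h \<in> carrier (Aut R)"
  shows "two_sided_translate (Aut R) g {f \<in> carrier (Aut R). \<not> good R f} h =
    {x \<in> carrier (Aut R). \<not> good R (x \<circ> (inv_into UNIV h \<circ> inv_into UNIV g))}"
    (is "?L = ?R")
proof
  let ?c = "inv_into UNIV h \<circ> inv_into UNIV g"
  have bg: "bij g" and bh: "bij h" using g h by (simp_all add: Aut_iff)
  have gi: "inv_into UNIV g \<in> carrier (Aut R)" and hi: "inv_into UNIV h \<in> carrier (Aut R)"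
    using Aut_inv_carrier g h by blast+
  have c: "?c \<in> carrier (Aut R)" using Aut_comp[OF hi gi] .
  have inv: "inv_into UNIV g (g x) = x" "g (inv_into UNIV g x) = x"
    "inv_into UNIV h (h x) = x" "h (inv_into UNIV h x) = x" for x
    using bg bh by (simp_all add: bij_is_inj bij_is_surj surj_f_inv_f)
  show "?L \<subseteq> ?R"
  proof
    fix x assume "x \<in> ?L"
    then obtain f where f: "f \<in> carrier (Aut R)" "\<not> good R f" "x = g \<circ> f \<circ> h"
      by (auto simp: two_sided_translate_def Aut_mult)
    have x: "x \<in> carrier (Aut R)" unfolding f(3) by (intro Aut_comp g f(1) h)
    have "good R f" if "good R (x \<circ> ?c)"
      by (rule good_conj[OF Aut_comp[OF x c] f(1) gi _ that]) (simp add: f(3) inv)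
    then show "x \<in> ?R" using x f(2) by blast
  qed
  show "?R \<subseteq> ?L"
  proof
    fix x assume x: "x \<in> ?R"
    define f where "f = inv_into UNIV g \<circ> x \<circ> inv_into UNIV h"
    have fc: "f \<in> carrier (Aut R)" unfolding f_def using x by (intro Aut_comp gi hi) simp
    have xc: "x \<circ> ?c \<in> carrier (Aut R)" using x by (intro Aut_comp c) simp
    have "good R (x \<circ> ?c)" if "good R f"
      by (rule good_conj[OF fc xc g _ that]) (simp add: f_def inv)
    then have "f \<in> {f \<in> carrier (Aut R). \<not> good R f}" using x fc by blast
    moreover have "x = g \<circ> f \<circ> h" by (simp add: f_def fun_eq_iff inv)
    ultimately show "x \<in> ?L" unfolding two_sided_translate_def Aut_mult by blast
  qed
qed

text \<open>The law of the random automorphism is a single witness for all translates, because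
  \<open>AE_good\<close> holds for every fixed automorphism on the right.\<close>

lemma not_good_borel_haar_null:
  fixes R :: "'v::countable \<Rightarrow> 'v \<Rightarrow> bool"
  assumes R: "random_graph R"
  shows "borel_haar_null (Aut R) (Aut_topology R) {f \<in> carrier (Aut R). \<not> good R f}"
proof -
  let ?M = "borel_of (Aut_topology R)" and ?B = "{f \<in> carrier (Aut R). \<not> good R f}"
  let ?\<mu> = "distr choices ?M (random_aut R)"
  note rm = random_aut_measurable[OF R]
  have B: "?B \<in> sets ?M"
  proof -
    have "space ?M - {f \<in> carrier (Aut R). good R f} \<in> sets ?M" by (rule sets.compl_sets[OF sets_good])
    moreover have "space ?M - {f \<in> carrier (Aut R). good R f} = ?B" unfolding space_borel_Aut by blast
    ultimately show ?thesis by simp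
  qed
  have "prob_space ?\<mu>" by (rule prob_space.prob_space_distr[OF prob_space_choices rm])
  moreover have "two_sided_translate (Aut R) g ?B h \<in> null_sets ?\<mu>"
    if g: "g \<in> carrier (Aut R)" and h: "h \<in> carrier (Aut R)" for g h
  proof -
    let ?c = "inv_into UNIV h \<circ> inv_into UNIV g"
    let ?T = "{x \<in> carrier (Aut R). \<not> good R (x \<circ> ?c)}"
    have c: "?c \<in> carrier (Aut R)" using Aut_comp[OF Aut_inv_carrier[OF h] Aut_inv_carrier[OF g]] .
    have "(\<lambda>x. x \<circ> ?c) \<in> measurable ?M ?M"
    proof (rule measurable_into_Aut)
      show "x \<circ> ?c \<in> carrier (Aut R)" if "x \<in> space ?M" for x
        using that unfolding space_borel_Aut by (rule Aut_comp[OF _ c])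
      show "{x \<in> space ?M. (x \<circ> ?c) v = w} \<in> sets ?M" for v w
        using pred_eval[where R = R and v = "?c v" and w = w] unfolding pred_def by simp
    qed
    from measurable_sets[OF this B] have "(\<lambda>x. x \<circ> ?c) -` ?B \<inter> space ?M \<in> sets ?M" .
    moreover have "(\<lambda>x. x \<circ> ?c) -` ?B \<inter> space ?M = ?T"
      unfolding space_borel_Aut using Aut_comp[OF _ c] by auto
    ultimately have T: "?T \<in> sets ?M" by simp
    have pre: "random_aut R -` ?T \<inter> space choices = {\<omega> \<in> space choices. \<not> good R (random_aut R \<omega> \<circ> ?c)}"
      using random_aut_carrier[OF R] by auto
    have "random_aut R -` ?T \<inter> space choices \<in> null_sets choices"
    proof -
      have m: "{\<omega> \<in> space choices. \<not> good R (random_aut R \<omega> \<circ> ?c)} \<in> sets choices"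
        using measurable_sets[OF rm T] unfolding pre .
      show ?thesis unfolding pre using AE_good[OF R c] by (rule AE_iff_null[OF m, THEN iffD1])
    qed
    then have "?T \<in> null_sets ?\<mu>" using null_sets_distr_iff[OF rm] T by blast
    then show ?thesis unfolding translate_not_good[OF g h] .
  qed
  ultimately show ?thesis
    unfolding borel_haar_null_def using B by (intro conjI exI[of _ ?\<mu>] ballI) auto
qed

theorem theorem2p23:
  fixes R :: "'v::countable \<Rightarrow> 'v \<Rightarrow> bool"
  assumes "random_graph R"
  shows "co_haar_null (Aut R) (Aut_topology R)
      {f \<in> carrier (Aut R). extension_off_orbits R f \<and> finitely_many_finite_orbits R f} \<and>
    (\<forall>C\<in>conjugacy_classes (Aut R).
      (\<not> haar_null (Aut R) (Aut_topology R) C \<longleftrightarrow>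
        (\<exists>f\<in>C. extension_off_orbits R f \<and> finitely_many_finite_orbits R f)) \<and>
      (\<not> haar_null (Aut R) (Aut_topology R) C \<longleftrightarrow>
        (\<forall>f\<in>C. extension_off_orbits R f \<and> finitely_many_finite_orbits R f)) \<and>
      (\<not> haar_null (Aut R) (Aut_topology R) C \<longrightarrow>
        compact_biter (Aut R) (Aut_topology R) C) \<and>
      (\<not> haar_null (Aut R) (Aut_topology R) C \<and> (\<forall>f\<in>C. no_finite_orbits R f) \<longrightarrow>
        compact_catcher (Aut R) (Aut_topology R) C))"
  unfolding good_def[symmetric]
proof (intro conjI ballI)
  let ?null = "haar_null (Aut R) (Aut_topology R)"
  note bad = not_good_borel_haar_null[OF assms]
  have "carrier (Aut R) - {f \<in> carrier (Aut R). good R f} = {f \<in> carrier (Aut R). \<not> good R f}" by blast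
  then show "co_haar_null (Aut R) (Aut_topology R) {f \<in> carrier (Aut R). good R f}"
    unfolding co_haar_null_def haar_null_def using bad by auto
  fix C assume "C \<in> conjugacy_classes (Aut R)"
  then obtain f where f: "f \<in> carrier (Aut R)" and C: "C = conjugacy_class (Aut R) f"
    by (auto simp: conjugacy_classes_def)
  have fC: "f \<in> C"
  proof -
    have "id \<in> carrier (Aut R)" by (simp add: Aut_iff)
    moreover have "f = id \<otimes>\<^bsub>Aut R\<^esub> f \<otimes>\<^bsub>Aut R\<^esub> inv\<^bsub>Aut R\<^esub> id"
      using Aut_inv[OF calculation] by (simp add: Aut_mult)
    ultimately show ?thesis unfolding C conjugacy_class_def by blast
  qed
  have mem: "f' \<in> carrier (Aut R) \<and> (good R f' \<longleftrightarrow> good R f)" if f'C: "f' \<in> C" for f'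
  proof -
    obtain h where h: "h \<in> carrier (Aut R)" "f' = h \<otimes>\<^bsub>Aut R\<^esub> f \<otimes>\<^bsub>Aut R\<^esub> inv\<^bsub>Aut R\<^esub> h"
      using f'C unfolding C conjugacy_class_def by blast
    let ?i = "inv_into UNIV h"
    have i: "?i \<in> carrier (Aut R)" using Aut_inv_carrier[OF h(1)] .
    have "bij h" using h(1) by (simp add: Aut_iff)
    then have inv: "?i (h x) = x" "h (?i x) = x" for x
      by (simp_all add: bij_is_inj bij_is_surj surj_f_inv_f)
    have f': "f' = h \<circ> f \<circ> ?i" using h(2) Aut_inv[OF h(1)] by (simp add: Aut_mult)
    have c: "f' \<in> carrier (Aut R)" unfolding f' by (intro Aut_comp h(1) f i)
    have "good R f' \<Longrightarrow> good R f"
      by (rule good_conj[OF c f i]) (simp_all add: f' inv)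
    moreover have "good R f \<Longrightarrow> good R f'"
      by (rule good_conj[OF f c h(1)]) (simp_all add: f' inv)
    ultimately show ?thesis using c by blast
  qed
  \<comment> \<open>Goodness is constant on \<open>C\<close>, so \<open>C\<close> either consists of
    good elements or is contained in the null set of bad ones.\<close>
  have iff: "\<not> ?null C \<longleftrightarrow> good R f"
  proof
    assume "\<not> ?null C"
    moreover have "?null C" if "\<not> good R f"
      unfolding haar_null_def using bad mem that by (intro exI[of _ "{f \<in> carrier (Aut R). \<not> good R f}"]) blast
    ultimately show "good R f" by blast
  next
    assume "good R f"
    then show "\<not> ?null C" unfolding C by (rule conjugacy_class_not_haar_null[OF assms f])
  qed
  show "\<not> ?null C \<longleftrightarrow> (\<exists>f\<in>C. good R f)" "\<not> ?null C \<longleftrightarrow> (\<forall>f\<in>C. good R f)"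
    unfolding iff using mem fC by blast+
  show "\<not> ?null C \<longrightarrow> compact_biter (Aut R) (Aut_topology R) C"
    unfolding iff using conjugacy_class_biter[OF assms f] C by blast
  show "\<not> ?null C \<and> (\<forall>f\<in>C. no_finite_orbits R f) \<longrightarrow> compact_catcher (Aut R) (Aut_topology R) C"
    unfolding iff using conjugacy_class_catcher[OF assms f] C fC by blast
qed

end
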